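(* Let $1\le j\le n-1$ and $1\le i\le rj-1$, and let $\overline{h_{i,j}}=\overline{t^{-i}y^j}$ be the corresponding element of the basis of $H^1(X_0,\mathcal O_{X_0})$. Let $a$ be the quotient and $b$ the remainder of the Euclidean division of $pj$ by $n$. Put $F(t)=f(t)^a$, let $F[k]$ (resp. $f[k]$) denote the coefficient of $t^k$ in $F$ (resp. in $f$), and let $d=\deg(F)$. Then $1\le b\le n-1$ and $$P_2\bigl(\Phi(\overline{h_{i,j}})\bigr)=\sum_{m=0}^{r(n-b)-2}\left(\sum_{k=pi-d}^{rb-1}\frac{kn-b(m+k+1)}{n}\,F[pi-k]\,f[m+k+1]\right)\frac{t^m\,dt}{y^{n-b}}$$ in $H^0(X_0,\Omega^1_{X_0})$.
   Context: **Curve.** Let $p$ be a prime, $k$ a finite field of characteristic $p$, $W=W(k)$ its ring of Witt vectors, $W_1=W/p^2W$. Let $n\ge 1$ be an integer prime to $p$, $l\ge 1$ an integer with $l\equiv -1 \pmod n$ and $p\nmid l$, and $r=(l+1)/n$. Let $\mathbf f\in W[t]$ be a polynomial of degree $l$ such that $\mathbf f$ and its derivative $\mathbf f'$ generate the unit ideal of $W[t]$, and let $\mathbf f_2(s)=\mathbf f(1/s)s^{l+1}\in W[s]$. Write $f\in k[t]$, $f_2\in k[s]$ for their reductions modulo $p$; it is assumed that $\deg f=l$ and that $f(0)\neq 0$. $X$ is the curve over $\mathrm{Spec}(W)$ obtained by gluing $\mathrm{Spec}(W[t,y]/(y^n-\mathbf f(t)))$ and $\mathrm{Spec}(W[s,z]/(z^n-\mathbf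 f_2(s)))$ along $t\ne0$, $s\neq 0$ via $t=s^{-1}$, $z=s^ry$. Its special fibre $X_0$ over $k$ is the gluing of $\mathcal U=\mathrm{Spec}(k[t,y]/(y^n-f(t)))$ and $\mathcal V=\mathrm{Spec}(k[s,z]/(z^n-f_2(s)))$. Put $\overline{\mathcal U}=\mathcal U\cap D(y)$; then $X_0=\overline{\mathcal U}\cup\mathcal V$. Coefficients of a polynomial at indices that are negative or larger than the degree are $0$. **Bases.** $H^0(X_0,\Omega^1_{X_0})$ has $k$-basis $\omega_{i,j}=t^iy^{-j}dt$ ($1\le j\le n-1$, $0\le i\le rj-2$). $H^1(X_0,\mathcal O_{X_0})=\mathcal O_{X_0}(\overline{\mathcal U}\cap\mathcal V)/(\mathcal O_{X_0}(\overline{\mathcal U})+\mathcal O_{X_0}(\mathcal V))$ has $k$-basis the classes $\overline{h_{i,j}}$ of $h_{i,j}=t^{-i}y^j$ ($1\le j\le n-1$, $1\le i\le rj-1$); $\overline{x}$ denotes the class of $x\in \mathcal O_{X_0}(\overline{\mathcal U}\cap\mathcal V)$. **De Rham cohomology and splitting.** $H^1_{DR}(X_0)$ is the space of triples $(\omega_U,\omega_V,h)\in\Omega^1_{X_0}(\overline{\mathcal U})\oplus\Omega^1_{X_0}(\mathcal V)\oplus\mathcal O_{X_0}(\overline{\mathcal U}\cap\mathcal V)$ with $\omega_V-\omega_U+dh=0$ modulo triples $(dh_U,-dh_V,h_U+h_V)$, $h_U\in\mathcal O_{X_0}(\overline{\mathcal U})$, $h_V\in\mathcal O_{X_0}(\mathcal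 V)$; $[\cdot]$ denotes the class. Let $\lambda_m$ be the coefficient of $t^m$ in $f$. For $1\le j\le n-1$, $1\le i\le rj-1$ set $$\alpha^{\mathcal U}_{i,j}=\Bigl[\sum_{m=i+1}^l\tfrac{jm-in}{n}\lambda_mt^{m-(i+1)}\Bigr]y^{j-1}\tfrac{dt}{y^{n-1}},\qquad \alpha^{\mathcal V}_{i,j}=\Bigl[\sum_{m=0}^i\tfrac{in-jm}{n}\lambda_ms^{i+1+(n-j)r-2-m}\Bigr]z^{j-1}\tfrac{ds}{z^{n-1}},$$ so that $dh_{i,j}=\alpha^{\mathcal U}_{i,j}+\alpha^{\mathcal V}_{i,j}$; let $\tau$ be the $k$-linear map with $\tau(\overline{h_{i,j}})=(\alpha^{\mathcal U}_{i,j},-\alpha^{\mathcal V}_{i,j},h_{i,j})$. One identifies $H^0(X_0,\Omega^1_{X_0})\oplus H^1(X_0,\mathcal O_{X_0})$ with $H^1_{DR}(X_0)$ by $(\omega,x)\mapsto[(\omega|_{\overline{\mathcal U}},\omega|_{\mathcal V},0)]+[\tau(x)]$. $P_2$ (resp. $P_1$) is the projection to $H^0(X_0,\Omega^1_{X_0})$ (resp. $H^1(X_0,\mathcal O_{X_0})$). **Divided Frobenius $\Phi$.** Let $\sigma$ be the Frobenius of $k$ and its lift to $W$ and $W_1$; $Q^\sigma$ means $\sigma$ applied to the coefficients of $Q$; $X_0'$ is the base change of $X_0$ by $\sigma$ (given by $f^\sigma,f_2^\sigma$), with analogous bases $\omega'_{i,j}=t^iy^{-j}dt$, $\overline{h'_{i,j}}=\overline{t^{-i}y^j}$.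 For $x\in k[s]$, $px\in W_1[s]$ means $p$ times any lift of $x$. Fix $v,c\in k[s]$ with $\mathbf f_2(s)^p-\mathbf f_2^\sigma(s^p)=p\,(v(s)f_2'(s)^p-n\,c(s)f_2(s)^p)$ in $W_1[s]$; then $s\mapsto s^p+pv(s)$, $z\mapsto z^p+pz^pc(s)$ is a lift modulo $p^2$ of the relative Frobenius on $\mathcal V$, while on $\overline{\mathcal U}$ one uses the lift sending $t\mapsto t^p$ and $y\mapsto y^p+py^p\frac{\mathcal P(t)}{n}y^{-np}$, where $p\mathcal P(t)=\mathbf f^\sigma(t^p)-\mathbf f(t)^p$. Let $F^\#$ be the $k$-linear relative Frobenius ($t\mapsto t^p$, $y\mapsto y^p$, $s\mapsto s^p$, $z\mapsto z^p$), and let $f_U,f_V,h$ be the $F^\#$-linear maps from $\Omega^1_{X'_0}$ (on $\overline{\mathcal U}'$, $\mathcal V'$, $\overline{\mathcal U}'\cap\mathcal V'$) to $\Omega^1_{X_0}(\overline{\mathcal U})$, $\Omega^1_{X_0}(\mathcal V)$, $\mathcal O_{X_0}(\overline{\mathcal U}\cap\mathcal V)$ with $f_U(dt)=t^{p-1}dt$, $f_V(ds)=(s^{p-1}+v'(s))ds$, $h(dt)=t^{2p}v(s)$; they satisfy $f_V-f_U+dh=0$. The Deligne–Illusie map $\Phi':H^0(X_0',\Omega^1_{X_0'})\oplus H^1(X'_0,\mathcal O_{X'_0})\to H^1_{DR}(X_0)$ is $\Phi'(\omega')=[(f_U(\omega'),f_V(\omega'),h(\omega'))]$, $\Phi'(\overline{x'})=[(0,0,F^\#(x'))]$.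 The divided Frobenius modulo $p$ is the $\sigma$-semilinear map $\Phi:H^0(X_0,\Omega^1_{X_0})\oplus H^1(X_0,\mathcal O_{X_0})\to H^1_{DR}(X_0)$ with $\Phi(\omega_{i,j})=\Phi'(\omega'_{i,j})$, $\Phi(\overline{h_{i,j}})=\Phi'(\overline{h'_{i,j}})$ (its coincidence with the crystalline divided Frobenius modulo $p$ is a cited theorem of Huyghe–Wach). *)

theory Defs
  imports
    "HOL-Computational_Algebra.Computational_Algebra"
    "HOL-Number_Theory.Cong"
    "HOL-Library.Poly_Mapping"
    "HOL-Library.Set_Algebras"
    "HOL-Library.Product_Plus"
begin

section \<open>Ring homomorphisms and inverses of units\<close>

definition is_ring_hom :: "('a::comm_ring_1 \<Rightarrow> 'b::comm_ring_1) \<Rightarrow> bool" where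
  "is_ring_hom \<phi> \<longleftrightarrow>
     \<phi> 1 = 1 \<and> (\<forall>x y. \<phi> (x + y) = \<phi> x + \<phi> y) \<and> (\<forall>x y. \<phi> (x * y) = \<phi> x * \<phi> y)"

definition unit_inv :: "'a::comm_ring_1 \<Rightarrow> 'a" where
  "unit_inv x = (THE y. x * y = 1)"

definition icoeff :: "'a::zero poly \<Rightarrow> int \<Rightarrow> 'a" where
  "icoeff q k = (if k < 0 then 0 else coeff q (nat k))"


section \<open>Kaehler differentials\<close>

text \<open>
  An element \<open>w\<close> of the free module on the symbols \<open>d b\<close> stands for the sum of the
  \<open>w(b) d b\<close>.  The submodule below is the \<open>R\<close>-span of the relations
  \<open>d (a + b) = d a + d b\<close> and \<open>d (a b) = a d b + b d a\<close>; it is stable under scalars because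
  the generators carry an arbitrary coefficient \<open>c\<close>.

  The constants of a base field are not among the relations.  If the base field is finite
  they are killed automatically (lemma \<open>kd_const\<close> below), so that for an algebra over
  a finite field this is the module of relative differentials.
\<close>
inductive_set kaehler_rels :: "('a::comm_ring_1 \<Rightarrow>\<^sub>0 'a) set" where
  zero: "0 \<in> kaehler_rels"
| diff: "x \<in> kaehler_rels \<Longrightarrow> y \<in> kaehler_rels \<Longrightarrow> x - y \<in> kaehler_rels"
| sum_rule: "Poly_Mapping.single (a + b) c - Poly_Mapping.single a c - Poly_Mapping.single b c
     \<in> kaehler_rels"
| product_rule: "Poly_Mapping.single (a * b) c - Poly_Mapping.single b (c * a)
     - Poly_Mapping.single a (c * b) \<in> kaehler_rels"

lemma kaehler_rels_uminus: "x \<in> kaehler_rels \<Longrightarrow> - x \<in> kaehler_rels"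
  using kaehler_rels.diff[OF kaehler_rels.zero] by force

lemma kaehler_rels_add: "x \<in> kaehler_rels \<Longrightarrow> y \<in> kaehler_rels \<Longrightarrow> x + y \<in> kaehler_rels"
  using kaehler_rels.diff[OF _ kaehler_rels_uminus] by force

definition free_scale :: "'a::comm_ring_1 \<Rightarrow> ('a \<Rightarrow>\<^sub>0 'a) \<Rightarrow> ('a \<Rightarrow>\<^sub>0 'a)" where
  "free_scale c w = Poly_Mapping.map (\<lambda>x. c * x) w"

lemma lookup_free_scale: "Poly_Mapping.lookup (free_scale c w) b = c * Poly_Mapping.lookup w b"
  by (auto simp: free_scale_def Poly_Mapping.map.rep_eq when_def)

lemma free_scale_zero: "free_scale c 0 = 0"
  by (rule poly_mapping_eqI) (simp add: lookup_free_scale)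

lemma free_scale_diff: "free_scale c (x - y) = free_scale c x - free_scale c y"
  by (rule poly_mapping_eqI) (simp add: lookup_free_scale lookup_minus algebra_simps)

lemma free_scale_single: "free_scale c (Poly_Mapping.single b x) = Poly_Mapping.single b (c * x)"
  by (rule poly_mapping_eqI) (simp add: lookup_free_scale lookup_single when_def)

lemma kaehler_rels_scale: "x \<in> kaehler_rels \<Longrightarrow> free_scale c x \<in> kaehler_rels"
proof (induction rule: kaehler_rels.induct)
  case (sum_rule a b e)
  then show ?case
    using kaehler_rels.sum_rule[of a b "c * e"] by (simp add: free_scale_diff free_scale_single)
next
  case (product_rule a b e)
  then show ?case
    using kaehler_rels.product_rule[of a b "c * e"]
    by (simp add: free_scale_diff free_scale_single mult.assoc)
qed (auto simp: free_scale_zero free_scale_diff intro: kaehler_rels.intros)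

definition free_push :: "('a::comm_ring_1 \<Rightarrow> 'b::comm_ring_1) \<Rightarrow> ('a \<Rightarrow>\<^sub>0 'a) \<Rightarrow> ('b \<Rightarrow>\<^sub>0 'b)" where
  "free_push \<phi> w = (\<Sum>b\<in>Poly_Mapping.keys w.
     Poly_Mapping.single (\<phi> b) (\<phi> (Poly_Mapping.lookup w b)))"

lemma is_ring_hom_zero: "is_ring_hom \<phi> \<Longrightarrow> \<phi> 0 = 0"
  unfolding is_ring_hom_def by (metis add_cancel_right_right)

lemma is_ring_hom_diff: "is_ring_hom \<phi> \<Longrightarrow> \<phi> (x - y) = \<phi> x - \<phi> y"
  unfolding is_ring_hom_def by (metis add_diff_cancel_right' diff_add_cancel)

lemma free_push_superset:
  assumes "is_ring_hom \<phi>" "finite B" "Poly_Mapping.keys w \<subseteq> B"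
  shows "free_push \<phi> w = (\<Sum>b\<in>B. Poly_Mapping.single (\<phi> b) (\<phi> (Poly_Mapping.lookup w b)))"
  unfolding free_push_def
  by (rule sum.mono_neutral_left) (use assms in \<open>auto simp: in_keys_iff is_ring_hom_zero\<close>)

lemma free_push_diff:
  assumes "is_ring_hom \<phi>"
  shows "free_push \<phi> (x - y) = free_push \<phi> x - free_push \<phi> y"
proof -
  let ?B = "Poly_Mapping.keys x \<union> Poly_Mapping.keys y"
  have "Poly_Mapping.keys (x - y) \<subseteq> ?B"
    by (auto simp: in_keys_iff lookup_minus)
  then have "free_push \<phi> (x - y)
      = (\<Sum>b\<in>?B. Poly_Mapping.single (\<phi> b) (\<phi> (Poly_Mapping.lookup (x - y) b)))"
    by (intro free_push_superset assms) auto
  also have "\<dots> = free_push \<phi> x - free_push \<phi> y"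
    by (simp add: free_push_superset[OF assms, of ?B] lookup_minus is_ring_hom_diff[OF assms]
        single_diff sum_subtractf)
  finally show ?thesis .
qed

lemma free_push_single:
  assumes "is_ring_hom \<phi>"
  shows "free_push \<phi> (Poly_Mapping.single b c) = Poly_Mapping.single (\<phi> b) (\<phi> c)"
  using free_push_superset[OF assms, of "{b}" "Poly_Mapping.single b c"] by (simp split: if_splits)

lemma free_push_zero: "free_push \<phi> 0 = 0"
  by (simp add: free_push_def)

lemma kaehler_rels_push:
  assumes "is_ring_hom \<phi>"
  shows "x \<in> kaehler_rels \<Longrightarrow> free_push \<phi> x \<in> kaehler_rels"
proof (induction rule: kaehler_rels.induct)
  case (sum_rule a b c)
  then show ?case
    using assms kaehler_rels.sum_rule[of "\<phi> a" "\<phi> b" "\<phi> c"]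
    by (simp add: free_push_diff free_push_single is_ring_hom_def)
next
  case (product_rule a b c)
  then show ?case
    using assms kaehler_rels.product_rule[of "\<phi> a" "\<phi> b" "\<phi> c"]
    by (simp add: free_push_diff free_push_single is_ring_hom_def)
qed (auto simp: free_push_zero free_push_diff[OF assms] intro: kaehler_rels.intros)

quotient_type (overloaded) 'a kaehler = "'a::comm_ring_1 \<Rightarrow>\<^sub>0 'a" / "\<lambda>x y. x - y \<in> kaehler_rels"
proof (rule equivpI)
  show "reflp (\<lambda>x y. x - y \<in> (kaehler_rels :: ('a \<Rightarrow>\<^sub>0 'a) set))"
    by (auto intro!: reflpI kaehler_rels.zero)
  show "symp (\<lambda>x y. x - y \<in> (kaehler_rels :: ('a \<Rightarrow>\<^sub>0 'a) set))"
    by (rule sympI) (metis kaehler_rels_uminus minus_diff_eq)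
  show "transp (\<lambda>x y. x - y \<in> (kaehler_rels :: ('a \<Rightarrow>\<^sub>0 'a) set))"
    by (rule transpI) (metis kaehler_rels_add add_diff_eq diff_add_cancel)
qed

instantiation kaehler :: (comm_ring_1) ab_group_add
begin

lift_definition zero_kaehler :: "'a kaehler" is 0 .

lift_definition plus_kaehler :: "'a kaehler \<Rightarrow> 'a kaehler \<Rightarrow> 'a kaehler" is "(+)"
  by (metis add_diff_add kaehler_rels_add)

lift_definition uminus_kaehler :: "'a kaehler \<Rightarrow> 'a kaehler" is uminus
  by (metis kaehler_rels_uminus minus_diff_minus)

lift_definition minus_kaehler :: "'a kaehler \<Rightarrow> 'a kaehler \<Rightarrow> 'a kaehler" is "(-)"
  by (metis (no_types, lifting) diff_diff_eq2 add_diff_eq diff_add_eq diff_diff_eq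
      kaehler_rels.diff add.commute)

instance
  by standard (transfer; simp add: kaehler_rels.zero algebra_simps)+

end

lift_definition kscale :: "'a::comm_ring_1 \<Rightarrow> 'a kaehler \<Rightarrow> 'a kaehler" (infixr \<open>\<odot>\<close> 75)
  is free_scale
  by (metis free_scale_diff kaehler_rels_scale)

lift_definition kd :: "'a::comm_ring_1 \<Rightarrow> 'a kaehler" is "\<lambda>b. Poly_Mapping.single b 1" .

text \<open>Functoriality: \<open>a db\<close> goes to \<open>\<phi>(a) d\<phi>(b)\<close>.\<close>
lift_definition kaehler_map :: "('a::comm_ring_1 \<Rightarrow> 'b::comm_ring_1) \<Rightarrow> 'a kaehler \<Rightarrow> 'b kaehler"
  is "\<lambda>\<phi> w. if is_ring_hom \<phi> then free_push \<phi> w else 0"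
  by (auto simp: free_push_diff[symmetric] kaehler_rels_push kaehler_rels.zero)

lemma kaehler_map_scale_kd:
  assumes "is_ring_hom \<phi>"
  shows "kaehler_map \<phi> (a \<odot> kd b) = \<phi> a \<odot> kd (\<phi> b)"
  using assms
  by transfer (simp add: free_scale_single free_push_single kaehler_rels.zero)

lemma kaehler_map_add:
  assumes "is_ring_hom \<phi>"
  shows "kaehler_map \<phi> (x + y) = kaehler_map \<phi> x + kaehler_map \<phi> y"
  using assms
  apply transfer
  subgoal premises prems for \<phi> x y
    using prems free_push_diff[of \<phi> "x + y" y]
    by (simp add: kaehler_rels.zero algebra_simps)
  done

lemma kd_mult: "kd (a * b) = a \<odot> kd b + b \<odot> kd a"
  by transfer (metis (no_types, lifting) diff_diff_eq free_scale_single kaehler_rels.product_rule mult_1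
      mult.right_neutral)

lemma kd_add: "kd (a + b) = kd a + kd b"
  by transfer (metis (no_types, lifting) diff_diff_eq kaehler_rels.sum_rule)

lemma kd_const:
  fixes \<iota> :: "'k::finite_field \<Rightarrow> 'a::comm_ring_1"
  assumes "is_ring_hom \<iota>"
  shows "kd (\<iota> c) = 0"
proof -
  define q where "q = card (UNIV :: 'k set)"
  have scale0: "0 \<odot> \<omega> = 0" for \<omega> :: "'a kaehler"
  proof transfer
    fix w :: "'a \<Rightarrow>\<^sub>0 'a"
    have "free_scale 0 w = 0"
      by (rule poly_mapping_eqI) (simp add: lookup_free_scale)
    then show "free_scale 0 w - 0 \<in> kaehler_rels"
      by (simp add: kaehler_rels.zero)
  qed
  have scale_add: "(a + b) \<odot> \<omega> = a \<odot> \<omega> + b \<odot> \<omega>" for a b :: 'a and \<omega>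
  proof transfer
    fix a b :: 'a and w :: "'a \<Rightarrow>\<^sub>0 'a"
    have "free_scale (a + b) w = free_scale a w + free_scale b w"
      by (rule poly_mapping_eqI) (simp add: lookup_free_scale lookup_add algebra_simps)
    then show "free_scale (a + b) w - (free_scale a w + free_scale b w) \<in> kaehler_rels"
      by (simp add: kaehler_rels.zero)
  qed
  have scale_scale: "a \<odot> b \<odot> \<omega> = (a * b) \<odot> \<omega>" for a b :: 'a and \<omega>
  proof transfer
    fix a b :: 'a and w :: "'a \<Rightarrow>\<^sub>0 'a"
    have "free_scale a (free_scale b w) = free_scale (a * b) w"
      by (rule poly_mapping_eqI) (simp add: lookup_free_scale mult.assoc)
    then show "free_scale a (free_scale b w) - free_scale (a * b) w \<in> kaehler_rels"
      by (simp add: kaehler_rels.zero)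
  qed
  have pow: "kd (x ^ Suc m) = (of_nat (Suc m) * x ^ m) \<odot> kd x" for x :: 'a and m
  proof (induction m)
    case 0
    show ?case
      using scale_add[of 1 0 "kd x"] by (transfer, simp) (metis free_scale_single mult_1 kaehler_rels.zero diff_self)
  next
    case (Suc m)
    have "kd (x ^ Suc (Suc m)) = x \<odot> kd (x ^ Suc m) + x ^ Suc m \<odot> kd x"
      by (metis kd_mult power_Suc)
    also have "\<dots> = (x * (of_nat (Suc m) * x ^ m) + x ^ Suc m) \<odot> kd x"
      unfolding Suc scale_scale scale_add ..
    also have "x * (of_nat (Suc m) * x ^ m) + x ^ Suc m = of_nat (Suc (Suc m)) * x ^ Suc m"
      by (simp add: algebra_simps)
    finally show ?case .
  qed
  have "bij (\<lambda>x::'k. x + 1)"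
    by (rule bij_betw_byWitness[where f' = "\<lambda>x. x - 1"]) auto
  then have "(\<Sum>x\<in>(UNIV :: 'k set). x + 1) = \<Sum>(UNIV :: 'k set)"
    by (rule sum.reindex_bij_betw)
  then have "of_nat q = (0::'k)"
    by (simp add: sum.distrib q_def)
  moreover have "\<iota> (of_nat m) = of_nat m" for m
    using assms by (induction m) (auto simp: is_ring_hom_zero is_ring_hom_def)
  ultimately have q0: "of_nat q = (0::'a)"
    using is_ring_hom_zero[OF assms] by metis
  have "\<iota> (x ^ m) = \<iota> x ^ m" for x m
    using assms by (induction m) (auto simp: is_ring_hom_def)
  then have "\<iota> c = \<iota> c ^ q"
    by (metis finite_field_power_card_eq_same q_def)
  moreover obtain m where "q = Suc m"
    by (metis q_def finite_UNIV_card_ge_0 finite gr0_implies_Suc)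
  ultimately have "kd (\<iota> c) = (of_nat q * \<iota> c ^ m) \<odot> kd (\<iota> c)"
    by (metis pow)
  then show ?thesis
    by (simp add: q0 scale0)
qed


section \<open>Witt vectors\<close>

text \<open>
  For a perfect field \<open>k\<close> of characteristic \<open>p\<close> the ring \<open>W(k)\<close> is, up to unique
  isomorphism, the strict \<open>p\<close>-ring with residue field \<open>k\<close>: it is \<open>p\<close>-torsion free, complete
  and separated for the \<open>p\<close>-adic topology, and reduction modulo \<open>p\<close> identifies \<open>W/pW\<close> with \<open>k\<close>.
\<close>
definition witt_ring :: "nat \<Rightarrow> ('w::idom \<Rightarrow> 'k::field) \<Rightarrow> bool" where
  "witt_ring p \<pi> \<longleftrightarrow>
     is_ring_hom \<pi> \<and> surj \<pi> \<and> (\<forall>x. \<pi> x = 0 \<longleftrightarrow> of_nat p dvd x) \<and>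
     (\<forall>x::'w. of_nat p * x = 0 \<longrightarrow> x = 0) \<and>
     (\<forall>x::'w. (\<forall>m. of_nat p ^ m dvd x) \<longrightarrow> x = 0) \<and>
     (\<forall>x::nat \<Rightarrow> 'w. (\<forall>m. of_nat p ^ m dvd x (Suc m) - x m) \<longrightarrow>
        (\<exists>y. \<forall>m. of_nat p ^ m dvd y - x m))"

definition frobenius_lift :: "nat \<Rightarrow> ('w::idom \<Rightarrow> 'k::field) \<Rightarrow> ('w \<Rightarrow> 'w) \<Rightarrow> bool" where
  "frobenius_lift p \<pi> \<sigma> \<longleftrightarrow> is_ring_hom \<sigma> \<and> (\<forall>x. \<pi> (\<sigma> x) = \<pi> x ^ p)"


section \<open>The curve\<close>

text \<open>\<open>g(1/s) s^(l+1)\<close> as a polynomial in \<open>s\<close>, for \<open>g\<close> of degree at most \<open>l\<close>.\<close>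
definition flip_poly :: "nat \<Rightarrow> 'a::comm_ring_1 poly \<Rightarrow> 'a poly" where
  "flip_poly l g = (\<Sum>m\<le>l. monom (coeff g m) (l + 1 - m))"

text \<open>Polynomials in two variables \<open>x, y\<close> are elements of \<open>k[x][y]\<close>.\<close>
definition eval2 :: "('k::comm_ring_1 \<Rightarrow> 'a::comm_ring_1) \<Rightarrow> 'a \<Rightarrow> 'a \<Rightarrow> 'k poly poly \<Rightarrow> 'a" where
  "eval2 \<iota> x y Q = poly (map_poly (\<lambda>q. poly (map_poly \<iota> q) x) Q) y"

text \<open>
  The ring \<open>'a\<close>, with structure map \<open>\<iota>\<close> and elements \<open>x, y\<close>, is the localisation
  of \<open>k[x,y]/(y^n - g(x))\<close> at the powers of \<open>h(x,y)\<close>.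
\<close>
definition curve_ring ::
  "nat \<Rightarrow> 'k::field poly \<Rightarrow> 'k poly poly \<Rightarrow> ('k \<Rightarrow> 'a::comm_ring_1) \<Rightarrow> 'a \<Rightarrow> 'a \<Rightarrow> bool" where
  "curve_ring n g h \<iota> x y \<longleftrightarrow>
     is_ring_hom \<iota> \<and> eval2 \<iota> x y h dvd 1 \<and>
     (\<forall>u. \<exists>N Q. eval2 \<iota> x y h ^ N * u = eval2 \<iota> x y Q) \<and>
     (\<forall>Q. eval2 \<iota> x y Q = 0 \<longleftrightarrow> (\<exists>N. (monom 1 n - [:g:]) dvd h ^ N * Q))"

text \<open>
  The affine data of the covering of the curve by \<open>Ubar\<close> and \<open>V\<close>: the rings
  \<open>'a = O(Ubar)\<close>, \<open>'b = O(V)\<close>, \<open>'c = O(Ubar \<inter> V)\<close>, their \<open>k\<close>-algebra structures,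
  coordinates, and the restriction maps.
\<close>
record ('k, 'a, 'b, 'c) covered_curve =
  cstU :: "'k \<Rightarrow> 'a"
  cstV :: "'k \<Rightarrow> 'b"
  cstUV :: "'k \<Rightarrow> 'c"
  tU :: 'a
  yU :: 'a
  sV :: 'b
  zV :: 'b
  tUV :: 'c
  yUV :: 'c
  resU :: "'a \<Rightarrow> 'c"
  resV :: "'b \<Rightarrow> 'c"

definition superelliptic_curve ::
  "nat \<Rightarrow> nat \<Rightarrow> 'k::field poly \<Rightarrow> 'k poly \<Rightarrow>
   ('k, 'a::comm_ring_1, 'b::comm_ring_1, 'c::comm_ring_1) covered_curve \<Rightarrow> bool" where
  "superelliptic_curve n r f f2 X \<longleftrightarrow>
     curve_ring n f (monom 1 1) (cstU X) (tU X) (yU X) \<and>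
     curve_ring n f2 1 (cstV X) (sV X) (zV X) \<and>
     curve_ring n f (monom (monom 1 1) 1) (cstUV X) (tUV X) (yUV X) \<and>
     is_ring_hom (resU X) \<and> resU X \<circ> cstU X = cstUV X \<and>
     resU X (tU X) = tUV X \<and> resU X (yU X) = yUV X \<and>
     is_ring_hom (resV X) \<and> resV X \<circ> cstV X = cstUV X \<and>
     resV X (sV X) = unit_inv (tUV X) \<and> resV X (zV X) = resV X (sV X) ^ r * yUV X"


section \<open>Cohomology\<close>

text \<open>
  Quotient spaces consist of cosets \<open>x +o N\<close>; sums of cosets are sums of sets, and
  scalar multiplication adds the subspace again in order to be correct for the scalar \<open>0\<close>.
\<close>

definition H0 :: "('k, 'a::comm_ring_1, 'b::comm_ring_1, 'c::comm_ring_1) covered_curve \<Rightarrow>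
    ('a kaehler \<times> 'b kaehler) set" where
  "H0 X = {(\<omega>U, \<omega>V). kaehler_map (resU X) \<omega>U = kaehler_map (resV X) \<omega>V}"

definition H0_scale :: "('k, 'a::comm_ring_1, 'b::comm_ring_1, 'c::comm_ring_1) covered_curve \<Rightarrow>
    'k \<Rightarrow> 'a kaehler \<times> 'b kaehler \<Rightarrow> 'a kaehler \<times> 'b kaehler" where
  "H0_scale X c \<omega> = (cstU X c \<odot> fst \<omega>, cstV X c \<odot> snd \<omega>)"

definition H1_bd :: "('k, 'a::comm_ring_1, 'b::comm_ring_1, 'c::comm_ring_1) covered_curve \<Rightarrow>
    'c set" where
  "H1_bd X = range (resU X) + range (resV X)"

definition H1 :: "('k, 'a::comm_ring_1, 'b::comm_ring_1, 'c::comm_ring_1) covered_curve \<Rightarrow>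
    'c set set" where
  "H1 X = range (\<lambda>x. x +o H1_bd X)"

definition H1_scale :: "('k, 'a::comm_ring_1, 'b::comm_ring_1, 'c::comm_ring_1) covered_curve \<Rightarrow>
    'k \<Rightarrow> 'c set \<Rightarrow> 'c set" where
  "H1_scale X c A = (\<lambda>x. cstUV X c * x) ` A + H1_bd X"

definition DR_cocycles :: "('k, 'a::comm_ring_1, 'b::comm_ring_1, 'c::comm_ring_1) covered_curve \<Rightarrow>
    ('a kaehler \<times> 'b kaehler \<times> 'c) set" where
  "DR_cocycles X = {(\<omega>U, \<omega>V, h).
     kaehler_map (resV X) \<omega>V - kaehler_map (resU X) \<omega>U + kd h = 0}"

definition DR_bd :: "('k, 'a::comm_ring_1, 'b::comm_ring_1, 'c::comm_ring_1) covered_curve \<Rightarrow>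
    ('a kaehler \<times> 'b kaehler \<times> 'c) set" where
  "DR_bd X = {(kd hU, - kd hV, resU X hU + resV X hV) | hU hV. True}"

definition DR_class :: "('k, 'a::comm_ring_1, 'b::comm_ring_1, 'c::comm_ring_1) covered_curve \<Rightarrow>
    'a kaehler \<times> 'b kaehler \<times> 'c \<Rightarrow> ('a kaehler \<times> 'b kaehler \<times> 'c) set" where
  "DR_class X T = T +o DR_bd X"

definition H1_DR :: "('k, 'a::comm_ring_1, 'b::comm_ring_1, 'c::comm_ring_1) covered_curve \<Rightarrow>
    ('a kaehler \<times> 'b kaehler \<times> 'c) set set" where
  "H1_DR X = DR_class X ` DR_cocycles X"

definition triple_scale :: "('k, 'a::comm_ring_1, 'b::comm_ring_1, 'c::comm_ring_1) covered_curve \<Rightarrow>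
    'k \<Rightarrow> 'a kaehler \<times> 'b kaehler \<times> 'c \<Rightarrow> 'a kaehler \<times> 'b kaehler \<times> 'c" where
  "triple_scale X c = (\<lambda>(\<omega>U, \<omega>V, h). (cstU X c \<odot> \<omega>U, cstV X c \<odot> \<omega>V, cstUV X c * h))"

definition H1_DR_scale :: "('k, 'a::comm_ring_1, 'b::comm_ring_1, 'c::comm_ring_1) covered_curve \<Rightarrow>
    'k \<Rightarrow> ('a kaehler \<times> 'b kaehler \<times> 'c) set \<Rightarrow> ('a kaehler \<times> 'b kaehler \<times> 'c) set" where
  "H1_DR_scale X c \<xi> = triple_scale X c ` \<xi> + DR_bd X"

text \<open>The global differential that is \<open>t^i y^(-j) dt\<close> on \<open>Ubar\<close>.\<close>
definition omega :: "('k, 'a::comm_ring_1, 'b::comm_ring_1, 'c::comm_ring_1) covered_curve \<Rightarrow>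
    nat \<Rightarrow> nat \<Rightarrow> 'a kaehler \<times> 'b kaehler" where
  "omega X i j =
     (THE \<omega>. \<omega> \<in> H0 X \<and> fst \<omega> = (tU X ^ i * unit_inv (yU X) ^ j) \<odot> kd (tU X))"

definition h_fun :: "('k, 'a::comm_ring_1, 'b::comm_ring_1, 'c::comm_ring_1) covered_curve \<Rightarrow>
    nat \<Rightarrow> nat \<Rightarrow> 'c" where
  "h_fun X i j = unit_inv (tUV X) ^ i * yUV X ^ j"

definition hbar :: "('k, 'a::comm_ring_1, 'b::comm_ring_1, 'c::comm_ring_1) covered_curve \<Rightarrow>
    nat \<Rightarrow> nat \<Rightarrow> 'c set" where
  "hbar X i j = h_fun X i j +o H1_bd X"


section \<open>The splitting of de Rham cohomology\<close>

definition alphaU :: "nat \<Rightarrow> nat \<Rightarrow> 'k::field poly \<Rightarrow>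
    ('k, 'a::comm_ring_1, 'b::comm_ring_1, 'c::comm_ring_1) covered_curve \<Rightarrow>
    nat \<Rightarrow> nat \<Rightarrow> 'a kaehler" where
  "alphaU n l f X i j =
     ((\<Sum>m = i + 1..l. cstU X (of_int (int j * int m - int i * int n) / of_nat n * coeff f m)
          * tU X ^ (m - (i + 1)))
       * yU X ^ (j - 1) * unit_inv (yU X) ^ (n - 1)) \<odot> kd (tU X)"

text \<open>
  \<open>z\<close> is not invertible on \<open>V\<close>: there \<open>ds/z^(n-1)\<close> is the differential whose multiple by
  \<open>z^(n-1)\<close> is \<open>ds\<close>.
\<close>
definition ds_over_z :: "nat \<Rightarrow>
    ('k, 'a::comm_ring_1, 'b::comm_ring_1, 'c::comm_ring_1) covered_curve \<Rightarrow> 'b kaehler" where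
  "ds_over_z n X = (THE \<eta>. zV X ^ (n - 1) \<odot> \<eta> = kd (sV X))"

definition alphaV :: "nat \<Rightarrow> nat \<Rightarrow> 'k::field poly \<Rightarrow>
    ('k, 'a::comm_ring_1, 'b::comm_ring_1, 'c::comm_ring_1) covered_curve \<Rightarrow>
    nat \<Rightarrow> nat \<Rightarrow> 'b kaehler" where
  "alphaV n r f X i j =
     ((\<Sum>m = 0..i. cstV X (of_int (int i * int n - int j * int m) / of_nat n * coeff f m)
          * sV X ^ (i + 1 + (n - j) * r - 2 - m))
       * zV X ^ (j - 1)) \<odot> ds_over_z n X"

definition is_tau :: "nat \<Rightarrow> nat \<Rightarrow> nat \<Rightarrow> 'k::field poly \<Rightarrow>
    ('k, 'a::comm_ring_1, 'b::comm_ring_1, 'c::comm_ring_1) covered_curve \<Rightarrow>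
    ('c set \<Rightarrow> 'a kaehler \<times> 'b kaehler \<times> 'c) \<Rightarrow> bool" where
  "is_tau n l r f X \<tau> \<longleftrightarrow>
     (\<forall>x\<in>H1 X. \<forall>y\<in>H1 X. \<tau> (x + y) = \<tau> x + \<tau> y) \<and>
     (\<forall>c. \<forall>x\<in>H1 X. \<tau> (H1_scale X c x) = triple_scale X c (\<tau> x)) \<and>
     (\<forall>i j. 1 \<le> j \<and> j \<le> n - 1 \<and> 1 \<le> i \<and> i \<le> r * j - 1 \<longrightarrow>
        \<tau> (hbar X i j) = (alphaU n l f X i j, - alphaV n r f X i j, h_fun X i j))"

definition DR_ident :: "('k, 'a::comm_ring_1, 'b::comm_ring_1, 'c::comm_ring_1) covered_curve \<Rightarrow>
    ('c set \<Rightarrow> 'a kaehler \<times> 'b kaehler \<times> 'c) \<Rightarrow>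
    ('a kaehler \<times> 'b kaehler) \<times> 'c set \<Rightarrow> ('a kaehler \<times> 'b kaehler \<times> 'c) set" where
  "DR_ident X \<tau> = (\<lambda>(\<omega>, x). DR_class X (fst \<omega>, snd \<omega>, 0) + DR_class X (\<tau> x))"

definition P2 :: "('k, 'a::comm_ring_1, 'b::comm_ring_1, 'c::comm_ring_1) covered_curve \<Rightarrow>
    ('c set \<Rightarrow> 'a kaehler \<times> 'b kaehler \<times> 'c) \<Rightarrow>
    ('a kaehler \<times> 'b kaehler \<times> 'c) set \<Rightarrow> 'a kaehler \<times> 'b kaehler" where
  "P2 X \<tau> \<xi> = fst (inv_into (H0 X \<times> H1 X) (DR_ident X \<tau>) \<xi>)"


section \<open>The divided Frobenius\<close>

text \<open>\<open>X'\<close> is the base change of \<open>X\<close> by the Frobenius of \<open>k\<close>.\<close>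
definition relative_frobenius :: "nat \<Rightarrow>
    ('k::field, 'a::comm_ring_1, 'b::comm_ring_1, 'c::comm_ring_1) covered_curve \<Rightarrow>
    ('k, 'd::comm_ring_1, 'e::comm_ring_1, 'g::comm_ring_1) covered_curve \<Rightarrow>
    ('d \<Rightarrow> 'a) \<Rightarrow> ('e \<Rightarrow> 'b) \<Rightarrow> ('g \<Rightarrow> 'c) \<Rightarrow> bool" where
  "relative_frobenius p X X' FU FV FUV \<longleftrightarrow>
     is_ring_hom FU \<and> FU \<circ> cstU X' = cstU X \<and> FU (tU X') = tU X ^ p \<and> FU (yU X') = yU X ^ p \<and>
     is_ring_hom FV \<and> FV \<circ> cstV X' = cstV X \<and> FV (sV X') = sV X ^ p \<and> FV (zV X') = zV X ^ p \<and>
     is_ring_hom FUV \<and> FUV \<circ> cstUV X' = cstUV X \<and>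
     FUV (tUV X') = tUV X ^ p \<and> FUV (yUV X') = yUV X ^ p"

definition linear_over :: "('r::comm_ring_1 \<Rightarrow> 's::comm_ring_1) \<Rightarrow> ('s \<Rightarrow> 'm \<Rightarrow> 'm) \<Rightarrow>
    ('r kaehler \<Rightarrow> 'm::ab_group_add) \<Rightarrow> bool" where
  "linear_over \<phi> scale g \<longleftrightarrow>
     (\<forall>\<omega> \<eta>. g (\<omega> + \<eta>) = g \<omega> + g \<eta>) \<and> (\<forall>a \<omega>. g (a \<odot> \<omega>) = scale (\<phi> a) (g \<omega>))"

text \<open>
  \<open>ds\<close> does not generate the differentials on \<open>V\<close>, but they are torsion free, so that
  \<open>fV\<close> is determined by its value at \<open>ds\<close>.
\<close>
definition frobenius_homotopy :: "nat \<Rightarrow> 'k::field poly \<Rightarrow>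
    ('k, 'a::comm_ring_1, 'b::comm_ring_1, 'c::comm_ring_1) covered_curve \<Rightarrow>
    ('k, 'd::comm_ring_1, 'e::comm_ring_1, 'g::comm_ring_1) covered_curve \<Rightarrow>
    ('d \<Rightarrow> 'a) \<Rightarrow> ('e \<Rightarrow> 'b) \<Rightarrow> ('g \<Rightarrow> 'c) \<Rightarrow>
    ('d kaehler \<Rightarrow> 'a kaehler) \<Rightarrow> ('e kaehler \<Rightarrow> 'b kaehler) \<Rightarrow> ('g kaehler \<Rightarrow> 'c) \<Rightarrow> bool" where
  "frobenius_homotopy p v X X' FU FV FUV fU fV h \<longleftrightarrow>
     linear_over FU (\<odot>) fU \<and> fU (kd (tU X')) = tU X ^ (p - 1) \<odot> kd (tU X) \<and>
     linear_over FV (\<odot>) fV \<and>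
     fV (kd (sV X')) = (sV X ^ (p - 1) + poly (map_poly (cstV X) (pderiv v)) (sV X)) \<odot> kd (sV X) \<and>
     linear_over FUV (\<lambda>a x. a * x) h \<and>
     h (kd (tUV X')) = tUV X ^ (2 * p) * poly (map_poly (cstUV X) v) (unit_inv (tUV X))"

text \<open>
  The last summand does not depend on the representative \<open>x'\<close>, since the relative
  Frobenius kills differentials and preserves \<open>Ubar\<close> and \<open>V\<close>.
\<close>
definition DI_map ::
    "('k::field, 'a::comm_ring_1, 'b::comm_ring_1, 'c::comm_ring_1) covered_curve \<Rightarrow>
    ('k, 'd::comm_ring_1, 'e::comm_ring_1, 'g::comm_ring_1) covered_curve \<Rightarrow>
    ('g \<Rightarrow> 'c) \<Rightarrow>
    ('d kaehler \<Rightarrow> 'a kaehler) \<Rightarrow> ('e kaehler \<Rightarrow> 'b kaehler) \<Rightarrow> ('g kaehler \<Rightarrow> 'c) \<Rightarrow>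
    ('d kaehler \<times> 'e kaehler) \<times> 'g set \<Rightarrow> ('a kaehler \<times> 'b kaehler \<times> 'c) set" where
  "DI_map X X' FUV fU fV h = (\<lambda>(\<omega>, x).
     DR_class X (fU (fst \<omega>), fV (snd \<omega>), h (kaehler_map (resU X') (fst \<omega>))) +
     DR_class X (0, 0, FUV (SOME x'. x' \<in> x)))"

definition divided_frobenius :: "nat \<Rightarrow> nat \<Rightarrow> nat \<Rightarrow>
    ('k::field, 'a::comm_ring_1, 'b::comm_ring_1, 'c::comm_ring_1) covered_curve \<Rightarrow>
    ('k, 'd::comm_ring_1, 'e::comm_ring_1, 'g::comm_ring_1) covered_curve \<Rightarrow>
    (('d kaehler \<times> 'e kaehler) \<times> 'g set \<Rightarrow> ('a kaehler \<times> 'b kaehler \<times> 'c) set) \<Rightarrow>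
    (('a kaehler \<times> 'b kaehler) \<times> 'c set \<Rightarrow> ('a kaehler \<times> 'b kaehler \<times> 'c) set) \<Rightarrow> bool" where
  "divided_frobenius p n r X X' \<Phi>' \<Phi> \<longleftrightarrow>
     \<Phi> ` (H0 X \<times> H1 X) \<subseteq> H1_DR X \<and>
     (\<forall>\<omega>\<in>H0 X. \<forall>\<eta>\<in>H0 X. \<forall>x\<in>H1 X. \<forall>y\<in>H1 X. \<Phi> (\<omega> + \<eta>, x + y) = \<Phi> (\<omega>, x) + \<Phi> (\<eta>, y)) \<and>
     (\<forall>c. \<forall>\<omega>\<in>H0 X. \<forall>x\<in>H1 X.
        \<Phi> (H0_scale X c \<omega>, H1_scale X c x) = H1_DR_scale X (c ^ p) (\<Phi> (\<omega>, x))) \<and>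
     (\<forall>i j. 1 \<le> j \<and> j \<le> n - 1 \<and> i + 2 \<le> r * j \<longrightarrow>
        \<Phi> (omega X i j, H1_bd X) = \<Phi>' (omega X' i j, H1_bd X')) \<and>
     (\<forall>i j. 1 \<le> j \<and> j \<le> n - 1 \<and> 1 \<le> i \<and> i \<le> r * j - 1 \<longrightarrow>
        \<Phi> (0, hbar X i j) = \<Phi>' (0, hbar X' i j))"

end

theory Submission
  imports Defs
begin

text \<open>
  Let \<open>U\<close> and \<open>V\<close> be the members of the covering, on which \<open>y\<close> is invertible and \<open>t\<close> is
  nonzero or infinite, respectively, and put \<open>N = p i\<close>.  The relative Frobenius kills
  differentials and respects the covering, so the class of \<open>\<Phi>(h_ij)\<close> is that of the triple
  \<open>(0, 0, w)\<close> with \<open>w = t^(-N) y^(p j)\<close>; moreover \<open>dw = 0\<close>,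
  because \<open>w\<close> is a \<open>p\<close>-th power (lemma \<open>DI_map_hbar\<close>).  Since \<open>p j = a n + b\<close> and \<open>y^n = f(t)\<close>,
  \<open>w\<close> is the sum of the \<open>F[u] t^(u - N) y^b\<close> (lemma \<open>monomial_expansion\<close>).  Put \<open>k = N - u\<close>.
  The monomials \<open>t^(-k) y^b\<close> with \<open>k \<le> 0\<close> are regular on \<open>U\<close>, those with \<open>k \<ge> r b\<close> are regular
  on \<open>V\<close>, and the remaining ones are the basis functions \<open>h_kb\<close>.  Let \<open>hU\<close> and \<open>hV\<close> be the sums of
  the first two kinds.  Subtracting from \<open>(0, 0, w)\<close> the coboundary \<open>(d hU, - d hV, hU + hV)\<close> and
  the lift by \<open>\<tau>\<close> of the basis part leaves a triple \<open>(\<omega>U, \<omega>V, 0)\<close>, hence a global differential,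
  and this is the value of \<open>P2\<close>.

  The derivative of \<open>t^k y^b\<close> is a Laurent polynomial in \<open>t\<close> times \<open>y^(b - n) dt\<close>, and
  \<open>dh = \<alpha>^U + \<alpha>^V\<close> is its splitting into nonnegative and negative powers of \<open>t\<close>.
  Thus \<open>- \<omega>U\<close> is the polynomial part of the derivative of the monomials with \<open>k < r b\<close>, and its
  coefficients are those of the theorem.  The coefficient of \<open>t^m\<close> vanishes when
  \<open>m + 2 > r (n - b)\<close>: the monomials with \<open>k \<ge> r b\<close> could only contribute to it through
  coefficients of \<open>f\<close> beyond its degree \<open>l = r n - 1\<close>, so it equals the corresponding coefficient
  of \<open>dw\<close> (lemmas \<open>closed_coefficient\<close> and \<open>P2_closed_function\<close>).

  Two facts make this rigorous for abstract rings and abstract Kaehler modules.  First, the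
  splitting has to be unique: the \<open>h_ij\<close> span the first cohomology of the structure sheaf
  (\<open>h_span_UNIV\<close>), and a combination of them that is a coboundary is trivial, with only constants
  as global functions (\<open>overlap_relation\<close>).  Both come down to partial fractions in \<open>k[t]\<close>
  for the coprime polynomials \<open>t\<close> and \<open>f\<close>.  Secondly, differentials on \<open>U\<close> and \<open>V\<close> inject into those
  on the overlap (\<open>kaehler_resU_inj\<close>, \<open>kaehler_resV_inj\<close>), which are free on \<open>dt\<close>
  (\<open>kd_t_free\<close>); so every identity of differentials is checked there.
\<close>

section \<open>Ring homomorphisms and evaluation of polynomials\<close>

lemma hom_1: "is_ring_hom \<phi> \<Longrightarrow> \<phi> 1 = 1"
  and hom_add: "is_ring_hom \<phi> \<Longrightarrow> \<phi> (x + y) = \<phi> x + \<phi> y"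
  and hom_mult: "is_ring_hom \<phi> \<Longrightarrow> \<phi> (x * y) = \<phi> x * \<phi> y"
  by (simp_all add: is_ring_hom_def)

lemma hom_uminus: "is_ring_hom \<phi> \<Longrightarrow> \<phi> (- x) = - \<phi> x"
  using is_ring_hom_diff[of \<phi> 0 x] by (simp add: is_ring_hom_zero)

lemma hom_power: "is_ring_hom \<phi> \<Longrightarrow> \<phi> (x ^ m) = \<phi> x ^ m"
  by (induction m) (simp_all add: hom_1[of \<phi>] hom_mult[of \<phi>])

lemma hom_sum: "is_ring_hom \<phi> \<Longrightarrow> \<phi> (sum g A) = (\<Sum>a\<in>A. \<phi> (g a))"
  by (induction A rule: infinite_finite_induct)
    (simp_all add: is_ring_hom_zero[of \<phi>] hom_add[of \<phi>])

lemma hom_of_nat: "is_ring_hom \<phi> \<Longrightarrow> \<phi> (of_nat m) = of_nat m"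
  by (induction m) (simp_all add: is_ring_hom_zero[of \<phi>] hom_1[of \<phi>] hom_add[of \<phi>])

lemma hom_of_int: "is_ring_hom \<phi> \<Longrightarrow> \<phi> (of_int m) = of_int m"
  by (cases m)
    (simp_all add: hom_of_nat[of \<phi>] hom_uminus[of \<phi>] hom_1[of \<phi>] hom_add[of \<phi>] is_ring_hom_diff[of \<phi>])

lemma hom_comp: "is_ring_hom \<phi> \<Longrightarrow> is_ring_hom \<psi> \<Longrightarrow> is_ring_hom (\<lambda>x. \<psi> (\<phi> x))"
  by (simp add: is_ring_hom_def)

lemmas hom_simps = hom_1 hom_add hom_mult hom_uminus hom_power hom_of_nat hom_of_int
  is_ring_hom_zero is_ring_hom_diff hom_sum

lemma inverse_unique_mult:
  assumes "x * y = (1::'a::comm_ring_1)" "x * z = 1"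
  shows "z = y"
proof -
  have "z = y * (x * z)" using assms(1) by (simp add: mult.assoc[symmetric] mult.commute[of y x])
  then show ?thesis using assms(2) by simp
qed

lemma unit_inv_eqI: "x * y = (1::'a::comm_ring_1) \<Longrightarrow> unit_inv x = y"
  unfolding unit_inv_def by (rule the_equality) (auto intro: inverse_unique_mult)

lemma unit_inv_right:
  assumes "(x::'a::comm_ring_1) dvd 1"
  shows "x * unit_inv x = 1"
proof -
  from assms obtain y where "x * y = 1" by (auto simp: dvd_def)
  then show ?thesis using unit_inv_eqI[of x y] by simp
qed

lemma hom_unit_inv:
  assumes "is_ring_hom \<phi>" "x dvd 1"
  shows "\<phi> (unit_inv x) = unit_inv (\<phi> x)"
proof -
  have "\<phi> x * \<phi> (unit_inv x) = 1"
    unfolding hom_mult[OF assms(1), symmetric] unit_inv_right[OF assms(2)] hom_1[OF assms(1)] ..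
  then show ?thesis by (simp add: unit_inv_eqI)
qed

lemma hom_dvd_1:
  assumes "is_ring_hom \<phi>" "x dvd 1"
  shows "\<phi> x dvd 1"
proof -
  have "\<phi> x * \<phi> (unit_inv x) = 1"
    unfolding hom_mult[OF assms(1), symmetric] unit_inv_right[OF assms(2)] hom_1[OF assms(1)] ..
  then show ?thesis by (rule dvdI[OF sym])
qed

lemma power_dvd_1: "(x::'a::comm_ring_1) dvd 1 \<Longrightarrow> x ^ m dvd 1"
  by (metis dvd_power_same power_one)

lemma unit_cancel:
  assumes "(u::'a::comm_ring_1) dvd 1" "u * x = u * y"
  shows "x = y"
proof -
  have "unit_inv u * u * x = unit_inv u * u * y" using assms(2) by (simp add: mult.assoc)
  then show ?thesis using unit_inv_right[OF assms(1)] by (simp add: mult.commute[of "unit_inv u"])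
qed

text \<open>
  Iterating this evaluation gives \<open>eval2\<close>, so its properties apply to both variables at once.
\<close>
definition ev :: "('k::comm_ring_1 \<Rightarrow> 'a::comm_ring_1) \<Rightarrow> 'a \<Rightarrow> 'k poly \<Rightarrow> 'a" where
  "ev \<iota> x q = poly (map_poly \<iota> q) x"

lemma eval2_ev: "eval2 \<iota> x y Q = ev (ev \<iota> x) y Q"
  by (simp add: eval2_def ev_def[abs_def])

lemma ev_0 [simp]: "ev \<iota> x 0 = 0"
  by (simp add: ev_def)

lemma ev_pCons: "is_ring_hom \<iota> \<Longrightarrow> ev \<iota> x (pCons a q) = \<iota> a + x * ev \<iota> x q"
  by (simp add: ev_def map_poly_pCons is_ring_hom_zero[of \<iota>])

lemma ev_const: "is_ring_hom \<iota> \<Longrightarrow> ev \<iota> x [:a:] = \<iota> a"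
  by (simp add: ev_pCons)

lemma ev_add: assumes "is_ring_hom \<iota>" shows "ev \<iota> x (P + Q) = ev \<iota> x P + ev \<iota> x Q"
  by (induction P Q rule: poly_induct2) (simp_all add: ev_pCons assms hom_add[OF assms] algebra_simps)

lemma ev_smult: assumes "is_ring_hom \<iota>" shows "ev \<iota> x (smult a Q) = \<iota> a * ev \<iota> x Q"
  by (induction Q) (simp_all add: ev_pCons assms hom_mult[OF assms] algebra_simps)

lemma ev_hom: assumes "is_ring_hom \<iota>" shows "is_ring_hom (ev \<iota> x)"
proof -
  have "ev \<iota> x (P * Q) = ev \<iota> x P * ev \<iota> x Q" for P Q
    by (induction P) (simp_all add: ev_add ev_smult ev_pCons assms is_ring_hom_zero[OF assms] algebra_simps)
  moreover have "ev \<iota> x 1 = 1"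
    using ev_const[OF assms, of x 1] by (simp add: one_pCons hom_1[OF assms])
  ultimately show ?thesis
    unfolding is_ring_hom_def using ev_add[OF assms] by blast
qed

lemma ev_monom: assumes "is_ring_hom \<iota>" shows "ev \<iota> x (monom a m) = \<iota> a * x ^ m"
  by (induction m) (simp_all add: monom_Suc monom_0 ev_pCons assms is_ring_hom_zero[OF assms] algebra_simps)

lemma hom_ev:
  assumes "is_ring_hom \<iota>" "is_ring_hom \<phi>"
  shows "\<phi> (ev \<iota> x Q) = ev (\<lambda>a. \<phi> (\<iota> a)) (\<phi> x) Q"
  by (induction Q) (simp_all add: ev_pCons hom_simps[OF assms(2)] assms hom_comp[OF assms])

lemma ev_sum:
  assumes "is_ring_hom \<iota>" "degree q \<le> m"
  shows "ev \<iota> x q = (\<Sum>i\<le>m. \<iota> (coeff q i) * x ^ i)"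
proof -
  have "ev \<iota> x q = ev \<iota> x (\<Sum>i\<le>m. monom (coeff q i) i)"
    using poly_as_sum_of_monoms'[OF assms(2)] by simp
  also have "\<dots> = (\<Sum>i\<le>m. \<iota> (coeff q i) * x ^ i)"
    by (simp add: hom_sum[OF ev_hom[OF assms(1)]] ev_monom assms)
  finally show ?thesis .
qed

lemma map_poly_hom:
  assumes "is_ring_hom \<phi>" shows "is_ring_hom (map_poly \<phi>)"
proof -
  have "is_ring_hom (\<lambda>a. [:\<phi> a:])"
    using assms by (auto simp: is_ring_hom_def one_pCons)
  moreover have "map_poly \<phi> = ev (\<lambda>a. [:\<phi> a:]) [:0, 1:]"
  proof
    fix q show "map_poly \<phi> q = ev (\<lambda>a. [:\<phi> a:]) [:0, 1:] q"
      by (induction q) (simp_all add: map_poly_pCons is_ring_hom_zero[OF assms] ev_pCons[OF calculation])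
  qed
  ultimately show ?thesis by (simp add: ev_hom)
qed

section \<open>The module of differentials\<close>

lemma kscale_add_left: "(a + b) \<odot> \<omega> = a \<odot> \<omega> + b \<odot> (\<omega>::'a::comm_ring_1 kaehler)"
proof transfer
  fix a b :: 'a and w :: "'a \<Rightarrow>\<^sub>0 'a"
  have "free_scale (a + b) w = free_scale a w + free_scale b w"
    by (rule poly_mapping_eqI) (simp add: lookup_free_scale lookup_add algebra_simps)
  then show "free_scale (a + b) w - (free_scale a w + free_scale b w) \<in> kaehler_rels"
    by (simp add: kaehler_rels.zero)
qed

lemma kscale_add_right: "a \<odot> (\<omega> + \<eta>) = a \<odot> \<omega> + a \<odot> (\<eta>::'a::comm_ring_1 kaehler)"
proof transfer
  fix a :: 'a and w v :: "'a \<Rightarrow>\<^sub>0 'a"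
  have "free_scale a (w + v) = free_scale a w + free_scale a v"
    by (rule poly_mapping_eqI) (simp add: lookup_free_scale lookup_add algebra_simps)
  then show "free_scale a (w + v) - (free_scale a w + free_scale a v) \<in> kaehler_rels"
    by (simp add: kaehler_rels.zero)
qed

lemma kscale_scale: "a \<odot> b \<odot> \<omega> = (a * b) \<odot> (\<omega>::'a::comm_ring_1 kaehler)"
proof transfer
  fix a b :: 'a and w :: "'a \<Rightarrow>\<^sub>0 'a"
  have "free_scale a (free_scale b w) = free_scale (a * b) w"
    by (rule poly_mapping_eqI) (simp add: lookup_free_scale mult.assoc)
  then show "free_scale a (free_scale b w) - free_scale (a * b) w \<in> kaehler_rels"
    by (simp add: kaehler_rels.zero)
qed

lemma kscale_one: "1 \<odot> \<omega> = (\<omega>::'a::comm_ring_1 kaehler)"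
proof transfer
  fix w :: "'a \<Rightarrow>\<^sub>0 'a"
  have "free_scale 1 w = w"
    by (rule poly_mapping_eqI) (simp add: lookup_free_scale)
  then show "free_scale 1 w - w \<in> kaehler_rels"
    by (simp add: kaehler_rels.zero)
qed

interpretation kaehler: module "kscale :: 'a::comm_ring_1 \<Rightarrow> 'a kaehler \<Rightarrow> 'a kaehler"
  by standard (simp_all add: kscale_add_left kscale_add_right kscale_scale kscale_one)

text \<open>
  The generators \<open>a db\<close> suffice for induction: the module is a quotient of the free module.
\<close>
lemma kaehler_induct [case_names scale_kd add]:
  fixes \<omega> :: "'a::comm_ring_1 kaehler"
  assumes "\<And>a b. P (a \<odot> kd b)" and "\<And>\<omega> \<eta>. P \<omega> \<Longrightarrow> P \<eta> \<Longrightarrow> P (\<omega> + \<eta>)"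
  shows "P \<omega>"
proof -
  have "P (abs_kaehler w)" for w
  proof (induction w rule: Poly_Mapping.update_induct)
    case const
    then show ?case using assms(1)[of 0 0] by (simp add: zero_kaehler_def)
  next
    case (update f b a)
    have "Poly_Mapping.update b a f = f + Poly_Mapping.single b a"
      using update(1)
      by (intro poly_mapping_eqI)
        (auto simp: lookup_update lookup_add lookup_single when_def in_keys_iff)
    moreover have "abs_kaehler (Poly_Mapping.single b a) = a \<odot> kd b"
      by (simp add: kd.abs_eq kscale.abs_eq free_scale_single)
    ultimately have "abs_kaehler (Poly_Mapping.update b a f) = abs_kaehler f + a \<odot> kd b"
      by (simp add: plus_kaehler.abs_eq[symmetric])
    then show ?case using assms update(3) by simp
  qed
  then show ?thesis by (metis Quotient_abs_rep[OF Quotient_kaehler])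
qed

lemma kd_one: "kd 1 = (0::'a::comm_ring_1 kaehler)"
  using kd_mult[of "1::'a" 1] by simp

lemma kd_zero: "kd 0 = (0::'a::comm_ring_1 kaehler)"
  using kd_add[of "0::'a" 0] by simp

lemma kd_uminus: "kd (- x) = - kd (x::'a::comm_ring_1)"
  using kd_add[of x "- x"] minus_unique[of "kd x" "kd (- x)"] by (simp add: kd_zero)

lemma kd_diff: "kd (x - y) = kd x - kd (y::'a::comm_ring_1)"
  using kd_add[of x "- y"] by (simp add: kd_uminus)

lemma kd_sum: "kd (sum g A) = (\<Sum>a\<in>A. kd (g a :: 'a::comm_ring_1))"
  by (induction A rule: infinite_finite_induct) (simp_all add: kd_zero kd_add)

lemma kd_power: "kd (x ^ m) = (of_nat m * x ^ (m - 1)) \<odot> kd (x::'a::comm_ring_1)"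
proof (induction m)
  case (Suc m)
  have "x * (of_nat m * x ^ (m - 1)) = of_nat m * x ^ m"
    by (cases m) simp_all
  then show ?case
    by (simp add: kd_mult Suc kscale_scale kscale_add_left[symmetric] distrib_right add.commute)
qed (simp add: kd_one)

lemma kaehler_map_zero:
  "is_ring_hom \<phi> \<Longrightarrow> kaehler_map \<phi> 0 = 0"
  using kaehler_map_add[of \<phi> 0 0] by simp

lemma kaehler_map_uminus:
  "is_ring_hom \<phi> \<Longrightarrow> kaehler_map \<phi> (- x) = - kaehler_map \<phi> x"
  using kaehler_map_add[of \<phi> x "- x"] minus_unique[of "kaehler_map \<phi> x" "kaehler_map \<phi> (- x)"]
  by (simp add: kaehler_map_zero)

lemma kaehler_map_diff:
  "is_ring_hom \<phi> \<Longrightarrow> kaehler_map \<phi> (x - y) = kaehler_map \<phi> x - kaehler_map \<phi> y"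
  using kaehler_map_add[of \<phi> x "- y"] by (simp add: kaehler_map_uminus)

lemma kaehler_map_sum:
  "is_ring_hom \<phi> \<Longrightarrow> kaehler_map \<phi> (sum g A) = (\<Sum>a\<in>A. kaehler_map \<phi> (g a))"
  by (induction A rule: infinite_finite_induct) (simp_all add: kaehler_map_zero kaehler_map_add)

lemma kaehler_map_kd: "is_ring_hom \<phi> \<Longrightarrow> kaehler_map \<phi> (kd b) = kd (\<phi> b)"
  using kaehler_map_scale_kd[of \<phi> 1 b] by (simp add: hom_1[of \<phi>])

lemma kaehler_map_scale:
  assumes "is_ring_hom \<phi>"
  shows "kaehler_map \<phi> (a \<odot> \<omega>) = \<phi> a \<odot> kaehler_map \<phi> \<omega>"
proof (induction \<omega> rule: kaehler_induct)
  case (scale_kd b c)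
  show ?case by (simp add: kaehler_map_scale_kd assms hom_mult[OF assms])
next
  case (add \<omega> \<eta>)
  then show ?case by (simp add: kaehler_map_add assms kaehler.scale_right_distrib)
qed

lemmas kaehler_map_simps = kaehler_map_zero kaehler_map_add kaehler_map_uminus kaehler_map_diff
  kaehler_map_sum kaehler_map_kd kaehler_map_scale

definition is_derivation :: "('a::comm_ring_1 \<Rightarrow> 'a) \<Rightarrow> bool" where
  "is_derivation D \<longleftrightarrow> (\<forall>a b. D (a + b) = D a + D b) \<and> (\<forall>a b. D (a * b) = a * D b + b * D a)"

text \<open>
  A derivation \<open>D\<close> defines a linear form with \<open>db \<mapsto> D(b)\<close>, first on the free module.  Linear forms
  of this kind are the only means by which elements of the abstract module are told apart below.
\<close>
definition free_contract :: "('a::comm_ring_1 \<Rightarrow> 'a) \<Rightarrow> ('a \<Rightarrow>\<^sub>0 'a) \<Rightarrow> 'a" where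
  "free_contract D w = (\<Sum>b\<in>Poly_Mapping.keys w. Poly_Mapping.lookup w b * D b)"

lemma free_contract_superset:
  assumes "finite B" "Poly_Mapping.keys w \<subseteq> B"
  shows "free_contract D w = (\<Sum>b\<in>B. Poly_Mapping.lookup w b * D b)"
  unfolding free_contract_def
  by (rule sum.mono_neutral_left) (use assms in \<open>auto simp: in_keys_iff\<close>)

lemma free_contract_diff: "free_contract D (x - y) = free_contract D x - free_contract D y"
proof -
  let ?B = "Poly_Mapping.keys x \<union> Poly_Mapping.keys y"
  have "Poly_Mapping.keys (x - y) \<subseteq> ?B"
    by (auto simp: in_keys_iff lookup_minus)
  then show ?thesis
    by (simp add: free_contract_superset[of ?B] lookup_minus left_diff_distrib sum_subtractf)
qed

lemma free_contract_single: "free_contract D (Poly_Mapping.single b a) = a * D b"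
  using free_contract_superset[of "{b}" "Poly_Mapping.single b a" D] by (simp split: if_splits)

lemma free_contract_rels:
  assumes "is_derivation D" "w \<in> kaehler_rels"
  shows "free_contract D w = 0"
  using assms(2)
proof (induction rule: kaehler_rels.induct)
  case zero
  show ?case by (simp add: free_contract_def)
next
  case (diff x y)
  then show ?case by (simp add: free_contract_diff)
next
  case (sum_rule a b c)
  have "D (a + b) = D a + D b" using assms(1) by (simp add: is_derivation_def)
  then show ?case by (simp only: free_contract_diff free_contract_single) (simp add: algebra_simps)
next
  case (product_rule a b c)
  have "D (a * b) = a * D b + b * D a" using assms(1) by (simp add: is_derivation_def)
  then show ?case by (simp only: free_contract_diff free_contract_single) (simp add: algebra_simps)
qed

lift_definition contract :: "('a::comm_ring_1 \<Rightarrow> 'a) \<Rightarrow> 'a kaehler \<Rightarrow> 'a" is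
  "\<lambda>D w. if is_derivation D then free_contract D w else 0"
  by (auto dest: free_contract_rels simp: free_contract_diff)

lemma contract_scale_kd: "is_derivation D \<Longrightarrow> contract D (a \<odot> kd b) = a * D b"
  by transfer (simp add: free_scale_single free_contract_single)


section \<open>Affine pieces of a superelliptic curve\<close>

text \<open>
  Used with \<open>A = y^n - f\<close> and \<open>q = t\<close> or \<open>q = y\<close>: inverting \<open>t y\<close> adds no relations to \<open>k[t,y]/A\<close>.
\<close>
lemma prime_elem_power_cancel:
  fixes q A Q :: "'a::idom"
  assumes "prime_elem q" "\<not> q dvd A" "A dvd q ^ N * Q"
  shows "A dvd Q"
  using assms(3)
proof (induction N)
  case (Suc N)
  then obtain S where S: "q * (q ^ N * Q) = A * S" by (auto simp: dvd_def mult.assoc)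
  then have "q dvd A * S" by (metis dvd_triv_left)
  then have "q dvd S" using assms(1,2) by (simp add: prime_elem_dvd_mult_iff)
  then obtain S' where "S = q * S'" by (auto simp: dvd_def)
  then have "q * (q ^ N * Q) = q * (A * S')" using S by (simp add: algebra_simps)
  then have "q ^ N * Q = A * S'" using assms(1) by (simp add: prime_elem_def)
  then show ?case using Suc.IH by (metis dvd_triv_left)
qed simp

lemma prime_elem_X: "prime_elem ([:0, 1:] :: 'a::idom poly)"
proof (rule prime_elemI)
  have dvd: "[:0, 1:] dvd P \<longleftrightarrow> poly P 0 = 0" for P :: "'a poly"
    using poly_eq_0_iff_dvd[of P 0] by simp
  show "[:0, 1:] \<noteq> (0::'a poly)" by simp
  show "\<not> [:0, 1:] dvd (1::'a poly)" unfolding dvd by simp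
  show "[:0, 1:] dvd a \<or> [:0, 1:] dvd b" if "[:0, 1:] dvd a * b" for a b :: "'a poly"
    using that unfolding dvd by simp
qed

text \<open>
  One chart of the curve, or the overlap.  The field is finite only because this is what
  makes differentials of constants vanish in the absolute Kaehler module.
\<close>
locale affine_curve =
  fixes n :: nat and g :: "'k::finite_field poly" and h :: "'k poly poly"
    and \<iota> :: "'k \<Rightarrow> 'a::comm_ring_1" and x y :: 'a
  assumes curve: "curve_ring n g h \<iota> x y" and n_pos: "0 < n" and n_unit: "of_nat n \<noteq> (0::'k)"
begin

abbreviation E :: "'k poly \<Rightarrow> 'a" where "E \<equiv> ev \<iota> x"
abbreviation E2 :: "'k poly poly \<Rightarrow> 'a" where "E2 \<equiv> eval2 \<iota> x y"
abbreviation H :: 'a where "H \<equiv> eval2 \<iota> x y h"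

lemma cst_hom: "is_ring_hom \<iota>"
  using curve by (simp add: curve_ring_def)

lemma cst_inv_n: "\<iota> (1 / of_nat n) * of_nat n = 1"
proof -
  have "\<iota> (1 / of_nat n) * of_nat n = \<iota> (1 / of_nat n * of_nat n)"
    by (simp only: hom_mult[OF cst_hom] hom_of_nat[OF cst_hom])
  also have "\<dots> = \<iota> 1" using n_unit by simp
  finally show ?thesis by (simp only: hom_1[OF cst_hom])
qed

lemma E_hom: "is_ring_hom E"
  by (rule ev_hom[OF cst_hom])

lemma E2_ev: "E2 = ev E y"
  by (rule ext) (rule eval2_ev)

lemma E2_hom: "is_ring_hom E2"
  unfolding E2_ev by (rule ev_hom[OF E_hom])

lemma E2_pCons: "E2 (pCons q Q) = E q + y * E2 Q"
  unfolding E2_ev by (rule ev_pCons[OF E_hom])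

lemma E2_const: "E2 [:q:] = E q"
  unfolding E2_ev by (rule ev_const[OF E_hom])

lemma E2_monom: "E2 (monom q m) = E q * y ^ m"
  unfolding E2_ev by (rule ev_monom[OF E_hom])

lemma H_unit: "H dvd 1"
  using curve by (simp add: curve_ring_def)

lemma fraction: obtains N Q where "H ^ N * u = E2 Q"
  using curve unfolding curve_ring_def by blast

lemma E2_eq_0_iff: "E2 Q = 0 \<longleftrightarrow> (\<exists>N. (monom 1 n - [:g:]) dvd h ^ N * Q)"
  using curve unfolding curve_ring_def by blast

lemma y_power: "y ^ n = E g"
proof -
  have "(monom 1 n - [:g:]) dvd h ^ 0 * (monom 1 n - [:g:])" by simp
  then have "E2 (monom 1 n - [:g:]) = 0" using E2_eq_0_iff by blast
  then show ?thesis
    by (simp add: is_ring_hom_diff[OF E2_hom] E2_monom E2_const hom_1[OF E_hom])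
qed

lemma kd_E: "kd (E q) = E (pderiv q) \<odot> kd x"
proof (induction q)
  case (pCons c q)
  have "kd (E (pCons c q)) = x \<odot> kd (E q) + E q \<odot> kd x"
    by (simp add: ev_pCons[OF cst_hom] kd_add kd_const[OF cst_hom] kd_mult)
  also have "\<dots> = E (pderiv (pCons c q)) \<odot> kd x"
    by (simp add: pCons.IH kscale_scale kscale_add_left[symmetric] pderiv_pCons
        hom_add[OF E_hom] ev_pCons[OF cst_hom] is_ring_hom_zero[OF cst_hom] add.commute)
  finally show ?case .
qed (simp add: kd_zero)

lemma kd_y: "(of_nat n * y ^ (n - 1)) \<odot> kd y = E (pderiv g) \<odot> kd x"
  using kd_power[of y n] by (simp add: y_power kd_E)

text \<open>
  Constants and coordinates generate the ring up to inverting \<open>h(x, y)\<close>, and inverses are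
  preserved automatically.
\<close>
lemma hom_eqI:
  assumes "is_ring_hom \<phi>" "is_ring_hom \<psi>" "\<And>c. \<phi> (\<iota> c) = \<psi> (\<iota> c)" "\<phi> x = \<psi> x" "\<phi> y = \<psi> y"
  shows "\<phi> u = \<psi> u"
proof -
  have E2: "\<phi> (E2 Q) = \<psi> (E2 Q)" for Q
    unfolding E2_ev hom_ev[OF E_hom assms(1)] hom_ev[OF E_hom assms(2)]
      hom_ev[OF cst_hom assms(1)] hom_ev[OF cst_hom assms(2)] assms(3-5) ..
  obtain N Q where u: "H ^ N * u = E2 Q" by (rule fraction)
  have "\<phi> (H ^ N) dvd 1"
    by (rule hom_dvd_1[OF assms(1) power_dvd_1[OF H_unit]])
  moreover have "\<phi> (H ^ N) * \<phi> u = \<phi> (H ^ N) * \<psi> u"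
  proof -
    have "\<phi> (H ^ N) * \<phi> u = \<phi> (E2 Q)" by (simp add: hom_mult[OF assms(1), symmetric] u)
    also have "\<dots> = \<psi> (H ^ N) * \<psi> u" by (simp add: hom_mult[OF assms(2), symmetric] u E2)
    also have "\<psi> (H ^ N) = \<phi> (H ^ N)"
      by (simp add: hom_power[OF assms(1)] hom_power[OF assms(2)] E2)
    finally show ?thesis .
  qed
  ultimately show ?thesis by (rule unit_cancel)
qed

text \<open>
  Differentiate \<open>H^N u = Q(x, y)\<close> and divide by the unit \<open>H^N\<close>.
\<close>
lemma kd_span: "\<exists>A B. kd u = A \<odot> kd x + B \<odot> kd y"
proof -
  have E2: "\<exists>A B. kd (E2 Q) = A \<odot> kd x + B \<odot> kd y" for Q
  proof (induction Q)
    case 0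
    show ?case
      by (rule exI[of _ 0], rule exI[of _ 0]) (simp add: kd_zero E2_ev)
  next
    case (pCons q Q)
    then obtain A B where "kd (E2 Q) = A \<odot> kd x + B \<odot> kd y" by blast
    then have "kd (E2 (pCons q Q)) = (E (pderiv q) + y * A) \<odot> kd x + (y * B + E2 Q) \<odot> kd y"
      by (simp add: E2_pCons kd_add kd_mult kd_E kscale_add_left kscale_add_right kscale_scale
          add.assoc)
    then show ?case by blast
  qed
  obtain N Q where u: "H ^ N * u = E2 Q" by (rule fraction)
  obtain A B where 1: "kd (E2 Q) = A \<odot> kd x + B \<odot> kd y" using E2 by blast
  obtain A' B' where 2: "kd (E2 (h ^ N)) = A' \<odot> kd x + B' \<odot> kd y" using E2 by blast
  have HN: "E2 (h ^ N) = H ^ N" by (rule hom_power[OF E2_hom])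
  define H' where "H' = unit_inv (H ^ N)"
  have "H ^ N dvd 1" by (rule power_dvd_1[OF H_unit])
  then have H': "H' * H ^ N = 1" using unit_inv_right by (simp add: H'_def mult.commute)
  have "kd (E2 Q) = H ^ N \<odot> kd u + u \<odot> kd (E2 (h ^ N))"
    by (simp add: u[symmetric] kd_mult HN)
  then have "H ^ N \<odot> kd u = (A - u * A') \<odot> kd x + (B - u * B') \<odot> kd y"
    unfolding 1 2
    by (simp add: kscale_add_right kscale_scale kaehler.scale_left_diff_distrib algebra_simps)
  then have "H' \<odot> H ^ N \<odot> kd u = H' \<odot> ((A - u * A') \<odot> kd x + (B - u * B') \<odot> kd y)"
    by (simp only:)
  then have "kd u = (H' * (A - u * A')) \<odot> kd x + (H' * (B - u * B')) \<odot> kd y"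
    by (simp add: kscale_scale H' kscale_add_right)
  then show ?thesis by blast
qed

lemma kaehler_span: "\<exists>A B. \<omega> = A \<odot> kd x + B \<odot> kd y"
proof (induction \<omega> rule: kaehler_induct)
  case (scale_kd a b)
  obtain A B where "kd b = A \<odot> kd x + B \<odot> kd y" using kd_span by blast
  then have "a \<odot> kd b = (a * A) \<odot> kd x + (a * B) \<odot> kd y"
    by (simp add: kscale_add_right kscale_scale)
  then show ?case by blast
next
  case (add \<omega> \<eta>)
  then obtain A B A' B' where "\<omega> = A \<odot> kd x + B \<odot> kd y" "\<eta> = A' \<odot> kd x + B' \<odot> kd y"
    by blast
  then have "\<omega> + \<eta> = (A + A') \<odot> kd x + (B + B') \<odot> kd y"
    by (simp add: kscale_add_left algebra_simps)
  then show ?case by blast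
qed

text \<open>
  The case of interest is a relative Frobenius, where the coordinates go to \<open>p\<close>-th powers.
\<close>
lemma kd_hom_eq_0:
  assumes "is_ring_hom \<phi>" "kd (\<phi> x) = 0" "kd (\<phi> y) = 0"
  shows "kd (\<phi> u) = 0"
proof -
  obtain A B where "kd u = A \<odot> kd x + B \<odot> kd y" using kd_span by blast
  then have "kaehler_map \<phi> (kd u) = kaehler_map \<phi> (A \<odot> kd x + B \<odot> kd y)" by simp
  then show ?thesis using assms by (simp add: kaehler_map_simps)
qed

text \<open>
  \<open>Q \<mapsto> Q(x + \<epsilon>, y + \<epsilon> y')\<close> with \<open>\<epsilon>^2 = 0\<close> is a ring homomorphism on \<open>k[x,y]\<close>, so its
  \<open>\<epsilon>\<close>-coefficient \<open>D0\<close> is a derivation.  The condition on \<open>y'\<close> says that \<open>D0\<close> kills \<open>y^n - g(x)\<close>;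
  hence \<open>D0\<close> descends to the quotient, and by the quotient rule to the localisation.
\<close>
lemma derivation_exists:
  assumes y': "of_nat n * y ^ (n - 1) * y' = E (pderiv g)"
  shows "\<exists>D. is_derivation D \<and> D x = 1"
proof -
  \<comment> \<open>Dual numbers are modelled by polynomials over the ring: only the coefficients 0 and 1 are read.\<close>
  define \<iota>' where "\<iota>' = (\<lambda>c. [:\<iota> c:])"
  define T where "T = ev (ev \<iota>' [:x, 1:]) [:y, y':]"
  define D0 where "D0 Q = coeff (T Q) 1" for Q
  have \<iota>': "is_ring_hom \<iota>'"
    using cst_hom by (auto simp: is_ring_hom_def \<iota>'_def one_pCons)
  note ev' = ev_hom[OF \<iota>']
  have T: "is_ring_hom T"
    unfolding T_def by (rule ev_hom[OF ev'])
  have c0: "is_ring_hom (\<lambda>q::'a poly. coeff q 0)"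
    by (simp add: is_ring_hom_def coeff_mult)
  have coeff_ev: "coeff (ev \<iota>' [:x, 1:] q) 0 = E q" for q
    unfolding hom_ev[OF \<iota>' c0] by (simp add: \<iota>'_def)
  have coeff_T: "coeff (T Q) 0 = E2 Q" for Q
    unfolding T_def hom_ev[OF ev' c0] coeff_ev E2_ev by simp
  have mult1: "coeff (P * Q) 1 = coeff P 0 * coeff Q 1 + coeff P 1 * coeff Q 0" for P Q :: "'a poly"
    by (simp add: coeff_mult)
  have D0_add: "D0 (P + Q) = D0 P + D0 Q" for P Q
    by (simp add: D0_def hom_add[OF T])
  have D0_diff: "D0 (P - Q) = D0 P - D0 Q" for P Q
    by (simp add: D0_def is_ring_hom_diff[OF T])
  have D0_mult: "D0 (P * Q) = E2 P * D0 Q + D0 P * E2 Q" for P Q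
    unfolding D0_def hom_mult[OF T] mult1 coeff_T ..
  have "coeff (ev \<iota>' [:x, 1:] q) 1 = E (pderiv q)" for q
  proof (induction q)
    case (pCons c q)
    have "coeff (ev \<iota>' [:x, 1:] (pCons c q)) 1 = x * E (pderiv q) + E q"
      unfolding ev_pCons[OF \<iota>'] coeff_add mult1 coeff_ev pCons.IH by (simp add: \<iota>'_def)
    then show ?case
      by (simp add: pderiv_pCons hom_add[OF E_hom] ev_pCons[OF cst_hom] is_ring_hom_zero[OF cst_hom])
  qed simp
  then have D0_const: "D0 [:q:] = E (pderiv q)" for q
    by (simp add: D0_def T_def ev_const[OF ev'])
  have pow1: "coeff ([:y, y':] ^ m) 1 = of_nat m * y ^ (m - 1) * y'" for m
  proof (induction m)
    case (Suc m)
    have "coeff ([:y, y':] ^ Suc m) 1 = y * (of_nat m * y ^ (m - 1) * y') + y' * y ^ m"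
      unfolding power_Suc mult1 Suc.IH by (simp add: coeff_0_power)
    also have "y * (of_nat m * y ^ (m - 1) * y') = of_nat m * y ^ m * y'"
      by (cases m) simp_all
    finally show ?case by (simp add: algebra_simps)
  qed simp
  have "T (monom 1 n) = [:y, y':] ^ n"
    by (simp add: T_def ev_monom[OF ev'] hom_1[OF ev'])
  then have "D0 (monom 1 n - [:g:]) = 0"
    using y' unfolding D0_diff D0_const by (simp add: D0_def pow1[simplified])
  moreover have "E2 (monom 1 n - [:g:]) = 0"
    by (simp add: is_ring_hom_diff[OF E2_hom] E2_monom E2_const hom_1[OF E_hom] y_power)
  ultimately have D0_dvd: "D0 Q = 0" if "(monom 1 n - [:g:]) dvd Q" for Q
    using that by (auto simp: dvd_def D0_mult)
  have HN_unit: "H ^ N dvd 1" for N by (rule power_dvd_1[OF H_unit])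
  have HN: "E2 (h ^ N) = H ^ N" for N by (rule hom_power[OF E2_hom])
  have D0_ker: "D0 Q = 0" if "E2 Q = 0" for Q
  proof -
    from E2_eq_0_iff[THEN iffD1, OF that]
    obtain N where "(monom 1 n - [:g:]) dvd h ^ N * Q" ..
    then have "D0 (h ^ N * Q) = 0" by (rule D0_dvd)
    then have "H ^ N * D0 Q = H ^ N * 0" unfolding D0_mult HN that by simp
    then show ?thesis by (rule unit_cancel[OF HN_unit])
  qed
  \<comment> \<open>Quotient rule for \<open>w = Q / h^N\<close>, independent of the chosen fraction.\<close>
  have "\<exists>v. \<forall>N Q. H ^ N * w = E2 Q \<longrightarrow> H ^ N * v + w * D0 (h ^ N) = D0 Q" for w
  proof -
    obtain N0 Q0 where w0: "H ^ N0 * w = E2 Q0" by (rule fraction)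
    define v where "v = unit_inv (H ^ N0) * (D0 Q0 - w * D0 (h ^ N0))"
    have v: "H ^ N0 * v = D0 Q0 - w * D0 (h ^ N0)"
      unfolding v_def mult.assoc[symmetric] unit_inv_right[OF HN_unit] by simp
    have "H ^ N * v + w * D0 (h ^ N) = D0 Q" if w: "H ^ N * w = E2 Q" for N Q
    proof (rule unit_cancel[OF HN_unit[of N0]])
      have "E2 (h ^ N * Q0 - h ^ N0 * Q) = 0"
        unfolding is_ring_hom_diff[OF E2_hom] hom_mult[OF E2_hom] HN w[symmetric] w0[symmetric]
        by (simp add: mult.left_commute)
      then have "D0 (h ^ N * Q0 - h ^ N0 * Q) = 0" by (rule D0_ker)
      then have eq: "H ^ N * D0 Q0 + D0 (h ^ N) * (H ^ N0 * w) = H ^ N0 * D0 Q + D0 (h ^ N0) * (H ^ N * w)"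
        unfolding D0_diff D0_mult HN w w0 by (simp add: algebra_simps)
      have "H ^ N0 * (H ^ N * v + w * D0 (h ^ N)) = H ^ N * (H ^ N0 * v) + H ^ N0 * w * D0 (h ^ N)"
        by (simp add: algebra_simps)
      also have "\<dots> = H ^ N0 * D0 Q" unfolding v using eq by (simp add: algebra_simps)
      finally show "H ^ N0 * (H ^ N * v + w * D0 (h ^ N)) = H ^ N0 * D0 Q" .
    qed
    then show ?thesis by blast
  qed
  then obtain D where D: "\<And>w N Q. H ^ N * w = E2 Q \<Longrightarrow> H ^ N * D w + w * D0 (h ^ N) = D0 Q"
    by metis
  have D': "D0 Q = H ^ N * D w + w * D0 (h ^ N)" if "H ^ N * w = E2 Q" for w N Q
    using D[OF that] ..
  have D0h: "D0 (h ^ (N + M)) = H ^ N * D0 (h ^ M) + D0 (h ^ N) * H ^ M" for N M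
    by (simp add: power_add D0_mult HN)
  have "D (a + b) = D a + D b \<and> D (a * b) = a * D b + b * D a" for a b
  proof -
    obtain N P where a: "H ^ N * a = E2 P" by (rule fraction)
    obtain M Q where b: "H ^ M * b = E2 Q" by (rule fraction)
    have "H ^ (N + M) * (a + b) = E2 (h ^ M * P + h ^ N * Q)"
      unfolding hom_add[OF E2_hom] hom_mult[OF E2_hom] HN a[symmetric] b[symmetric] power_add
      by (simp add: algebra_simps)
    from D[OF this]
    have "H ^ (N + M) * D (a + b) = H ^ (N + M) * (D a + D b)"
      unfolding D0_add D0_mult D0h HN a[symmetric] b[symmetric] D'[OF a] D'[OF b] power_add
      by (simp add: algebra_simps)
    then have 1: "D (a + b) = D a + D b" by (rule unit_cancel[OF HN_unit])
    have "H ^ (N + M) * (a * b) = E2 (P * Q)"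
      unfolding hom_mult[OF E2_hom] a[symmetric] b[symmetric] power_add by (simp add: algebra_simps)
    from D[OF this]
    have "H ^ (N + M) * D (a * b) = H ^ (N + M) * (a * D b + b * D a)"
      unfolding D0_mult D0h HN a[symmetric] b[symmetric] D'[OF a] D'[OF b] power_add
      by (simp add: algebra_simps)
    then have "D (a * b) = a * D b + b * D a" by (rule unit_cancel[OF HN_unit])
    with 1 show ?thesis ..
  qed
  then have "is_derivation D" by (simp add: is_derivation_def)
  moreover have "D x = 1"
  proof -
    have "H ^ 0 * x = E2 [:[:0, 1:]:]"
      by (simp add: E2_const ev_pCons[OF cst_hom] is_ring_hom_zero[OF cst_hom] hom_1[OF cst_hom])
    from D[OF this] show ?thesis
      using D0_const[of 1] by (simp add: D0_const pderiv_pCons one_pCons ev_pCons[OF cst_hom] hom_1[OF cst_hom])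
  qed
  ultimately show ?thesis by blast
qed

text \<open>
  Reduction modulo \<open>y^n = g(x)\<close>.
\<close>
lemma E2_reduced: "\<exists>q. E2 Q = (\<Sum>j<n. E (q j) * y ^ j)"
proof (induction Q)
  case 0
  have "E2 0 = (\<Sum>j<n. E 0 * y ^ j)" by (simp add: E2_ev)
  then show ?case by (rule exI[of _ "\<lambda>_. 0"])
next
  case (pCons a Q)
  then obtain q where q: "E2 Q = (\<Sum>j<n. E (q j) * y ^ j)" by blast
  obtain m where m: "n = Suc m" using n_pos by (cases n) auto
  define q' where "q' j = (if j = 0 then a + g * q m else q (j - 1))" for j
  have "y * E2 Q = (\<Sum>j<m. E (q j) * y ^ Suc j) + E (q m) * y ^ n"
    by (simp add: q m sum_distrib_left distrib_left mult.left_commute)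
  also have "E (q m) * y ^ n = E (g * q m)"
    by (simp add: y_power hom_mult[OF E_hom] mult.commute)
  finally have "E2 (pCons a Q) = E (q' 0) + (\<Sum>j<m. E (q' (Suc j)) * y ^ Suc j)"
    by (simp add: E2_pCons q'_def hom_add[OF E_hom])
  also have "\<dots> = (\<Sum>j<n. E (q' j) * y ^ j)"
    unfolding m sum.lessThan_Suc_shift by simp
  finally show ?case by blast
qed

end

text \<open>
  With \<open>E2_reduced\<close> this lets identities on the overlap be compared coefficient by coefficient
  in \<open>y\<close> once denominators are cleared.  The polynomial \<open>Q\<close> of \<open>y\<close>-degree less than \<open>n\<close> is divisible by \<open>y^n - g\<close> once the powers of the
  primes \<open>x\<close> and \<open>y\<close> are cancelled, hence vanishes.
\<close>
lemma reduced_independent: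
  assumes "affine_curve n g (monom (monom 1 1) 1) \<iota> x y" and "g \<noteq> 0"
    and "(\<Sum>j<n. ev \<iota> x (q j) * y ^ j) = 0" and "j < n"
  shows "q j = 0"
proof -
  interpret affine_curve n g "monom (monom 1 1) 1" \<iota> x y by fact
  define Q where "Q = (\<Sum>j<n. monom (q j) j)"
  let ?A = "monom 1 n - [:g:]"
  let ?t = "[:[:0, 1:]:] :: 'a poly poly" and ?y = "[:0, 1:] :: 'a poly poly"
  have "E2 Q = 0" using assms(3) by (simp add: Q_def hom_sum[OF E2_hom] E2_monom)
  then obtain N where "?A dvd monom (monom 1 1) 1 ^ N * Q" using E2_eq_0_iff by blast
  moreover have "monom (monom 1 1) 1 = ?t * ?y"
    by (simp add: monom_Suc monom_0)
  ultimately have "?A dvd (?t * ?y) ^ N * Q" by (simp only:)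
  then have "?A dvd ?t ^ N * (?y ^ N * Q)"
    by (simp only: power_mult_distrib mult.assoc)
  moreover have "prime_elem ?t"
    by (intro lift_prime_elem_poly prime_elem_X)
  moreover have An: "coeff ?A n = 1" using n_pos by (simp add: coeff_pCons split: nat.split)
  moreover have "\<not> ?t dvd ?A"
  proof
    assume "?t dvd ?A"
    then have "[:0, 1:] dvd coeff ?A n" unfolding const_poly_dvd_iff ..
    then have "[:0, 1:] dvd (1::'a poly)" unfolding An .
    then show False by (simp add: is_unit_iff_degree)
  qed
  ultimately have "?A dvd ?y ^ N * Q" by (metis prime_elem_power_cancel)
  moreover have "prime_elem ?y" by (rule prime_elem_X)
  moreover have "\<not> ?y dvd ?A"
    using assms(2) n_pos poly_eq_0_iff_dvd[of ?A 0] by (simp add: poly_monom power_0_left)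
  ultimately have AQ: "?A dvd Q" by (metis prime_elem_power_cancel)
  have "degree Q < n"
    unfolding Q_def by (rule degree_lessI) (use n_pos in \<open>auto simp: coeff_sum\<close>)
  moreover have "n \<le> degree ?A" using An by (intro le_degree) simp
  ultimately have "Q = 0" using dvd_imp_degree_le[OF AQ] by linarith
  then have "coeff Q j = 0" by simp
  then show ?thesis using assms(4) by (simp add: Q_def coeff_sum if_distrib cong: if_cong)
qed

section \<open>Reversed polynomials and Bezout relations\<close>

text \<open>
  The partial fraction decomposition of \<open>1 / (t^K u)\<close>.  If \<open>t\<close> and \<open>u\<close> are coprime, multiplying
  the relation for \<open>K\<close> by the one for \<open>1\<close> gives the relation for \<open>K + 1\<close>.
\<close>
lemma bezout_monom:
  assumes "coeff (u :: 'k::field poly) 0 \<noteq> 0"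
  shows "\<exists>A B. A * monom 1 K + B * u = 1"
proof (induction K)
  case 0
  show ?case by (rule exI[of _ 1], rule exI[of _ 0]) simp
next
  case (Suc K)
  then obtain A B where AB: "A * monom 1 K + B * u = 1" by blast
  obtain u0 u1 where u: "u = pCons u0 u1" by (cases u)
  with assms have "u0 \<noteq> 0" by simp
  define A' B' where "A' = - smult (1 / u0) u1" and "B' = [:1 / u0:]"
  have "A' * monom 1 1 + B' * u = 1"
    using \<open>u0 \<noteq> 0\<close> by (simp add: A'_def B'_def u monom_Suc monom_0 one_pCons)
  then have "(A * monom 1 K + B * u) * (A' * monom 1 1 + B' * u) = 1" by (simp add: AB)
  then have "(A * A') * (monom 1 K * monom 1 1) + (A * monom 1 K * B' + B * A' * monom 1 1 + B * u * B') * u = 1"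
    by (simp only: distrib_left distrib_right mult_ac add_ac)
  then show ?case by (auto simp: mult_monom)
qed

lemma coeff_flip:
  "coeff (flip_poly N q) e = (if 1 \<le> e \<and> e \<le> N + 1 then coeff q (N + 1 - e) else 0)"
proof -
  have "coeff (flip_poly N q) e = (\<Sum>m\<le>N. if m = N + 1 - e then (if N + 1 - m = e then coeff q m else 0) else 0)"
    unfolding flip_poly_def coeff_sum by (rule sum.cong) auto
  then show ?thesis by (simp add: sum.delta) auto
qed

lemma flip_add: "flip_poly N (P + Q) = flip_poly N P + flip_poly N Q"
  by (rule poly_eqI) (simp add: coeff_flip)

lemma flip_monom: "m \<le> N \<Longrightarrow> flip_poly N (monom a m) = monom a (N + 1 - m)"
  by (rule poly_eqI) (auto simp: coeff_flip)

lemma flip_sum: "flip_poly N (sum G A) = (\<Sum>a\<in>A. flip_poly N (G a))"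
  by (induction A rule: infinite_finite_induct) (auto simp: flip_add intro!: poly_eqI simp: coeff_flip)

text \<open>
  With \<open>flip_poly N P = s^(N+1) P(1/s)\<close> the exponents add up: \<open>(N+1) + (M+1) = (N+M+1) + 1\<close>.
\<close>
lemma flip_mult:
  assumes "degree P \<le> N" "degree Q \<le> M"
  shows "flip_poly (N + M + 1) (P * Q) = flip_poly N P * flip_poly M Q"
proof -
  have "P * Q = (\<Sum>i\<le>N. \<Sum>j\<le>M. monom (coeff P i * coeff Q j) (i + j))"
    unfolding mult_monom[symmetric] sum_product[symmetric]
    using poly_as_sum_of_monoms'[OF assms(1)] poly_as_sum_of_monoms'[OF assms(2)] by simp
  then have "flip_poly (N + M + 1) (P * Q)
      = (\<Sum>i\<le>N. \<Sum>j\<le>M. monom (coeff P i * coeff Q j) (N + M + 1 + 1 - (i + j)))"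
    by (simp add: flip_sum flip_monom)
  also have "\<dots> = (\<Sum>i\<le>N. \<Sum>j\<le>M. monom (coeff P i) (N + 1 - i) * monom (coeff Q j) (M + 1 - j))"
    by (intro sum.cong refl) (simp add: mult_monom)
  finally show ?thesis unfolding sum_product[symmetric] flip_poly_def .
qed

text \<open>
  Smoothness at the points of \<open>V\<close>.  Substituting \<open>1/s\<close> in the relation between \<open>f\<close> and \<open>f'\<close> shows
  that a power of \<open>s\<close> lies in the ideal of \<open>f2\<close> and \<open>f2'\<close>; at \<open>s = 0\<close> itself \<open>f2'\<close> is the leading
  coefficient of \<open>f\<close>, so \<open>s\<close> and \<open>f2'\<close> are coprime.
\<close>
lemma flip_bezout:
  fixes f :: "'k::field poly"
  assumes "A * f + B * pderiv f = 1" "degree f = l" "1 \<le> l"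
  shows "\<exists>A' B'. A' * flip_poly l f + B' * pderiv (flip_poly l f) = 1"
proof -
  define K where "K = max (degree A) (degree B)"
  let ?g = "flip_poly l f" and ?s = "monom 1 1 :: 'k poly"
  have sg: "?s * pderiv ?g = of_nat (l + 1) * ?g - flip_poly (l - 1) (pderiv f)"
  proof (rule poly_eqI)
    fix e
    have "of_nat (l + 1) * ?g = smult (of_nat (l + 1)) ?g"
      by (simp add: of_nat_poly)
    moreover have "coeff (?s * pderiv ?g) e = of_nat e * coeff ?g e"
      by (cases e) (simp_all add: coeff_monom_mult coeff_pderiv)
    ultimately show "coeff (?s * pderiv ?g) e = coeff (of_nat (l + 1) * ?g - flip_poly (l - 1) (pderiv f)) e"
      using assms(3)
      by (auto simp: coeff_flip coeff_pderiv Suc_diff_le of_nat_diff algebra_simps le_Suc_eq)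
  qed
  have "monom 1 (K + l + 1 + 1) = flip_poly (K + l + 1) (A * f + B * pderiv f)"
    using flip_monom[of 0 "K + l + 1" "1::'k"] by (simp add: assms(1))
  also have "\<dots> = flip_poly (K + l + 1) (A * f) + flip_poly ((K + 1) + (l - 1) + 1) (B * pderiv f)"
    using assms(3) by (simp add: flip_add)
  also have "flip_poly (K + l + 1) (A * f) = flip_poly K A * ?g"
    by (rule flip_mult) (simp_all add: K_def assms(2))
  also have "flip_poly ((K + 1) + (l - 1) + 1) (B * pderiv f)
      = flip_poly (K + 1) B * flip_poly (l - 1) (pderiv f)"
  proof (rule flip_mult)
    show "degree (pderiv f) \<le> l - 1"
      by (rule degree_le) (use assms(2) in \<open>auto simp: coeff_pderiv intro: coeff_eq_0\<close>)
  qed (simp add: K_def)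
  also have "flip_poly (l - 1) (pderiv f) = of_nat (l + 1) * ?g - ?s * pderiv ?g"
    unfolding sg by (simp only: diff_diff_eq2 add_diff_cancel_left')
  finally have 1: "monom 1 (K + l + 1 + 1)
      = (flip_poly K A + flip_poly (K + 1) B * of_nat (l + 1)) * ?g - flip_poly (K + 1) B * ?s * pderiv ?g"
    by (simp add: algebra_simps)
  have "coeff (pderiv ?g) 0 = lead_coeff f"
    using assms(2,3) by (simp add: coeff_pderiv coeff_flip)
  moreover have "f \<noteq> 0" using assms(2,3) by auto
  ultimately have "coeff (pderiv ?g) 0 \<noteq> 0" by simp
  from bezout_monom[OF this] obtain C D where 2: "C * monom 1 (K + l + 1 + 1) + D * pderiv ?g = 1"
    by blast
  have "C * (flip_poly K A + flip_poly (K + 1) B * of_nat (l + 1)) * ?g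
      + (D - C * flip_poly (K + 1) B * ?s) * pderiv ?g = 1"
    using 2 unfolding 1 by (simp add: algebra_simps)
  then show ?thesis by blast
qed

section \<open>Integral powers of a unit\<close>

text \<open>
  Integral powers of a unit in a ring that need not be a field; for a non-unit the negative
  powers are meaningless.
\<close>
definition zpow :: "'a::comm_ring_1 \<Rightarrow> int \<Rightarrow> 'a" where
  "zpow u k = (if k \<ge> 0 then u ^ nat k else unit_inv u ^ nat (- k))"

lemma zpow_nat: "zpow u (int m) = u ^ m"
  by (simp add: zpow_def)

lemma zpow_neg: "zpow u (- int m) = unit_inv u ^ m"
  by (simp add: zpow_def)

lemma zpow_Suc:
  assumes "(u::'a::comm_ring_1) dvd 1"
  shows "zpow u (k + 1) = u * zpow u k"
proof (cases "k \<ge> 0")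
  case True
  then show ?thesis by (simp add: zpow_def nat_add_distrib)
next
  case False
  define m where "m = nat (- k - 1)"
  have k: "k = - int (Suc m)" "k + 1 = - int m" using False by (simp_all add: m_def)
  have "u * zpow u k = (u * unit_inv u) * unit_inv u ^ m"
    unfolding k(1) zpow_neg by (simp add: mult.assoc)
  also have "\<dots> = zpow u (k + 1)" unfolding k(2) zpow_neg unit_inv_right[OF assms] by simp
  finally show ?thesis by simp
qed

lemma zpow_add:
  assumes "(u::'a::comm_ring_1) dvd 1"
  shows "zpow u (k + m) = zpow u k * zpow u m"
proof (induction m rule: int_induct[where k = 0])
  case base
  show ?case by (simp add: zpow_def)
next
  case (step1 m)
  then show ?case using zpow_Suc[OF assms, of "k + m"] zpow_Suc[OF assms, of m]
    by (simp add: algebra_simps)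
next
  case (step2 m)
  have "u * zpow u (k + (m - 1)) = u * (zpow u k * zpow u (m - 1))"
    using step2.IH zpow_Suc[OF assms, of "k + (m - 1)"] zpow_Suc[OF assms, of "m - 1"]
    by (simp add: algebra_simps)
  then show ?case by (rule unit_cancel[OF assms])
qed

lemma zpow_unit:
  assumes "(u::'a::comm_ring_1) dvd 1"
  shows "zpow u k dvd 1"
proof -
  have "1 = zpow u k * zpow u (- k)"
    using zpow_add[OF assms, of k "- k"] by (simp add: zpow_def)
  then show ?thesis by (rule dvdI)
qed

lemma kd_zpow:
  assumes "(u::'a::comm_ring_1) dvd 1"
  shows "kd (zpow u k) = (of_int k * zpow u (k - 1)) \<odot> kd u"
proof -
  have shift: "zpow u m = u * zpow u (m - 1)" for m
    using zpow_Suc[OF assms, of "m - 1"] by simp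
  have mult_u: "u * (of_int m * zpow u (m - 1)) + zpow u m = of_int (m + 1) * zpow u m" for m
    unfolding shift[of m] by (simp add: algebra_simps)
  have kd_shift: "kd (zpow u m) = u \<odot> kd (zpow u (m - 1)) + zpow u (m - 1) \<odot> kd u" for m
    by (subst shift) (rule kd_mult)
  show ?thesis
  proof (induction k rule: int_induct[where k = 0])
    case base
    show ?case by (simp add: zpow_def kd_one)
  next
    case (step1 k)
    have "kd (zpow u (k + 1)) = (u * (of_int k * zpow u (k - 1)) + zpow u k) \<odot> kd u"
      unfolding kd_shift[of "k + 1"] kscale_add_left kscale_scale[symmetric]
      using step1.IH by (simp add: kscale_scale)
    then show ?case unfolding mult_u by simp
  next
    case (step2 k)
    have "u \<odot> kd (zpow u (k - 1)) = (of_int k * zpow u (k - 1)) \<odot> kd u - zpow u (k - 1) \<odot> kd u"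
      using kd_shift[of k] unfolding step2.IH by simp
    also have "\<dots> = (of_int k * zpow u (k - 1) - zpow u (k - 1)) \<odot> kd u"
      by (rule kaehler.scale_left_diff_distrib[symmetric])
    also have "of_int k * zpow u (k - 1) - zpow u (k - 1) = u * (of_int (k - 1) * zpow u (k - 1 - 1))"
      using mult_u[of "k - 1"] by (simp add: algebra_simps)
    finally have "(unit_inv u * u) \<odot> kd (zpow u (k - 1))
        = (unit_inv u * u) \<odot> (of_int (k - 1) * zpow u (k - 1 - 1)) \<odot> kd u"
      by (simp only: kscale_scale[symmetric])
    then show ?case
      unfolding mult.commute[of "unit_inv u"] unit_inv_right[OF assms] kscale_one .
  qed
qed

section \<open>The covering of the curve\<close>

text \<open>
  The part of the data that concerns the special fibre only.  The Bezout relation for \<open>f\<close> is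
  the reduction of the one for the polynomial over the Witt vectors.
\<close>
locale superelliptic =
  fixes n l r :: nat and f :: "'k::finite_field poly"
    and X :: "('k, 'a::comm_ring_1, 'b::comm_ring_1, 'c::comm_ring_1) covered_curve"
  assumes X: "superelliptic_curve n r f (flip_poly l f) X"
    and n_pos: "0 < n" and n_unit: "of_nat n \<noteq> (0::'k)"
    and l_pos: "1 \<le> l" and rn: "r * n = l + 1"
    and degree_f: "degree f = l" and f_0: "poly f 0 \<noteq> 0"
    and f_bezout: "\<exists>A B. A * f + B * pderiv f = 1"
begin

abbreviation "f2 \<equiv> flip_poly l f"
abbreviation "t \<equiv> tUV X"
abbreviation "y \<equiv> yUV X"
abbreviation "s \<equiv> unit_inv (tUV X)"
abbreviation "Y \<equiv> unit_inv (yUV X)"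
abbreviation "cst \<equiv> cstUV X"

sublocale U: affine_curve n f "monom 1 1" "cstU X" "tU X" "yU X"
  using X n_pos n_unit by unfold_locales (simp_all add: superelliptic_curve_def)

sublocale V: affine_curve n f2 1 "cstV X" "sV X" "zV X"
  using X n_pos n_unit by unfold_locales (simp_all add: superelliptic_curve_def)

sublocale UV: affine_curve n f "monom (monom 1 1) 1" "cstUV X" "tUV X" "yUV X"
  using X n_pos n_unit by unfold_locales (simp_all add: superelliptic_curve_def)

lemma resU_hom: "is_ring_hom (resU X)" and resV_hom: "is_ring_hom (resV X)"
  using X by (simp_all add: superelliptic_curve_def)

lemma resU_gens: "resU X (cstU X c) = cst c" "resU X (tU X) = t" "resU X (yU X) = y"
  using X by (auto simp: superelliptic_curve_def fun_eq_iff)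

lemma resV_gens: "resV X (cstV X c) = cst c" "resV X (sV X) = s" "resV X (zV X) = s ^ r * y"
  using X by (auto simp: superelliptic_curve_def fun_eq_iff)

lemma resU_E: "resU X (U.E q) = UV.E q"
  unfolding hom_ev[OF U.cst_hom resU_hom] resU_gens ..

lemma resV_E: "resV X (V.E q) = ev cst s q"
  unfolding hom_ev[OF V.cst_hom resV_hom] resV_gens ..

lemma yU_unit: "yU X dvd 1"
  using U.H_unit by (simp add: U.E2_monom hom_1[OF U.E_hom])

lemma ty_unit: "t * y dvd 1"
  using UV.H_unit by (simp add: UV.E2_monom ev_monom[OF UV.cst_hom] hom_1[OF UV.cst_hom])

lemma t_unit: "t dvd 1" and y_unit: "y dvd 1"
  using ty_unit by (auto intro: dvd_mult_left dvd_mult_right)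

lemma ts: "t * s = 1" and st: "s * t = 1"
  using unit_inv_right[OF t_unit] by (simp_all add: mult.commute)

lemma yY: "y * Y = 1" and Yy: "Y * y = 1"
  using unit_inv_right[OF y_unit] by (simp_all add: mult.commute)

lemma pow_ts: "t ^ m * s ^ m = 1" and pow_st: "s ^ m * t ^ m = 1"
  by (simp_all add: power_mult_distrib[symmetric] ts st)

lemma pow_ts_le: "i \<le> K \<Longrightarrow> t ^ K * s ^ i = t ^ (K - i)"
proof -
  assume "i \<le> K"
  then have "t ^ K = t ^ (K - i) * t ^ i" by (simp add: power_add[symmetric])
  then show ?thesis by (simp add: mult.assoc pow_ts)
qed

lemma f_nz: "f \<noteq> 0" using f_0 by auto

lemma UV_independent: "(\<Sum>j<n. UV.E (q j) * y ^ j) = 0 \<Longrightarrow> j < n \<Longrightarrow> q j = 0"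
  by (rule reduced_independent[OF UV.affine_curve_axioms f_nz])

lemma cst_inj:
  assumes "cst c = 0" shows "c = 0"
proof -
  have "(\<Sum>j<n. UV.E (if j = 0 then [:c:] else 0) * y ^ j) = (\<Sum>j<n. 0)"
    by (rule sum.cong) (auto simp: ev_const[OF UV.cst_hom] assms)
  then have "(if (0::nat) = 0 then [:c:] else 0) = (0 :: 'k poly)"
    by (intro UV_independent[of "\<lambda>j. if j = 0 then [:c:] else 0" 0]) (simp_all add: n_pos)
  then show ?thesis by simp
qed

text \<open>
  This turns polynomials in \<open>s = 1/t\<close> into polynomials in \<open>t\<close>.
\<close>
lemma flip_eval:
  assumes "degree q \<le> N"
  shows "t ^ (N + 1) * ev cst s q = UV.E (flip_poly N q)"
proof -
  have "t ^ (N + 1) * ev cst s q = (\<Sum>i\<le>N. cst (coeff q i) * t ^ (N + 1 - i))"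
    unfolding ev_sum[OF UV.cst_hom assms] sum_distrib_left
    by (intro sum.cong refl) (simp add: pow_ts_le[symmetric] algebra_simps del: power_Suc)
  then show ?thesis
    by (simp add: flip_poly_def hom_sum[OF UV.E_hom] ev_monom[OF UV.cst_hom])
qed

text \<open>
  The classes of the \<open>h_ij\<close> are linearly independent, and (for \<open>c = 0\<close>) the only global functions
  are constants.  Comparing coefficients of \<open>y^j\<close> after multiplication by \<open>f^N t^K\<close> gives
  \<open>f^N P_j = t^K q_j\<close>, where \<open>q_j\<close> comes from \<open>hU\<close> and \<open>P_j\<close> from the rest.  As \<open>t\<close> does not divide \<open>f\<close>,
  \<open>t^K\<close> divides \<open>P_j\<close>; but all exponents in \<open>P_j\<close> are below \<open>K\<close>, except for the exponent \<open>K\<close> that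
  the constant term of \<open>hV\<close> contributes to \<open>P_0\<close>.  The \<open>h_ij\<close> occupy the exponents strictly between
  \<open>K - r j\<close> and \<open>K\<close> and \<open>hV\<close> those up to \<open>K - r j\<close>, so everything else is zero.
\<close>
lemma overlap_relation:
  assumes "(\<Sum>j<n. \<Sum>i = 1..<r * j. cst (c i j) * h_fun X i j) = resU X hU + resV X hV"
  shows "\<forall>j<n. \<forall>i\<in>{1..<r * j}. c i j = 0"
    and "\<exists>k. hU = cstU X (- k) \<and> hV = cstV X k"
proof -
  obtain N0 Q0 where "V.H ^ N0 * hV = V.E2 Q0" by (rule V.fraction)
  then have "hV = V.E2 Q0" by (simp add: hom_1[OF V.E2_hom])
  then obtain g where hV: "hV = (\<Sum>j<n. V.E (g j) * zV X ^ j)" using V.E2_reduced[of Q0] by auto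
  obtain N Q1 where Q1: "U.H ^ N * hU = U.E2 Q1" by (rule U.fraction)
  have Hy: "U.H = yU X" by (simp add: U.E2_monom hom_1[OF U.E_hom])
  have "U.E (f ^ N) * hU = yU X ^ (n * N) * hU"
    by (simp add: hom_power[OF U.E_hom] U.y_power[symmetric] power_mult)
  also have "yU X ^ (n * N) = yU X ^ ((n - 1) * N) * yU X ^ N"
    using n_pos by (cases n) (simp_all add: power_add[symmetric] add.commute)
  also have "\<dots> * hU = U.E2 (monom 1 ((n - 1) * N) * Q1)"
    unfolding hom_mult[OF U.E2_hom] Q1[symmetric] Hy
    by (simp add: U.E2_monom hom_1[OF U.E_hom] mult.assoc)
  finally obtain q where q: "U.E (f ^ N) * hU = (\<Sum>j<n. U.E (q j) * yU X ^ j)"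
    using U.E2_reduced by metis
  define M where "M = Max ((\<lambda>j. degree (g j)) ` {..<n})"
  have M: "degree (g j) \<le> M" if "j < n" for j
    unfolding M_def using that by (intro Max_ge) auto
  \<comment> \<open>Large enough to clear the poles at \<open>t = 0\<close> of all terms: \<open>z^j = s^(r j) y^j\<close> and \<open>deg(g_j) \<le> M\<close>.\<close>
  define K where "K = M + 1 + r * n"
  define P where "P j = (\<Sum>i = 1..<r * j. monom (c i j) (K - i))
      - flip_poly M (g j) * monom 1 (r * n - r * j)" for j
  have rj: "r * j \<le> r * n" if "j < n" for j using that by simp
  have 1: "t ^ K * (\<Sum>i = 1..<r * j. cst (c i j) * h_fun X i j)
      = UV.E (\<Sum>i = 1..<r * j. monom (c i j) (K - i)) * y ^ j" if j: "j < n" for j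
    unfolding hom_sum[OF UV.E_hom] sum_distrib_left sum_distrib_right
  proof (rule sum.cong[OF refl])
    fix i assume "i \<in> {1..<r * j}"
    then have "i \<le> K" using rj[OF j] unfolding K_def atLeastLessThan_iff by linarith
    have "t ^ K * (cst (c i j) * h_fun X i j) = cst (c i j) * (t ^ K * s ^ i) * y ^ j"
      by (simp add: h_fun_def mult_ac)
    then show "t ^ K * (cst (c i j) * h_fun X i j) = UV.E (monom (c i j) (K - i)) * y ^ j"
      by (simp add: pow_ts_le[OF \<open>i \<le> K\<close>] ev_monom[OF UV.cst_hom])
  qed
  have 2: "t ^ K * resV X (V.E (g j) * zV X ^ j)
      = UV.E (flip_poly M (g j) * monom 1 (r * n - r * j)) * y ^ j" if j: "j < n" for j
  proof -
    have "t ^ K * resV X (V.E (g j) * zV X ^ j)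
        = (t ^ (M + 1) * ev cst s (g j)) * (t ^ (r * n) * s ^ (r * j)) * y ^ j"
      unfolding hom_mult[OF resV_hom] hom_power[OF resV_hom] resV_E resV_gens power_mult_distrib
        K_def power_add power_mult[symmetric] by (simp add: mult_ac)
    then show ?thesis
      unfolding flip_eval[OF M[OF j]] pow_ts_le[OF rj[OF j]] hom_mult[OF UV.E_hom]
      by (simp add: ev_monom[OF UV.cst_hom] hom_1[OF UV.cst_hom])
  qed
  have 3: "UV.E (f ^ N) * resU X hU = (\<Sum>j<n. UV.E (q j) * y ^ j)"
  proof -
    have "UV.E (f ^ N) * resU X hU = resU X (U.E (f ^ N) * hU)"
      by (simp add: hom_mult[OF resU_hom] resU_E)
    then show ?thesis
      unfolding q by (simp add: hom_sum[OF resU_hom] hom_mult[OF resU_hom] hom_power[OF resU_hom] resU_E resU_gens)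
  qed
  have "UV.E (f ^ N * P j - monom 1 K * q j) * y ^ j
      = UV.E (f ^ N) * (t ^ K * (\<Sum>i = 1..<r * j. cst (c i j) * h_fun X i j))
        - UV.E (f ^ N) * (t ^ K * resV X (V.E (g j) * zV X ^ j)) - t ^ K * (UV.E (q j) * y ^ j)"
    if "j < n" for j
    unfolding 1[OF that] 2[OF that] P_def is_ring_hom_diff[OF UV.E_hom] hom_mult[OF UV.E_hom]
      ev_monom[OF UV.cst_hom] hom_1[OF UV.cst_hom]
    by (simp add: left_diff_distrib right_diff_distrib mult_ac)
  then have "(\<Sum>j<n. UV.E (f ^ N * P j - monom 1 K * q j) * y ^ j)
      = (\<Sum>j<n. UV.E (f ^ N) * (t ^ K * (\<Sum>i = 1..<r * j. cst (c i j) * h_fun X i j))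
        - UV.E (f ^ N) * (t ^ K * resV X (V.E (g j) * zV X ^ j)) - t ^ K * (UV.E (q j) * y ^ j))"
    by (intro sum.cong refl) (simp only: lessThan_iff)
  also have "\<dots>
      = UV.E (f ^ N) * (t ^ K * (\<Sum>j<n. \<Sum>i = 1..<r * j. cst (c i j) * h_fun X i j))
        - UV.E (f ^ N) * (t ^ K * resV X hV) - t ^ K * (UV.E (f ^ N) * resU X hU)"
    unfolding 3 hV hom_sum[OF resV_hom] sum_subtractf sum_distrib_left[symmetric] ..
  also have "\<dots> = 0" unfolding assms by (simp add: algebra_simps)
  finally have "f ^ N * P j - monom 1 K * q j = 0" if "j < n" for j
    using UV_independent[of "\<lambda>j. f ^ N * P j - monom 1 K * q j" j] that by blast
  then have Pq: "f ^ N * P j = monom 1 K * q j" if "j < n" for j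
    using that by simp
  have "coeff (f ^ N) 0 \<noteq> 0" using f_0 by (simp add: poly_0_coeff_0[symmetric])
  then obtain A B where AB: "A * monom 1 K + B * f ^ N = 1" using bezout_monom by blast
  have "monom 1 K dvd P j" if "j < n" for j
  proof -
    have "P j = (A * monom 1 K + B * f ^ N) * P j" by (simp add: AB)
    also have "\<dots> = monom 1 K * (A * P j + B * q j)"
      using Pq[OF that] by (simp add: algebra_simps)
    finally show ?thesis by (rule dvdI)
  qed
  then have P0: "coeff (P j) e = 0" if "j < n" "e < K" for j e
    using that by (simp add: monom_1_dvd_iff')
  have coeff_P: "coeff (P j) (K - e) = (\<Sum>i = 1..<r * j. if i = e then c i j else 0)
      - (if r * j \<le> e \<and> e \<le> M + r * j then coeff (g j) (e - r * j) else 0)"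
    if "j < n" "e \<le> K" for j e
  proof -
    have "coeff (\<Sum>i = 1..<r * j. monom (c i j) (K - i)) (K - e)
        = (\<Sum>i = 1..<r * j. if i = e then c i j else 0)"
      unfolding coeff_sum
    proof (rule sum.cong[OF refl])
      fix i assume "i \<in> {1..<r * j}"
      then have "i \<le> K" using rj[OF that(1)] unfolding K_def atLeastLessThan_iff by linarith
      then show "coeff (monom (c i j) (K - i)) (K - e) = (if i = e then c i j else 0)"
        using that(2) by auto
    qed
    moreover have "coeff (flip_poly M (g j) * monom 1 (r * n - r * j)) (K - e)
        = (if r * j \<le> e \<and> e \<le> M + r * j then coeff (g j) (e - r * j) else 0)"
    proof -
      have K: "K = M + 1 + r * j + (r * n - r * j)" using rj[OF that(1)] unfolding K_def by linarith
      show ?thesis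
        unfolding mult.commute[of _ "monom 1 _"] coeff_monom_mult coeff_flip using that(2)
        unfolding K by (auto intro!: arg_cong[where f = "coeff (g j)"])
    qed
    ultimately show ?thesis by (simp add: P_def)
  qed
  show "\<forall>j<n. \<forall>i\<in>{1..<r * j}. c i j = 0"
  proof (intro allI impI ballI)
    fix j i assume j: "j < n" and i: "i \<in> {1..<r * j}"
    have "i \<le> K" "K - i < K" using i rj[OF j] unfolding K_def atLeastLessThan_iff by linarith+
    then show "c i j = 0"
      using coeff_P[OF j \<open>i \<le> K\<close>] P0[OF j \<open>K - i < K\<close>] i by (simp add: sum.delta)
  qed
  have g: "coeff (g j) e = 0" if j: "j < n" and e: "0 < r * j + e" for j e
  proof (cases "e \<le> M")
    case True
    have "e + r * j \<le> K" "K - (e + r * j) < K" using True e rj[OF j] unfolding K_def by linarith+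
    moreover have "(\<Sum>i = 1..<r * j. if i = e + r * j then c i j else 0) = 0"
      by (rule sum.neutral) auto
    ultimately show ?thesis
      using coeff_P[OF j, of "e + r * j"] P0[OF j, of "K - (e + r * j)"] True by simp
  next
    case False
    then show ?thesis using M[OF j] by (intro coeff_eq_0) simp
  qed
  have r_pos: "0 < r" using rn by (cases r) auto
  define k where "k = coeff (g 0) 0"
  have g0: "g 0 = [:k:]"
    using g[OF n_pos] by (intro poly_eqI) (auto simp: k_def coeff_pCons split: nat.split)
  have gj: "g j = 0" if "0 < j" "j < n" for j
    using g[OF that(2)] that r_pos by (intro poly_eqI) auto
  obtain m where m: "n = Suc m" using n_pos by (cases n) auto
  have hVk: "hV = cstV X k"
    unfolding hV m sum.lessThan_Suc_shift by (simp add: g0 gj m ev_const[OF V.cst_hom])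
  have Pj: "P j = - (flip_poly M (g j) * monom 1 (r * n - r * j))" if "j < n" for j
    using \<open>\<forall>j<n. \<forall>i\<in>{1..<r * j}. c i j = 0\<close> that by (simp add: P_def)
  have mono: "monom 1 K * Q = monom 1 K * Q' \<Longrightarrow> Q = Q'" for Q Q' :: "'k poly"
    by simp
  have q0: "q 0 = [:- k:] * f ^ N"
  proof (rule mono)
    have "P 0 = monom 1 K * [:- k:]"
      using flip_monom[of 0 M k]
      by (simp add: Pj n_pos g0 monom_0[symmetric] mult_monom K_def minus_monom)
    then show "monom 1 K * q 0 = monom 1 K * ([:- k:] * f ^ N)"
      using Pq[OF n_pos] by (simp only: mult_ac)
  qed
  have qj: "q j = 0" if "0 < j" "j < n" for j
  proof (rule mono)
    have "P j = 0" using that by (simp add: Pj gj flip_poly_def)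
    then show "monom 1 K * q j = monom 1 K * 0" using Pq[OF that(2)] by simp
  qed
  have "U.E (f ^ N) * hU = U.E (f ^ N) * cstU X (- k)"
  proof -
    have "(\<Sum>j<n. U.E (q j) * yU X ^ j) = U.E (q 0)"
      unfolding m sum.lessThan_Suc_shift by (simp add: qj m)
    then show ?thesis
      unfolding q q0 hom_mult[OF U.E_hom] ev_const[OF U.cst_hom] by (simp only: mult.commute)
  qed
  moreover have "U.E (f ^ N) dvd 1"
    unfolding hom_power[OF U.E_hom] U.y_power[symmetric] by (intro power_dvd_1 yU_unit)
  ultimately have "hU = cstU X (- k)" by (metis unit_cancel)
  with hVk show "\<exists>k. hU = cstU X (- k) \<and> hV = cstV X k" by blast
qed

lemma resU_inj:
  assumes "resU X u = resU X u'" shows "u = u'"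
proof -
  have "(\<Sum>j<n. \<Sum>i = 1..<r * j. cst 0 * h_fun X i j) = resU X (u - u') + resV X 0"
    using assms by (simp add: is_ring_hom_zero[OF UV.cst_hom] is_ring_hom_zero[OF resV_hom] is_ring_hom_diff[OF resU_hom])
  from overlap_relation(2)[of "\<lambda>_ _. 0", OF this]
  obtain k where k: "u - u' = cstU X (- k)" "0 = cstV X k" by blast
  have "cst k = 0" using k(2) resV_gens(1)[of k] by (simp add: is_ring_hom_zero[OF resV_hom])
  then have "k = 0" by (rule cst_inj)
  then show ?thesis using k(1) by (simp add: is_ring_hom_zero[OF U.cst_hom])
qed

lemma resV_inj:
  assumes "resV X u = resV X u'" shows "u = u'"
proof -
  have "(\<Sum>j<n. \<Sum>i = 1..<r * j. cst 0 * h_fun X i j) = resU X 0 + resV X (u - u')"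
    using assms by (simp add: is_ring_hom_zero[OF UV.cst_hom] is_ring_hom_zero[OF resU_hom] is_ring_hom_diff[OF resV_hom])
  from overlap_relation(2)[of "\<lambda>_ _. 0", OF this]
  obtain k where k: "0 = cstU X (- k)" "u - u' = cstV X k" by blast
  have "cst (- k) = 0" using k(1) resU_gens(1)[of "- k"] by (simp add: is_ring_hom_zero[OF resU_hom])
  then have "- k = 0" by (rule cst_inj)
  then show ?thesis using k(2) by (simp add: is_ring_hom_zero[OF V.cst_hom])
qed

text \<open>
  Functions on the overlap whose class in the first cohomology of the structure sheaf is a
  combination of the classes of the \<open>h_ij\<close>.
\<close>
definition h_span :: "'c set" where
  "h_span = {w. \<exists>c hU hV. w = (\<Sum>j<n. \<Sum>i = 1..<r * j. cst (c i j) * h_fun X i j) + resU X hU + resV X hV}"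

lemma h_spanI:
  "w = (\<Sum>j<n. \<Sum>i = 1..<r * j. cst (c i j) * h_fun X i j) + resU X hU + resV X hV \<Longrightarrow> w \<in> h_span"
  unfolding h_span_def mem_Collect_eq by (rule exI[of _ c], rule exI[of _ hU], rule exI[of _ hV])

lemma h_span_add: "w \<in> h_span \<Longrightarrow> w' \<in> h_span \<Longrightarrow> w + w' \<in> h_span"
proof -
  assume "w \<in> h_span" "w' \<in> h_span"
  then obtain c hU hV c' hU' hV'
    where w: "w = (\<Sum>j<n. \<Sum>i = 1..<r * j. cst (c i j) * h_fun X i j) + resU X hU + resV X hV"
      and w': "w' = (\<Sum>j<n. \<Sum>i = 1..<r * j. cst (c' i j) * h_fun X i j) + resU X hU' + resV X hV'"
    unfolding h_span_def by blast
  have "w + w' = (\<Sum>j<n. \<Sum>i = 1..<r * j. cst (c i j + c' i j) * h_fun X i j)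
      + resU X (hU + hU') + resV X (hV + hV')"
    unfolding w w' hom_add[OF UV.cst_hom] hom_add[OF resU_hom] hom_add[OF resV_hom]
    by (simp add: sum.distrib distrib_right add_ac)
  then show ?thesis by (rule h_spanI)
qed

lemma h_span_UV: "resU X hU + resV X hV \<in> h_span"
proof -
  have "resU X hU + resV X hV
      = (\<Sum>j<n. \<Sum>i = 1..<r * j. cst 0 * h_fun X i j) + resU X hU + resV X hV"
    by (simp add: is_ring_hom_zero[OF UV.cst_hom])
  then show ?thesis by (rule h_spanI)
qed

lemma h_span_U: "resU X hU \<in> h_span" and h_span_V: "resV X hV \<in> h_span"
  using h_span_UV[of hU 0] h_span_UV[of 0 hV]
  by (simp_all add: is_ring_hom_zero[OF resV_hom] is_ring_hom_zero[OF resU_hom])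

lemma h_span_sum: "(\<And>a. a \<in> A \<Longrightarrow> g a \<in> h_span) \<Longrightarrow> sum g A \<in> h_span"
proof (induction A rule: infinite_finite_induct)
  case (insert a A)
  then show ?case by (simp add: h_span_add)
qed (use h_span_U[of 0] in \<open>simp_all add: is_ring_hom_zero[OF resU_hom]\<close>)

lemma h_span_monomial:
  assumes "j < n" shows "cst c * zpow t k * y ^ j \<in> h_span"
proof -
  consider (U) "k \<ge> 0" | (V) "k \<le> - int (r * j)" | (h) "- int (r * j) < k" "k < 0" by linarith
  then show ?thesis
  proof cases
    case U
    then have "cst c * zpow t k * y ^ j = resU X (cstU X c * tU X ^ nat k * yU X ^ j)"
      by (simp add: hom_mult[OF resU_hom] hom_power[OF resU_hom] resU_gens zpow_def)
    then show ?thesis using h_span_U by simp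
  next
    case V
    define m where "m = nat (- k - int (r * j))"
    have k: "k = - int (m + r * j)" using V by (simp add: m_def)
    have "cst c * zpow t k * y ^ j = resV X (cstV X c * sV X ^ m * zV X ^ j)"
      unfolding k zpow_neg
      by (simp add: hom_mult[OF resV_hom] hom_power[OF resV_hom] resV_gens power_add power_mult[symmetric]
          power_mult_distrib mult_ac)
    then show ?thesis using h_span_V by simp
  next
    case h
    define m where "m = nat (- k)"
    have k: "k = - int m" using h by (simp add: m_def)
    then have "int m < int (r * j)" "1 \<le> m" using h by linarith+
    then have m: "m \<in> {1..<r * j}" unfolding of_nat_less_iff by simp
    let ?c = "\<lambda>i' j'. if j' = j then if i' = m then c else 0 else 0"
    have "(\<Sum>j'<n. \<Sum>i' = 1..<r * j'. cst (?c i' j') * h_fun X i' j')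
        = (\<Sum>j'<n. if j' = j then cst c * h_fun X m j else 0)"
    proof (rule sum.cong[OF refl])
      fix j' assume "j' \<in> {..<n}"
      show "(\<Sum>i' = 1..<r * j'. cst (?c i' j') * h_fun X i' j')
          = (if j' = j then cst c * h_fun X m j else 0)"
      proof (cases "j' = j")
        case True
        have "(\<Sum>i' = 1..<r * j. cst (if i' = m then c else 0) * h_fun X i' j)
            = (\<Sum>i' = 1..<r * j. if i' = m then cst c * h_fun X m j else 0)"
          by (rule sum.cong) (auto simp: is_ring_hom_zero[OF UV.cst_hom])
        then show ?thesis using m True by (simp add: sum.delta)
      qed (simp add: is_ring_hom_zero[OF UV.cst_hom])
    qed
    also have "\<dots> = cst c * zpow t k * y ^ j"
      using assms by (simp add: sum.delta h_fun_def k zpow_neg mult.assoc)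
    finally have "cst c * zpow t k * y ^ j
        = (\<Sum>j'<n. \<Sum>i' = 1..<r * j'. cst (?c i' j') * h_fun X i' j') + resU X 0 + resV X 0"
      by (simp add: is_ring_hom_zero[OF resU_hom] is_ring_hom_zero[OF resV_hom])
    then show ?thesis by (rule h_spanI)
  qed
qed

text \<open>
  Partial fractions with respect to \<open>t\<close> and \<open>f\<close> write a function as the sum of one regular on \<open>U\<close>,
  where \<open>f = y^n\<close> is invertible, and of monomials \<open>t^k y^j\<close> of the kind treated before.
\<close>
lemma h_span_UNIV: "w \<in> h_span"
proof -
  obtain N Q0 where Q0: "UV.H ^ N * w = UV.E2 Q0" by (rule UV.fraction)
  have H: "UV.H = t * y"
    by (simp add: UV.E2_monom ev_monom[OF UV.cst_hom] hom_1[OF UV.cst_hom])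
  have "t ^ N * UV.E (f ^ N) * w = y ^ (n * N) * (t ^ N * w)"
    unfolding hom_power[OF UV.E_hom] UV.y_power[symmetric] power_mult[symmetric]
    by (simp only: mult_ac)
  also have "y ^ (n * N) = y ^ ((n - 1) * N) * y ^ N"
    using n_pos by (cases n) (simp_all add: power_add[symmetric] add.commute)
  also have "\<dots> * (t ^ N * w) = UV.E2 (monom 1 ((n - 1) * N) * Q0)"
    unfolding hom_mult[OF UV.E2_hom] Q0[symmetric] H power_mult_distrib
    by (simp add: UV.E2_monom hom_1[OF UV.E_hom] mult_ac)
  finally obtain q where q: "t ^ N * UV.E (f ^ N) * w = (\<Sum>j<n. UV.E (q j) * y ^ j)"
    using UV.E2_reduced by metis
  have "coeff (f ^ N) 0 \<noteq> 0" using f_0 by (simp add: poly_0_coeff_0[symmetric])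
  then obtain A B where AB: "A * monom 1 N + B * f ^ N = 1" using bezout_monom by blast
  have "U.E (f ^ N) dvd 1"
    unfolding hom_power[OF U.E_hom] U.y_power[symmetric] by (intro power_dvd_1 yU_unit)
  then obtain F where F: "1 = U.E (f ^ N) * F" by (auto simp: dvd_def)
  have FF: "UV.E (f ^ N) * resU X F = 1"
    using arg_cong[OF F, of "resU X"] by (simp add: hom_mult[OF resU_hom] hom_1[OF resU_hom] resU_E)
  have "w = UV.E (A * monom 1 N + B * f ^ N) * w" by (simp add: AB hom_1[OF UV.E_hom])
  also have "\<dots> = UV.E A * (t ^ N * (UV.E (f ^ N) * resU X F) * w) + UV.E B * (t ^ N * s ^ N) * (UV.E (f ^ N) * w)"
    unfolding FF pow_ts by (simp add: hom_add[OF UV.E_hom] hom_mult[OF UV.E_hom] ev_monom[OF UV.cst_hom]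
        hom_1[OF UV.cst_hom] algebra_simps)
  also have "\<dots> = UV.E A * resU X F * (t ^ N * UV.E (f ^ N) * w) + UV.E B * s ^ N * (t ^ N * UV.E (f ^ N) * w)"
    by (simp add: mult_ac)
  also have "\<dots> = resU X (U.E A * F * (\<Sum>j<n. U.E (q j) * yU X ^ j))
      + (\<Sum>j<n. \<Sum>e\<le>degree (B * q j). cst (coeff (B * q j) e) * zpow t (int e - int N) * y ^ j)"
  proof -
    have "UV.E B * s ^ N * (UV.E (q j) * y ^ j)
        = (\<Sum>e\<le>degree (B * q j). cst (coeff (B * q j) e) * zpow t (int e - int N) * y ^ j)" for j
    proof -
      have "UV.E B * s ^ N * (UV.E (q j) * y ^ j) = UV.E (B * q j) * (s ^ N * y ^ j)"
        unfolding hom_mult[OF UV.E_hom] by (simp only: mult_ac)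
      also have "\<dots> = (\<Sum>e\<le>degree (B * q j). cst (coeff (B * q j) e) * (t ^ e * s ^ N) * y ^ j)"
        unfolding ev_sum[OF UV.cst_hom order_refl] sum_distrib_right
        by (intro sum.cong refl) (simp only: mult_ac)
      also have "\<dots> = (\<Sum>e\<le>degree (B * q j). cst (coeff (B * q j) e) * zpow t (int e - int N) * y ^ j)"
        using zpow_add[OF t_unit, of "int _" "- int N"] by (simp add: zpow_nat zpow_neg)
      finally show ?thesis .
    qed
    then show ?thesis
      unfolding q by (simp add: hom_mult[OF resU_hom] hom_sum[OF resU_hom] hom_power[OF resU_hom]
          resU_E resU_gens sum_distrib_left)
  qed
  also have "\<dots> \<in> h_span"
    by (intro h_span_add h_span_U h_span_sum h_span_monomial) simp
  finally show ?thesis .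
qed

lemma kd_y: "kd y = (cst (1 / of_nat n) * Y ^ (n - 1) * UV.E (pderiv f)) \<odot> kd t"
proof -
  have "(cst (1 / of_nat n) * Y ^ (n - 1)) \<odot> (of_nat n * y ^ (n - 1)) \<odot> kd y
      = (cst (1 / of_nat n) * Y ^ (n - 1)) \<odot> UV.E (pderiv f) \<odot> kd t"
    by (simp only: UV.kd_y)
  moreover have "cst (1 / of_nat n) * Y ^ (n - 1) * (of_nat n * y ^ (n - 1))
      = (cst (1 / of_nat n) * of_nat n) * (Y * y) ^ (n - 1)"
    unfolding power_mult_distrib by (simp only: mult_ac)
  ultimately show ?thesis by (simp add: kscale_scale UV.cst_inv_n Yy kscale_one)
qed

text \<open>
  The derivation \<open>d/dt\<close> gives a linear form that is \<open>1\<close> on \<open>dt\<close>.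
\<close>
lemma kd_t_free:
  assumes "a \<odot> kd t = a' \<odot> kd t" shows "a = a'"
proof -
  have "of_nat n * y ^ (n - 1) * (cst (1 / of_nat n) * Y ^ (n - 1) * UV.E (pderiv f))
      = (cst (1 / of_nat n) * of_nat n) * (y * Y) ^ (n - 1) * UV.E (pderiv f)"
    unfolding power_mult_distrib by (simp only: mult_ac)
  then have "of_nat n * y ^ (n - 1) * (cst (1 / of_nat n) * Y ^ (n - 1) * UV.E (pderiv f)) = UV.E (pderiv f)"
    by (simp add: UV.cst_inv_n yY)
  from UV.derivation_exists[OF this] obtain D where D: "is_derivation D" "D t = 1" by blast
  have "contract D (a \<odot> kd t) = contract D (a' \<odot> kd t)" using assms by simp
  then show ?thesis by (simp add: contract_scale_kd D)
qed

text \<open>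
  As \<open>y\<close> is invertible on \<open>U\<close>, \<open>dt\<close> generates the differentials there, and on the overlap
  it is free.
\<close>
lemma kaehler_resU_inj:
  assumes "kaehler_map (resU X) \<omega> = 0" shows "\<omega> = 0"
proof -
  obtain v where v: "1 = yU X * v" using yU_unit by (auto simp: dvd_def)
  note nU = U.cst_inv_n
  have "(cstU X (1 / of_nat n) * v ^ (n - 1)) \<odot> (of_nat n * yU X ^ (n - 1)) \<odot> kd (yU X)
      = (cstU X (1 / of_nat n) * v ^ (n - 1)) \<odot> U.E (pderiv f) \<odot> kd (tU X)"
    by (simp only: U.kd_y)
  moreover have "cstU X (1 / of_nat n) * v ^ (n - 1) * (of_nat n * yU X ^ (n - 1))
      = (cstU X (1 / of_nat n) * of_nat n) * (yU X * v) ^ (n - 1)"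
    unfolding power_mult_distrib by (simp only: mult_ac)
  ultimately have dy: "kd (yU X) = (cstU X (1 / of_nat n) * v ^ (n - 1) * U.E (pderiv f)) \<odot> kd (tU X)"
    by (simp add: kscale_scale nU v[symmetric] kscale_one)
  obtain A B where "\<omega> = A \<odot> kd (tU X) + B \<odot> kd (yU X)" using U.kaehler_span by blast
  then obtain a where a: "\<omega> = a \<odot> kd (tU X)"
    unfolding dy kscale_scale kscale_add_left[symmetric] by blast
  have "resU X a \<odot> kd t = 0 \<odot> kd t"
    using assms by (simp add: a kaehler_map_scale[OF resU_hom] kaehler_map_kd[OF resU_hom] resU_gens)
  then have "resU X a = resU X 0" using kd_t_free by (metis is_ring_hom_zero[OF resU_hom])
  then have "a = 0" by (rule resU_inj)
  then show ?thesis by (simp add: a)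
qed

lemma zV_res_unit: "resV X (zV X) dvd 1"
proof -
  have "s dvd 1" using ts by (metis dvd_triv_right)
  then have "s ^ r * y dvd 1 * 1" using y_unit by (intro mult_dvd_mono power_dvd_1)
  then show ?thesis by (simp add: resV_gens)
qed

lemma kd_s: "kd s = (- (s ^ 2)) \<odot> kd t"
proof -
  have "kd (zpow t (- 1)) = (- zpow t (- 2)) \<odot> kd t" by (simp add: kd_zpow[OF t_unit])
  then show ?thesis by (simp add: zpow_def)
qed

text \<open>
  On \<open>V\<close>, where \<open>z\<close> may vanish, neither \<open>ds\<close> nor \<open>dz\<close> generates in general.  With \<open>A f2 + B f2' = 1\<close> the
  differential \<open>\<eta> = n B dz + A z ds\<close> does: the relation \<open>n z^(n-1) dz = f2' ds\<close> yields
  \<open>z^(n-1) \<eta> = ds\<close> and \<open>f2' \<eta> = n dz\<close>.  It is the differential \<open>ds / z^(n-1)\<close>.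
\<close>
lemma V_generator:
  "\<exists>\<eta>. zV X ^ (n - 1) \<odot> \<eta> = kd (sV X) \<and> (\<forall>\<omega>. \<exists>b. \<omega> = b \<odot> \<eta>)"
proof -
  obtain A0 B0 where "A0 * f + B0 * pderiv f = 1" using f_bezout by blast
  from flip_bezout[OF this degree_f l_pos] obtain A B where AB: "A * f2 + B * pderiv f2 = 1" by blast
  define z where "z = zV X"
  define ds dz where "ds = kd (sV X)" and "dz = kd (zV X)"
  have rel: "(of_nat n * z ^ (n - 1)) \<odot> dz = V.E (pderiv f2) \<odot> ds"
    using V.kd_y by (simp add: z_def ds_def dz_def)
  have zn: "z ^ n = V.E f2" using V.y_power by (simp add: z_def)
  have AB': "V.E A * V.E f2 + V.E B * V.E (pderiv f2) = 1"
    unfolding hom_mult[OF V.E_hom, symmetric] hom_add[OF V.E_hom, symmetric] AB by (rule hom_1[OF V.E_hom])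
  define \<eta> where "\<eta> = (of_nat n * V.E B) \<odot> dz + (V.E A * z) \<odot> ds"
  have zz: "z ^ (n - 1) * z = z ^ n" using n_pos by (cases n) simp_all
  have "z ^ (n - 1) \<odot> \<eta> = V.E B \<odot> (of_nat n * z ^ (n - 1)) \<odot> dz + (V.E A * (z ^ (n - 1) * z)) \<odot> ds"
    by (simp add: \<eta>_def kscale_add_right kscale_scale mult_ac)
  also have "\<dots> = (V.E A * V.E f2 + V.E B * V.E (pderiv f2)) \<odot> ds"
    unfolding rel zz zn kscale_scale kscale_add_left by (rule add.commute)
  finally have 1: "z ^ (n - 1) \<odot> \<eta> = ds" unfolding AB' kscale_one .
  have "V.E (pderiv f2) \<odot> \<eta> = (of_nat n * V.E B * V.E (pderiv f2)) \<odot> dz + (V.E A * z) \<odot> V.E (pderiv f2) \<odot> ds"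
    by (simp add: \<eta>_def kscale_add_right kscale_scale mult_ac)
  also have "\<dots> = (of_nat n * V.E B * V.E (pderiv f2) + of_nat n * (V.E A * (z ^ (n - 1) * z))) \<odot> dz"
    unfolding rel[symmetric] kscale_scale kscale_add_left by (simp add: mult_ac)
  also have "of_nat n * V.E B * V.E (pderiv f2) + of_nat n * (V.E A * (z ^ (n - 1) * z))
      = of_nat n * (V.E A * V.E f2 + V.E B * V.E (pderiv f2))"
    unfolding zz zn by (simp add: algebra_simps)
  finally have 2: "V.E (pderiv f2) \<odot> \<eta> = of_nat n \<odot> dz" unfolding AB' by simp
  note nV = V.cst_inv_n
  have "cstV X (1 / of_nat n) \<odot> V.E (pderiv f2) \<odot> \<eta> = dz"
    unfolding 2 kscale_scale nV kscale_one ..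
  then have 3: "dz = (cstV X (1 / of_nat n) * V.E (pderiv f2)) \<odot> \<eta>" by (simp add: kscale_scale)
  have "\<exists>b. \<omega> = b \<odot> \<eta>" for \<omega>
  proof -
    obtain C D where "\<omega> = C \<odot> ds + D \<odot> dz" using V.kaehler_span unfolding ds_def dz_def by blast
    then show ?thesis unfolding 3 1[symmetric] kscale_scale kscale_add_left[symmetric] by blast
  qed
  with 1 show ?thesis unfolding z_def ds_def by blast
qed

lemma kaehler_resV_inj:
  assumes "kaehler_map (resV X) \<omega> = 0" shows "\<omega> = 0"
proof -
  obtain \<eta> where \<eta>: "zV X ^ (n - 1) \<odot> \<eta> = kd (sV X)" "\<forall>\<omega>. \<exists>b. \<omega> = b \<odot> \<eta>"
    using V_generator by blast
  obtain b where b: "\<omega> = b \<odot> \<eta>" using \<eta>(2) by blast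
  have "(resV X b * - (s ^ 2)) \<odot> kd t = resV X b \<odot> kaehler_map (resV X) (kd (sV X))"
    by (simp add: kaehler_map_kd[OF resV_hom] resV_gens kd_s kscale_scale)
  also have "\<dots> = kaehler_map (resV X) (zV X ^ (n - 1) \<odot> b \<odot> \<eta>)"
    unfolding \<eta>(1)[symmetric] by (simp add: kaehler_map_scale[OF resV_hom] hom_mult[OF resV_hom] kscale_scale mult_ac)
  also have "\<dots> = 0 \<odot> kd t" using assms by (simp add: b[symmetric] kaehler_map_scale[OF resV_hom])
  finally have "resV X b * - (s ^ 2) = 0" by (rule kd_t_free)
  then have "resV X b * - (s ^ 2) * (t ^ 2) = 0" by simp
  then have "resV X b * (s ^ 2 * t ^ 2) = 0" by (simp add: mult.assoc)
  then have "resV X b = resV X 0" unfolding pow_st by (simp add: is_ring_hom_zero[OF resV_hom])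
  then have "b = 0" by (rule resV_inj)
  then show ?thesis by (simp add: b)
qed

lemma ds_over_z: "zV X ^ (n - 1) \<odot> ds_over_z n X = kd (sV X)"
proof -
  obtain \<eta> where \<eta>: "zV X ^ (n - 1) \<odot> \<eta> = kd (sV X)" using V_generator by blast
  have "\<eta>' = \<eta>" if "zV X ^ (n - 1) \<odot> \<eta>' = kd (sV X)" for \<eta>'
  proof -
    have "kaehler_map (resV X) (zV X ^ (n - 1) \<odot> (\<eta>' - \<eta>)) = 0"
      using \<eta> that by (simp add: kaehler.scale_right_diff_distrib kaehler_map_zero[OF resV_hom])
    then have "resV X (zV X) ^ (n - 1) \<odot> kaehler_map (resV X) (\<eta>' - \<eta>) = 0"
      by (simp only: kaehler_map_scale[OF resV_hom] hom_power[OF resV_hom])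
    then have "(unit_inv (resV X (zV X) ^ (n - 1)) * resV X (zV X) ^ (n - 1)) \<odot> kaehler_map (resV X) (\<eta>' - \<eta>) = 0"
      by (simp only: kscale_scale[symmetric] kaehler.scale_zero_right)
    then have "kaehler_map (resV X) (\<eta>' - \<eta>) = 0"
      unfolding mult.commute[of "unit_inv _"] unit_inv_right[OF power_dvd_1[OF zV_res_unit]] kscale_one .
    then show ?thesis using kaehler_resV_inj by force
  qed
  then show ?thesis unfolding ds_over_z_def by (rule theI[where P = "\<lambda>\<eta>. zV X ^ (n - 1) \<odot> \<eta> = kd (sV X)", OF \<eta>])
qed

text \<open>
  From \<open>ds = - t^(-2) dt\<close> and \<open>z = t^(-r) y\<close>.
\<close>
lemma res_ds_over_z:
  "kaehler_map (resV X) (ds_over_z n X) = (- (zpow t (int (r * (n - 1)) - 2) * Y ^ (n - 1))) \<odot> kd t"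
proof -
  let ?z = "resV X (zV X) ^ (n - 1)" and ?w = "t ^ (r * (n - 1)) * Y ^ (n - 1)"
  have "?w * ?z = (t ^ (r * (n - 1)) * s ^ (r * (n - 1))) * (Y * y) ^ (n - 1)"
    unfolding resV_gens power_mult_distrib power_mult by (simp only: mult_ac)
  then have wz: "?w * ?z = 1" by (simp add: pow_ts Yy)
  have "?z \<odot> kaehler_map (resV X) (ds_over_z n X) = (- (s ^ 2)) \<odot> kd t"
    using arg_cong[OF ds_over_z, of "kaehler_map (resV X)"]
    by (simp only: kaehler_map_scale[OF resV_hom] hom_power[OF resV_hom] kaehler_map_kd[OF resV_hom]
        resV_gens(2) kd_s)
  then have "?w \<odot> ?z \<odot> kaehler_map (resV X) (ds_over_z n X) = ?w \<odot> (- (s ^ 2)) \<odot> kd t" by (simp only:)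
  then have "kaehler_map (resV X) (ds_over_z n X) = (?w * - (s ^ 2)) \<odot> kd t"
    unfolding kscale_scale wz kscale_one .
  moreover have "zpow t (int (r * (n - 1)) - 2) = t ^ (r * (n - 1)) * s ^ 2"
    using zpow_add[OF t_unit, of "int (r * (n - 1))" "- int 2"] unfolding zpow_nat zpow_neg by simp
  ultimately show ?thesis by (simp add: mult_ac)
qed

end

section \<open>Cohomology classes and their decomposition\<close>

text \<open>
  Both cohomology groups are sets of cosets of a subgroup; the following lemmas are what is
  needed to calculate with representatives.
\<close>
definition is_subgroup :: "'m::ab_group_add set \<Rightarrow> bool" where
  "is_subgroup B \<longleftrightarrow> 0 \<in> B \<and> (\<forall>x\<in>B. \<forall>y\<in>B. x - y \<in> B)"

lemma is_subgroup_uminus: "is_subgroup B \<Longrightarrow> x \<in> B \<Longrightarrow> - x \<in> B"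
  unfolding is_subgroup_def by (metis diff_0)

lemma is_subgroup_add: "is_subgroup B \<Longrightarrow> x \<in> B \<Longrightarrow> y \<in> B \<Longrightarrow> x + y \<in> B"
  using is_subgroup_uminus[of B y] unfolding is_subgroup_def by (metis diff_minus_eq_add)

lemma coset_eq_iff:
  assumes "is_subgroup B"
  shows "x +o B = y +o B \<longleftrightarrow> x - y \<in> B"
proof
  assume "x +o B = y +o B"
  moreover have "x + 0 \<in> x +o B" using assms by (intro set_plus_intro2) (simp add: is_subgroup_def)
  ultimately have "x \<in> y +o B" by simp
  then show "x - y \<in> B" by (auto simp: elt_set_plus_def)
next
  assume xy: "x - y \<in> B"
  have "x +o B \<subseteq> y +o B" if "x - y \<in> B" for x y
  proof
    fix z assume "z \<in> x +o B"
    then obtain b where "b \<in> B" "z = x + b" by (auto simp: elt_set_plus_def)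
    then have "z = y + ((x - y) + b)" "(x - y) + b \<in> B"
      using that is_subgroup_add[OF assms] by simp_all
    then show "z \<in> y +o B" unfolding elt_set_plus_def by blast
  qed
  from this[OF xy] this[of y x] show "x +o B = y +o B"
    using is_subgroup_uminus[OF assms xy] by simp
qed

lemma subgroup_plus_self: assumes "is_subgroup B" "B' \<subseteq> B" "0 \<in> B'" shows "B' + B = B"
proof
  show "B' + B \<subseteq> B" using is_subgroup_add[OF assms(1)] assms(2) by (auto simp: set_plus_def)
  show "B \<subseteq> B' + B" using set_plus_intro[OF assms(3)] by fastforce
qed

lemma coset_add:
  assumes "is_subgroup B"
  shows "(x +o B) + (y +o B) = (x + y) +o B"
proof -
  have "B + B = B" using assms by (intro subgroup_plus_self) (auto simp: is_subgroup_def)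
  then show ?thesis by (simp add: set_plus_rearrange)
qed

context superelliptic
begin

lemma H1_bd_iff: "w \<in> H1_bd X \<longleftrightarrow> (\<exists>hU hV. w = resU X hU + resV X hV)"
  by (auto simp: H1_bd_def set_plus_def)

lemma H1_bd_subgroup: "is_subgroup (H1_bd X)"
  unfolding is_subgroup_def
proof (intro conjI ballI)
  show "0 \<in> H1_bd X"
    unfolding H1_bd_iff
    by (rule exI[of _ 0], rule exI[of _ 0])
      (simp add: is_ring_hom_zero[OF resU_hom] is_ring_hom_zero[OF resV_hom])
  fix w w' assume "w \<in> H1_bd X" "w' \<in> H1_bd X"
  then obtain hU hV hU' hV' where "w = resU X hU + resV X hV" "w' = resU X hU' + resV X hV'"
    unfolding H1_bd_iff by blast
  then have "w - w' = resU X (hU - hU') + resV X (hV - hV')"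
    by (simp add: is_ring_hom_diff[OF resU_hom] is_ring_hom_diff[OF resV_hom])
  then show "w - w' \<in> H1_bd X" unfolding H1_bd_iff by blast
qed

lemma DR_bd_subgroup: "is_subgroup (DR_bd X)"
  unfolding is_subgroup_def
proof (intro conjI ballI)
  show "0 \<in> DR_bd X"
    unfolding DR_bd_def mem_Collect_eq
    by (rule exI[of _ 0], rule exI[of _ 0])
      (simp add: is_ring_hom_zero[OF resU_hom] is_ring_hom_zero[OF resV_hom] kd_zero zero_prod_def)
  fix w w' assume "w \<in> DR_bd X" "w' \<in> DR_bd X"
  then obtain hU hV hU' hV' where "w = (kd hU, - kd hV, resU X hU + resV X hV)"
    "w' = (kd hU', - kd hV', resU X hU' + resV X hV')"
    unfolding DR_bd_def by blast
  then have "w - w' = (kd (hU - hU'), - kd (hV - hV'), resU X (hU - hU') + resV X (hV - hV'))"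
    by (simp add: is_ring_hom_diff[OF resU_hom] is_ring_hom_diff[OF resV_hom] kd_diff)
  then show "w - w' \<in> DR_bd X" unfolding DR_bd_def by blast
qed

text \<open>
  A global differential is determined by its restriction to the overlap.
\<close>
lemma H0_eqI:
  assumes "\<omega> \<in> H0 X" "\<omega>' \<in> H0 X"
    and "kaehler_map (resU X) (fst \<omega>) = kaehler_map (resU X) (fst \<omega>')"
  shows "\<omega> = \<omega>'"
proof (rule prod_eqI)
  have "kaehler_map (resU X) (fst \<omega> - fst \<omega>') = 0"
    using assms(3) by (simp add: kaehler_map_diff[OF resU_hom])
  then have "fst \<omega> - fst \<omega>' = 0" by (rule kaehler_resU_inj)
  then show "fst \<omega> = fst \<omega>'" by simp
  have "kaehler_map (resV X) (snd \<omega> - snd \<omega>') = 0"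
    using assms by (simp add: kaehler_map_diff[OF resV_hom] H0_def case_prod_beta)
  then have "snd \<omega> - snd \<omega>' = 0" by (rule kaehler_resV_inj)
  then show "snd \<omega> = snd \<omega>'" by simp
qed

lemma H0_sum: "(\<And>a. a \<in> A \<Longrightarrow> g a \<in> H0 X) \<Longrightarrow> sum g A \<in> H0 X"
  by (simp add: H0_def case_prod_beta fst_sum snd_sum kaehler_map_sum[OF resU_hom]
      kaehler_map_sum[OF resV_hom])

lemma H0_scale_H0: "\<omega> \<in> H0 X \<Longrightarrow> H0_scale X c \<omega> \<in> H0 X"
  by (simp add: H0_def H0_scale_def case_prod_beta kaehler_map_scale[OF resU_hom]
      kaehler_map_scale[OF resV_hom] resU_gens resV_gens)

text \<open>
  On \<open>V\<close> the differential \<open>t^m y^(-j) dt\<close> is \<open>- s^(r j - 2 - m) z^(n-1-j) ds / z^(n-1)\<close>; the bound on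
  \<open>m\<close> makes the exponent of \<open>s\<close> nonnegative.
\<close>
lemma omega_global:
  assumes "1 \<le> j" "j \<le> n - 1" "m + 2 \<le> r * j"
  shows "omega X m j \<in> H0 X"
    and "kaehler_map (resU X) (fst (omega X m j)) = (t ^ m * Y ^ j) \<odot> kd t"
proof -
  let ?\<omega>U = "(tU X ^ m * unit_inv (yU X) ^ j) \<odot> kd (tU X)"
  let ?\<omega>V = "(- (sV X ^ (r * j - 2 - m) * zV X ^ (n - 1 - j))) \<odot> ds_over_z n X"
  have resU: "kaehler_map (resU X) ?\<omega>U = (t ^ m * Y ^ j) \<odot> kd t"
    by (simp add: kaehler_map_scale_kd[OF resU_hom] hom_mult[OF resU_hom] hom_power[OF resU_hom]
        hom_unit_inv[OF resU_hom yU_unit] resU_gens)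
  have "kaehler_map (resV X) ?\<omega>V = (s ^ (r * j - 2 - m) * (s ^ r * y) ^ (n - 1 - j)
      * (zpow t (int (r * (n - 1)) - 2) * Y ^ (n - 1))) \<odot> kd t"
    unfolding kaehler_map_scale[OF resV_hom] hom_uminus[OF resV_hom] hom_mult[OF resV_hom]
      hom_power[OF resV_hom] resV_gens res_ds_over_z kscale_scale minus_mult_minus ..
  also have "s ^ (r * j - 2 - m) * (s ^ r * y) ^ (n - 1 - j)
      * (zpow t (int (r * (n - 1)) - 2) * Y ^ (n - 1))
    = (zpow t (- int (r * j - 2 - m)) * zpow t (- int (r * (n - 1 - j)))
        * zpow t (int (r * (n - 1)) - 2)) * (y ^ (n - 1 - j) * Y ^ (n - 1))"
    unfolding zpow_neg power_mult_distrib power_mult by (simp only: mult_ac)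
  also have "zpow t (- int (r * j - 2 - m)) * zpow t (- int (r * (n - 1 - j)))
        * zpow t (int (r * (n - 1)) - 2) = t ^ m"
  proof -
    have "r * (n - 1) = r * j + r * (n - 1 - j)"
      unfolding distrib_left[symmetric] using assms(2) by (intro arg_cong[where f = "(*) r"]) linarith
    then have "- int (r * j - 2 - m) + - int (r * (n - 1 - j)) + (int (r * (n - 1)) - 2) = int m"
      using assms(3) by linarith
    then show ?thesis unfolding zpow_add[OF t_unit, symmetric] by (simp only: zpow_nat)
  qed
  also have "y ^ (n - 1 - j) * Y ^ (n - 1) = Y ^ j"
  proof -
    have "Y ^ (n - 1) = Y ^ (n - 1 - j) * Y ^ j"
      unfolding power_add[symmetric] using assms(2) by (intro arg_cong[where f = "(^) Y"]) linarith
    then have "y ^ (n - 1 - j) * Y ^ (n - 1) = (y * Y) ^ (n - 1 - j) * Y ^ j"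
      by (simp only: power_mult_distrib mult.assoc)
    then show ?thesis by (simp add: yY)
  qed
  finally have H0: "(?\<omega>U, ?\<omega>V) \<in> H0 X" by (simp add: H0_def resU)
  have "omega X m j = (?\<omega>U, ?\<omega>V)"
    unfolding omega_def
  proof (rule the_equality)
    show "(?\<omega>U, ?\<omega>V) \<in> H0 X \<and> fst (?\<omega>U, ?\<omega>V) = ?\<omega>U" using H0 by simp
    show "\<omega> = (?\<omega>U, ?\<omega>V)" if "\<omega> \<in> H0 X \<and> fst \<omega> = ?\<omega>U" for \<omega>
      using that by (intro H0_eqI H0) auto
  qed
  then show "omega X m j \<in> H0 X"
    and "kaehler_map (resU X) (fst (omega X m j)) = (t ^ m * Y ^ j) \<odot> kd t"
    using H0 resU by auto
qed

definition h_comb :: "(nat \<Rightarrow> nat \<Rightarrow> 'k) \<Rightarrow> 'c" where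
  "h_comb c = (\<Sum>j<n. \<Sum>i = 1..<r * j. cst (c i j) * h_fun X i j)"

definition tau_comb :: "(nat \<Rightarrow> nat \<Rightarrow> 'k) \<Rightarrow> 'a kaehler \<times> 'b kaehler \<times> 'c" where
  "tau_comb c = (\<Sum>j<n. \<Sum>i = 1..<r * j. triple_scale X (c i j)
     (alphaU n l f X i j, - alphaV n r f X i j, h_fun X i j))"

text \<open>
  The axioms of \<open>\<tau>\<close> only speak of cosets; this transfers them to representatives.
\<close>
lemma tau_h_comb:
  assumes "is_tau n l r f X \<tau>"
  shows "\<tau> (h_comb c +o H1_bd X) = tau_comb c"
proof -
  let ?cl = "\<lambda>x. x +o H1_bd X"
  have cl: "?cl x \<in> H1 X" for x by (simp add: H1_def)
  have add: "\<tau> (?cl (x + y)) = \<tau> (?cl x) + \<tau> (?cl y)" for x y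
    using assms cl unfolding is_tau_def coset_add[OF H1_bd_subgroup, symmetric] by blast
  have zero: "\<tau> (?cl 0) = 0" using add[of 0 0] by simp
  have sum: "\<tau> (?cl (sum g A)) = (\<Sum>a\<in>A. \<tau> (?cl (g a)))" for g :: "nat \<Rightarrow> 'c" and A
    by (induction A rule: infinite_finite_induct) (simp_all add: zero[simplified] add)
  have scale: "H1_scale X a (?cl x) = ?cl (cst a * x)" for a x
  proof -
    have "(\<lambda>x. cst a * x) ` (?cl x) = (cst a * x) +o ((\<lambda>x. cst a * x) ` H1_bd X)"
    proof -
      have image: "u +o B = (\<lambda>b. u + b) ` B" for u :: 'c and B by (auto simp: elt_set_plus_def)
      show ?thesis unfolding image image_image by (simp add: distrib_left)
    qed
    moreover have "(\<lambda>x. cst a * x) ` H1_bd X + H1_bd X = H1_bd X"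
    proof (rule subgroup_plus_self[OF H1_bd_subgroup])
      show "(\<lambda>x. cst a * x) ` H1_bd X \<subseteq> H1_bd X"
      proof
        fix w assume "w \<in> (\<lambda>x. cst a * x) ` H1_bd X"
        then obtain hU hV where "w = cst a * (resU X hU + resV X hV)"
          unfolding image_iff Bex_def H1_bd_iff by blast
        then have "w = resU X (cstU X a * hU) + resV X (cstV X a * hV)"
          by (simp add: hom_mult[OF resU_hom] hom_mult[OF resV_hom] resU_gens resV_gens distrib_left)
        then show "w \<in> H1_bd X" unfolding H1_bd_iff by blast
      qed
      have "0 \<in> H1_bd X" using H1_bd_subgroup by (simp add: is_subgroup_def)
      then have "cst a * 0 \<in> (\<lambda>x. cst a * x) ` H1_bd X" by (rule imageI)
      then show "0 \<in> (\<lambda>x. cst a * x) ` H1_bd X" by simp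
    qed
    ultimately show ?thesis unfolding H1_scale_def by (simp only: set_plus_rearrange2[symmetric] set_plus_rearrange3)
  qed
  have "\<tau> (?cl (cst (c i j) * h_fun X i j)) = triple_scale X (c i j)
     (alphaU n l f X i j, - alphaV n r f X i j, h_fun X i j)" if "j < n" "i \<in> {1..<r * j}" for i j
  proof -
    have "\<tau> (?cl (cst (c i j) * h_fun X i j)) = triple_scale X (c i j) (\<tau> (hbar X i j))"
      unfolding scale[symmetric] hbar_def using assms cl unfolding is_tau_def by blast
    moreover have "1 \<le> j \<and> j \<le> n - 1 \<and> 1 \<le> i \<and> i \<le> r * j - 1"
      using that by (cases j) auto
    ultimately show ?thesis using assms unfolding is_tau_def by simp
  qed
  then show ?thesis unfolding h_comb_def tau_comb_def sum by simp
qed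

lemma H1_comb: assumes "x \<in> H1 X" obtains c where "x = h_comb c +o H1_bd X"
proof -
  obtain w where x: "x = w +o H1_bd X" using assms by (auto simp: H1_def)
  have "w \<in> h_span" by (rule h_span_UNIV)
  then obtain c hU hV where "w = h_comb c + resU X hU + resV X hV"
    unfolding h_span_def h_comb_def by blast
  then have "w - h_comb c = resU X hU + resV X hV" by simp
  then have "x = h_comb c +o H1_bd X"
    unfolding x coset_eq_iff[OF H1_bd_subgroup] H1_bd_iff by blast
  then show thesis by (rule that)
qed

lemma tau_comb_snd: "snd (snd (tau_comb c)) = h_comb c"
  by (simp add: tau_comb_def h_comb_def snd_sum triple_scale_def)

text \<open>
  \<open>P2\<close> is defined through an arbitrary inverse of the identification, so its value needs
  injectivity.  If two pairs have the same image, the third components show that a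
  combination of the \<open>h_ij\<close> is a coboundary \<open>hU + hV\<close>.  Hence the combination is zero and \<open>hU\<close>, \<open>hV\<close>
  are constants, and then the differentials agree as well.
\<close>
lemma P2_DR_ident:
  assumes \<tau>: "is_tau n l r f X \<tau>" and "\<omega> \<in> H0 X" "x \<in> H1 X"
  shows "P2 X \<tau> (DR_ident X \<tau> (\<omega>, x)) = \<omega>"
proof -
  let ?A = "H0 X \<times> H1 X" and ?f = "DR_ident X \<tau>"
  have ident: "?f (\<omega>, x) = ((fst \<omega>, snd \<omega>, 0) + \<tau> x) +o DR_bd X" for \<omega> x
    by (simp add: DR_ident_def DR_class_def coset_add[OF DR_bd_subgroup])
  obtain \<omega>' x' where wx': "inv_into ?A ?f (?f (\<omega>, x)) = (\<omega>', x')" by fastforce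
  have "?f (\<omega>, x) \<in> ?f ` ?A" using assms by simp
  from inv_into_into[OF this] f_inv_into_f[OF this]
  have "x' \<in> H1 X" and eq: "?f (\<omega>', x') = ?f (\<omega>, x)" unfolding wx' by auto
  obtain c where c: "x = h_comb c +o H1_bd X" using assms(3) by (rule H1_comb)
  obtain c' where c': "x' = h_comb c' +o H1_bd X" using \<open>x' \<in> H1 X\<close> by (rule H1_comb)
  have "((fst \<omega>', snd \<omega>', 0) + tau_comb c') - ((fst \<omega>, snd \<omega>, 0) + tau_comb c) \<in> DR_bd X"
    using eq unfolding ident c c' tau_h_comb[OF \<tau>] coset_eq_iff[OF DR_bd_subgroup] .
  then obtain hU hV where bd: "((fst \<omega>', snd \<omega>', 0) + tau_comb c') - ((fst \<omega>, snd \<omega>, 0) + tau_comb c)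
      = (kd hU, - kd hV, resU X hU + resV X hV)"
    unfolding DR_bd_def by blast
  have "h_comb c' - h_comb c = resU X hU + resV X hV"
    using arg_cong[OF bd, of "\<lambda>x. snd (snd x)"] by (simp add: tau_comb_snd)
  then have rel: "(\<Sum>j<n. \<Sum>i = 1..<r * j. cst (c' i j - c i j) * h_fun X i j) = resU X hU + resV X hV"
    unfolding h_comb_def is_ring_hom_diff[OF UV.cst_hom]
    by (simp add: left_diff_distrib sum_subtractf)
  have "tau_comb c' = tau_comb c"
    unfolding tau_comb_def using overlap_relation(1)[OF rel] by (intro sum.cong refl) simp
  moreover obtain k where "hU = cstU X (- k)" "hV = cstV X k" using overlap_relation(2)[OF rel] by blast
  then have "kd hU = 0" "kd hV = 0" by (simp_all add: kd_const[OF U.cst_hom] kd_const[OF V.cst_hom])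
  ultimately have "fst \<omega>' = fst \<omega>" "snd \<omega>' = snd \<omega>"
    using arg_cong[OF bd, of fst] arg_cong[OF bd, of "\<lambda>x. fst (snd x)"] by simp_all
  then have "\<omega>' = \<omega>" by (rule prod_eqI)
  then show ?thesis unfolding P2_def wx' by simp
qed

end

section \<open>Laurent expansions of differentials on the overlap\<close>

context superelliptic
begin

text \<open>
  The derivative of \<open>t^k y^j\<close> is the sum over \<open>m\<close> of \<open>(j m + k n) / n f[m] t^(k+m-1)\<close>, multiplied by
  \<open>y^(j-n) dt\<close>.  The latter is \<open>W j\<close> below, and \<open>Lplus\<close>, \<open>Lminus\<close> collect the nonnegative and
  the negative powers of \<open>t\<close>.
\<close>
definition dcoef :: "nat \<Rightarrow> int \<Rightarrow> int \<Rightarrow> 'k" where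
  "dcoef j k m = of_int (int j * m + k * int n) / of_nat n * icoeff f m"

definition Lplus :: "nat \<Rightarrow> int \<Rightarrow> 'c" where
  "Lplus j k = (\<Sum>m | m \<le> l \<and> 0 \<le> k + int m - 1. cst (dcoef j k (int m)) * zpow t (k + int m - 1))"

definition Lminus :: "nat \<Rightarrow> int \<Rightarrow> 'c" where
  "Lminus j k = (\<Sum>m | m \<le> l \<and> k + int m - 1 < 0. cst (dcoef j k (int m)) * zpow t (k + int m - 1))"

definition W :: "nat \<Rightarrow> 'c kaehler" where
  "W j = (y ^ (j - 1) * Y ^ (n - 1)) \<odot> kd t"

lemma L_sum: "Lplus j k + Lminus j k = (\<Sum>m\<le>l. cst (dcoef j k (int m)) * zpow t (k + int m - 1))"
proof -
  have "{..l} = {m. m \<le> l \<and> 0 \<le> k + int m - 1} \<union> {m. m \<le> l \<and> k + int m - 1 < 0}" by auto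
  then show ?thesis unfolding Lplus_def Lminus_def by (simp add: sum.union_disjoint disjoint_iff)
qed

text \<open>
  The only candidate for a negative power is the term \<open>k = m = 0\<close>, whose coefficient is zero.
\<close>
lemma Lminus_eq_0: assumes "0 \<le> k" shows "Lminus j k = 0"
  unfolding Lminus_def
proof (rule sum.neutral, rule ballI)
  fix m assume "m \<in> {m. m \<le> l \<and> k + int m - 1 < 0}"
  then have "k = 0" "m = 0" using assms by auto
  then show "cst (dcoef j k (int m)) * zpow t (k + int m - 1) = 0"
    by (simp add: dcoef_def is_ring_hom_zero[OF UV.cst_hom])
qed

text \<open>
  Here \<open>y^n = f(t)\<close> is used twice: to express \<open>dy\<close> by \<open>dt\<close>, and to write \<open>y^j\<close> as \<open>f(t) y^(j-n)\<close> in order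
  to give both terms of the product rule the factor \<open>y^(j-n)\<close>.
\<close>
lemma kd_monomial:
  assumes "1 \<le> j"
  shows "kd (cst c * (zpow t k * y ^ j)) = (cst c * (Lplus j k + Lminus j k)) \<odot> W j"
proof -
  let ?N = "cst (1 / of_nat n)"
  have E: "UV.E f = (\<Sum>m\<le>l. cst (coeff f m) * zpow t (int m))"
    unfolding ev_sum[OF UV.cst_hom eq_refl[OF degree_f]] zpow_nat ..
  have tE': "t * UV.E (pderiv f) = (\<Sum>m\<le>l. cst (of_nat m * coeff f m) * zpow t (int m))"
  proof -
    have c: "coeff (monom 1 1 * pderiv f) m = of_nat m * coeff f m" for m
      by (cases m) (simp_all add: coeff_monom_mult coeff_pderiv)
    have "t * UV.E (pderiv f) = UV.E (monom 1 1 * pderiv f)"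
      by (simp add: hom_mult[OF UV.E_hom] ev_monom[OF UV.cst_hom] hom_1[OF UV.cst_hom])
    also have "\<dots> = (\<Sum>m\<le>l. cst (coeff (monom 1 1 * pderiv f) m) * t ^ m)"
      by (rule ev_sum[OF UV.cst_hom], rule degree_le)
        (use degree_f in \<open>auto simp: coeff_monom_mult coeff_pderiv intro: coeff_eq_0\<close>)
    finally show ?thesis unfolding c zpow_nat .
  qed
  have zk: "zpow t k = zpow t (k - 1) * t"
    using zpow_Suc[OF t_unit, of "k - 1"] by (simp add: mult.commute)
  have yj: "y ^ j = UV.E f * (y ^ (j - 1) * Y ^ (n - 1))"
  proof -
    have "UV.E f * (y ^ (j - 1) * Y ^ (n - 1)) = y ^ (n - 1 + 1) * y ^ (j - 1) * Y ^ (n - 1)"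
      using n_pos by (simp add: UV.y_power mult.assoc)
    also have "\<dots> = y ^ (j - 1 + 1) * (y * Y) ^ (n - 1)"
      by (simp only: power_add power_mult_distrib mult_ac)
    finally show ?thesis using assms by (simp add: yY)
  qed
  have "kd (cst c * (zpow t k * y ^ j)) = cst c \<odot> kd (zpow t k * y ^ j)"
    by (simp add: kd_mult kd_const[OF UV.cst_hom])
  also have "kd (zpow t k * y ^ j) = (zpow t k * (of_nat j * y ^ (j - 1)) * (?N * Y ^ (n - 1) * UV.E (pderiv f))
      + y ^ j * (of_int k * zpow t (k - 1))) \<odot> kd t"
    unfolding kd_mult kd_power[of y] kd_y kd_zpow[OF t_unit] kscale_scale kscale_add_left mult.assoc ..
  also have "zpow t k * (of_nat j * y ^ (j - 1)) * (?N * Y ^ (n - 1) * UV.E (pderiv f))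
      + y ^ j * (of_int k * zpow t (k - 1))
    = (zpow t (k - 1) * (of_nat j * ?N * (t * UV.E (pderiv f)) + of_int k * UV.E f)) * (y ^ (j - 1) * Y ^ (n - 1))"
    unfolding yj zk by (simp only: algebra_simps)
  also have "of_nat j * ?N * (t * UV.E (pderiv f)) + of_int k * UV.E f
      = (\<Sum>m\<le>l. cst (dcoef j k (int m)) * zpow t (int m))"
    unfolding tE' E sum_distrib_left sum.distrib[symmetric]
  proof (rule sum.cong[OF refl])
    fix m assume "m \<in> {..l}"
    have d: "dcoef j k (int m) = of_nat j * (1 / of_nat n) * (of_nat m * coeff f m) + of_int k * coeff f m"
      using n_unit by (simp add: dcoef_def icoeff_def field_simps)
    show "of_nat j * ?N * (cst (of_nat m * coeff f m) * zpow t (int m)) + of_int k * (cst (coeff f m) * zpow t (int m))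
        = cst (dcoef j k (int m)) * zpow t (int m)"
      unfolding d hom_add[OF UV.cst_hom] hom_mult[OF UV.cst_hom] hom_of_nat[OF UV.cst_hom]
        hom_of_int[OF UV.cst_hom] by (simp only: algebra_simps)
  qed
  also have "zpow t (k - 1) * (\<Sum>m\<le>l. cst (dcoef j k (int m)) * zpow t (int m)) = Lplus j k + Lminus j k"
    unfolding L_sum sum_distrib_left
  proof (rule sum.cong[OF refl])
    fix m
    have "zpow t (k + int m - 1) = zpow t (k - 1) * zpow t (int m)"
      using zpow_add[OF t_unit, of "k - 1" "int m"] by (simp add: algebra_simps)
    then show "zpow t (k - 1) * (cst (dcoef j k (int m)) * zpow t (int m))
        = cst (dcoef j k (int m)) * zpow t (k + int m - 1)"
      by (simp only: mult_ac)
  qed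
  finally show ?thesis unfolding W_def kscale_scale mult.assoc .
qed

lemma res_alphaU:
  "kaehler_map (resU X) (alphaU n l f X i j) = Lplus j (- int i) \<odot> W j"
proof -
  have "{m. m \<le> l \<and> 0 \<le> - int i + int m - 1} = {i + 1..l}" by auto
  then have "Lplus j (- int i) = (\<Sum>m = i + 1..l.
      cst (of_int (int j * int m - int i * int n) / of_nat n * coeff f m) * t ^ (m - (i + 1)))"
    unfolding Lplus_def
  proof (rule sum.cong)
    fix m assume "m \<in> {i + 1..l}"
    then have m: "- int i + int m - 1 = int (m - (i + 1))" by simp
    show "cst (dcoef j (- int i) (int m)) * zpow t (- int i + int m - 1)
        = cst (of_int (int j * int m - int i * int n) / of_nat n * coeff f m) * t ^ (m - (i + 1))"
      unfolding m zpow_nat by (simp add: dcoef_def icoeff_def)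
  qed
  then show ?thesis
    unfolding alphaU_def W_def
    by (simp add: kaehler_map_scale_kd[OF resU_hom] hom_mult[OF resU_hom] hom_power[OF resU_hom]
        hom_sum[OF resU_hom] hom_unit_inv[OF resU_hom yU_unit] resU_gens kscale_scale mult.assoc)
qed

text \<open>
  The powers of \<open>s\<close> in \<open>\<alpha>^V\<close> combine with \<open>z^(j-1)\<close> and with \<open>ds / z^(n-1)\<close> to \<open>t^(m-i-1)\<close>, which is a
  negative power precisely because \<open>m \<le> i\<close>.  The sign of \<open>ds = - t^(-2) dt\<close> turns \<open>i n - j m\<close> into
  \<open>j m - i n\<close>.
\<close>
lemma res_alphaV:
  assumes "1 \<le> j" "j \<le> n - 1"
  shows "kaehler_map (resV X) (alphaV n r f X i j) = Lminus j (- int i) \<odot> W j"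
proof -
  let ?e = "\<lambda>m. i + 1 + (n - j) * r - 2 - m"
  have r_pos: "0 < r" using rn by (cases r) auto
  have "r * 1 \<le> r * (n - j)" using assms n_pos by (intro mult_le_mono2) auto
  then have nj: "r \<le> (n - j) * r" by (simp add: mult.commute)
  have rsplit: "r * (n - 1) + r = (n - j) * r + r * (j - 1) + r"
  proof -
    have "n = (n - j) + (j - 1) + 1" using assms by simp
    then have "r * n = r * ((n - j) + (j - 1) + 1)" by simp
    then show ?thesis using n_pos by (cases n) (simp_all add: algebra_simps)
  qed
  have exp: "s ^ ?e m * (s ^ r) ^ (j - 1) * zpow t (int (r * (n - 1)) - 2) = zpow t (- int i + int m - 1)"
    if "m \<le> i" for m
  proof -
    have "- int i + int m - 1 = - int (?e m) + - int (r * (j - 1)) + (int (r * (n - 1)) - 2)"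
      using that nj r_pos rsplit by linarith
    then have "zpow t (- int i + int m - 1)
        = zpow t (- int (?e m)) * zpow t (- int (r * (j - 1))) * zpow t (int (r * (n - 1)) - 2)"
      by (simp only: zpow_add[OF t_unit])
    then show ?thesis unfolding zpow_neg power_mult by simp
  qed
  have "Lminus j (- int i) = (\<Sum>m = 0..i. cst (dcoef j (- int i) (int m)) * zpow t (- int i + int m - 1))"
    unfolding Lminus_def
  proof (rule sum.mono_neutral_left)
    show "\<forall>m\<in>{0..i} - {m. m \<le> l \<and> - int i + int m - 1 < 0}.
        cst (dcoef j (- int i) (int m)) * zpow t (- int i + int m - 1) = 0"
    proof
      fix m assume "m \<in> {0..i} - {m. m \<le> l \<and> - int i + int m - 1 < 0}"
      then have "coeff f m = 0" using degree_f by (intro coeff_eq_0) auto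
      then show "cst (dcoef j (- int i) (int m)) * zpow t (- int i + int m - 1) = 0"
        by (simp add: dcoef_def icoeff_def is_ring_hom_zero[OF UV.cst_hom])
    qed
  qed auto
  also have "\<dots> = (\<Sum>m = 0..i. - (cst (of_int (int i * int n - int j * int m) / of_nat n * coeff f m) * s ^ ?e m))
      * (s ^ r) ^ (j - 1) * zpow t (int (r * (n - 1)) - 2)"
    unfolding sum_distrib_right
  proof (rule sum.cong[OF refl])
    fix m assume "m \<in> {0..i}"
    then have m: "m \<le> i" by simp
    have neg: "int j * int m + - int i * int n = - (int i * int n - int j * int m)"
      by (simp add: algebra_simps)
    have "dcoef j (- int i) (int m) = - (of_int (int i * int n - int j * int m) / of_nat n * coeff f m)"
    proof -
      have "icoeff f (int m) = coeff f m" by (simp add: icoeff_def)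
      then show ?thesis
        unfolding dcoef_def neg of_int_minus by (simp only: minus_divide_left[symmetric] minus_mult_left)
    qed
    then have d: "cst (dcoef j (- int i) (int m)) = - cst (of_int (int i * int n - int j * int m) / of_nat n * coeff f m)"
      by (simp only: hom_uminus[OF UV.cst_hom])
    show "cst (dcoef j (- int i) (int m)) * zpow t (- int i + int m - 1)
        = - (cst (of_int (int i * int n - int j * int m) / of_nat n * coeff f m) * s ^ ?e m)
          * (s ^ r) ^ (j - 1) * zpow t (int (r * (n - 1)) - 2)"
      unfolding d exp[OF m, symmetric] by (simp only: mult_minus_left mult_minus_right mult_ac)
  qed
  finally have L: "Lminus j (- int i) = \<dots>" .
  show ?thesis
    unfolding alphaV_def W_def kaehler_map_scale[OF resV_hom] res_ds_over_z L kscale_scale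
      hom_mult[OF resV_hom] hom_power[OF resV_hom] hom_sum[OF resV_hom] resV_gens power_mult_distrib sum_negf
    by (simp add: mult_ac)
qed

text \<open>
  The same sum indexed by the exponent of \<open>t\<close>; the coefficients of \<open>f\<close> outside its range are zero.
\<close>
lemma Lplus_expand:
  assumes "k + int l \<le> int L"
  shows "Lplus j k = (\<Sum>m\<le>L. cst (dcoef j k (int m + 1 - k)) * t ^ m)"
proof -
  have "Lplus j k = (\<Sum>m | m \<le> L \<and> 0 \<le> int m + 1 - k \<and> int m + 1 - k \<le> int l. cst (dcoef j k (int m + 1 - k)) * t ^ m)"
    unfolding Lplus_def
    by (rule sum.reindex_bij_witness[of _ "\<lambda>m. nat (int m + 1 - k)" "\<lambda>m. nat (k + int m - 1)"])
      (use assms in \<open>auto simp: zpow_def\<close>)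
  also have "\<dots> = (\<Sum>m\<le>L. cst (dcoef j k (int m + 1 - k)) * t ^ m)"
  proof (rule sum.mono_neutral_left)
    show "\<forall>m\<in>{..L} - {m. m \<le> L \<and> 0 \<le> int m + 1 - k \<and> int m + 1 - k \<le> int l}.
        cst (dcoef j k (int m + 1 - k)) * t ^ m = 0"
    proof
      fix m assume "m \<in> {..L} - {m. m \<le> L \<and> 0 \<le> int m + 1 - k \<and> int m + 1 - k \<le> int l}"
      then have "int m + 1 - k < 0 \<or> int m + 1 - k > int l" by auto
      then have "icoeff f (int m + 1 - k) = 0"
        using degree_f by (auto simp: icoeff_def intro!: coeff_eq_0)
      then show "cst (dcoef j k (int m + 1 - k)) * t ^ m = 0"
        by (simp add: dcoef_def is_ring_hom_zero[OF UV.cst_hom])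
    qed
  qed auto
  finally show ?thesis .
qed

lemma W_free: "a \<odot> W j = 0 \<Longrightarrow> a = 0"
proof -
  assume "a \<odot> W j = 0"
  then have "(a * (y ^ (j - 1) * Y ^ (n - 1))) \<odot> kd t = 0 \<odot> kd t"
    by (simp add: W_def kscale_scale)
  then have "a * (y ^ (j - 1) * Y ^ (n - 1)) = 0" by (rule kd_t_free)
  then have "a * (y ^ (j - 1) * Y ^ (n - 1)) * (Y ^ (j - 1) * y ^ (n - 1)) = 0" by simp
  then have "a * ((y * Y) ^ (j - 1) * (Y * y) ^ (n - 1)) = 0"
    unfolding power_mult_distrib by (simp only: mult_ac)
  then show "a = 0" by (simp add: yY Yy)
qed

lemma UV_E_inj: "UV.E q = 0 \<Longrightarrow> q = 0"
proof -
  assume q: "UV.E q = 0"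
  have "(\<Sum>j<n. UV.E (if j = 0 then q else 0) * y ^ j) = (\<Sum>j<n. 0)"
    by (rule sum.cong) (auto simp: q)
  then have "(if (0::nat) = 0 then q else 0) = 0"
    by (intro UV_independent[of "\<lambda>j. if j = 0 then q else 0" 0]) (simp_all add: n_pos)
  then show "q = 0" by simp
qed

text \<open>
  The hypothesis states that the derivative of the sum of the \<open>F[u] t^(u-N) y^b\<close> is zero.
  Multiplied by \<open>t^(N+1)\<close> it becomes a polynomial identity, and the conclusion is its coefficient
  at \<open>t^(m+1+N)\<close>.
\<close>
lemma closed_coefficient:
  assumes "1 \<le> b" "(\<Sum>u\<le>d. cst (F u) * (Lplus b (int u - int N) + Lminus b (int u - int N))) = 0"
  shows "(\<Sum>u\<le>d. F u * dcoef b (int u - int N) (int m + 1 + int N - int u)) = 0"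
proof -
  define e where "e = m + 1 + N"
  define G where "G = (\<Sum>u\<le>d. \<Sum>i\<le>l. monom (F u * dcoef b (int u - int N) (int i)) (u + i))"
  have "cst (F u) * (Lplus b (int u - int N) + Lminus b (int u - int N))
      = zpow t (- int N - 1) * UV.E (\<Sum>i\<le>l. monom (F u * dcoef b (int u - int N) (int i)) (u + i))" for u
    unfolding L_sum hom_sum[OF UV.E_hom] sum_distrib_left
  proof (rule sum.cong[OF refl])
    fix i
    have "int u - int N + int i - 1 = (- int N - 1) + int (u + i)" by simp
    then have z: "zpow t (int u - int N + int i - 1) = zpow t (- int N - 1) * t ^ (u + i)"
      by (simp only: zpow_add[OF t_unit] zpow_nat)
    show "cst (F u) * (cst (dcoef b (int u - int N) (int i)) * zpow t (int u - int N + int i - 1))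
        = zpow t (- int N - 1) * UV.E (monom (F u * dcoef b (int u - int N) (int i)) (u + i))"
      unfolding z ev_monom[OF UV.cst_hom] hom_mult[OF UV.cst_hom] by (simp only: mult_ac)
  qed
  then have "zpow t (- int N - 1) * UV.E G = zpow t (- int N - 1) * 0"
    using assms(2) unfolding G_def hom_sum[OF UV.E_hom, of _ "{..d}"] sum_distrib_left by simp
  then have "UV.E G = 0" by (rule unit_cancel[OF zpow_unit[OF t_unit]])
  then have "G = 0" by (rule UV_E_inj)
  then have "0 = coeff G e" by simp
  also have "\<dots> = (\<Sum>u\<le>d. F u * dcoef b (int u - int N) (int m + 1 + int N - int u))"
    unfolding G_def coeff_sum
  proof (rule sum.cong[OF refl])
    fix u
    show "(\<Sum>i\<le>l. coeff (monom (F u * dcoef b (int u - int N) (int i)) (u + i)) e)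
        = F u * dcoef b (int u - int N) (int m + 1 + int N - int u)"
    proof (cases "u \<le> e \<and> e \<le> u + l")
      case True
      then have e: "int (e - u) = int m + 1 + int N - int u" by (simp add: e_def)
      have "(\<Sum>i\<le>l. coeff (monom (F u * dcoef b (int u - int N) (int i)) (u + i)) e)
          = (\<Sum>i\<le>l. if i = e - u then F u * dcoef b (int u - int N) (int (e - u)) else 0)"
        by (rule sum.cong) (use True in auto)
      also have "\<dots> = F u * dcoef b (int u - int N) (int (e - u))"
      proof -
        have "e - u \<le> l" using True by linarith
        then show ?thesis by (simp only: sum.delta finite_atMost atMost_iff if_True)
      qed
      finally show ?thesis unfolding e .
    next
      case False
      then have "int m + 1 + int N - int u < 0 \<or> int l < int m + 1 + int N - int u"
        by (auto simp: e_def)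
      then have "icoeff f (int m + 1 + int N - int u) = 0"
        using degree_f by (auto simp: icoeff_def intro!: coeff_eq_0)
      moreover have "(\<Sum>i\<le>l. coeff (monom (F u * dcoef b (int u - int N) (int i)) (u + i)) e) = 0"
        by (rule sum.neutral) (use False in auto)
      ultimately show ?thesis by (simp add: dcoef_def)
    qed
  qed
  finally show ?thesis by simp
qed

lemma tau_comb_single:
  assumes "b < n"
  shows "tau_comb (\<lambda>i j. if j = b then c i else 0) = (\<Sum>i = 1..<r * b. triple_scale X (c i)
     (alphaU n l f X i b, - alphaV n r f X i b, h_fun X i b))"
proof -
  have "triple_scale X 0 T = 0" for T
    by (cases T) (simp add: triple_scale_def is_ring_hom_zero[OF U.cst_hom]
        is_ring_hom_zero[OF V.cst_hom] is_ring_hom_zero[OF UV.cst_hom] zero_prod_def)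
  then have "tau_comb (\<lambda>i j. if j = b then c i else 0) = (\<Sum>j<n. if j = b then (\<Sum>i = 1..<r * b. triple_scale X (c i)
     (alphaU n l f X i b, - alphaV n r f X i b, h_fun X i b)) else 0)"
    unfolding tau_comb_def by (intro sum.cong refl) auto
  then show ?thesis using assms by (simp add: sum.delta)
qed

text \<open>
  The decomposition described at the beginning, for any closed function that is a Laurent
  polynomial in \<open>t\<close> times \<open>y^b\<close>; the index sets \<open>AU\<close>, \<open>AV\<close>, \<open>AH\<close> are those of the monomials that are
  regular on \<open>U\<close>, regular on \<open>V\<close>, or basis functions.
\<close>
lemma P2_closed_function:
  fixes F :: "nat \<Rightarrow> 'k" and N d :: nat
  assumes \<tau>: "is_tau n l r f X \<tau>" and b: "1 \<le> b" "b \<le> n - 1"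
  defines "w \<equiv> (\<Sum>u\<le>d. cst (F u) * (zpow t (int u - int N) * y ^ b))"
  assumes closed: "kd w = 0"
  shows "P2 X \<tau> (DR_class X (0, 0, w)) = (\<Sum>m | m + 2 \<le> r * (n - b).
     H0_scale X (- (\<Sum>u | u \<le> d \<and> N < u + r * b. F u * dcoef b (int u - int N) (int m + 1 + int N - int u)))
       (omega X m (n - b)))" (is "_ = ?R")
proof -
  have bn: "b < n" using b n_pos by linarith
  define D where "D k = Lplus b k + Lminus b k" for k
  define AU where "AU = {u. u \<le> d \<and> N \<le> u}"
  define AV where "AV = {u. u \<le> d \<and> u + r * b \<le> N}"
  define AH where "AH = {u. u \<le> d \<and> N < u + r * b \<and> u < N}"
  have fin: "finite AU" "finite AV" "finite AH"
    unfolding AU_def AV_def AH_def by (auto intro: finite_subset[of _ "{..d}"])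
  have rb: "r * b > 0" using b rn by (cases r) auto
  then have above: "N < u + r * b" if "N \<le> u" for u using that by linarith
  have disj: "{..d} = AV \<union> (AH \<union> AU)" "AV \<inter> (AH \<union> AU) = {}" "AH \<inter> AU = {}"
    unfolding AU_def AV_def AH_def by (auto dest: above)
  have AHU: "AH \<union> AU = {u. u \<le> d \<and> N < u + r * b}"
    unfolding AU_def AH_def by (auto dest: above)
  have split: "sum g {..d} = sum g AV + (sum g AH + sum g AU)" for g :: "nat \<Rightarrow> 'c"
    unfolding disj(1) by (simp add: sum.union_disjoint fin disj)
  have splitU: "sum g {u. u \<le> d \<and> N < u + r * b} = sum g AH + sum g AU" for g :: "nat \<Rightarrow> 'c"
    unfolding AHU[symmetric] by (simp add: sum.union_disjoint fin disj)
  define hU where "hU = (\<Sum>u\<in>AU. cstU X (F u) * (tU X ^ (u - N) * yU X ^ b))"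
  define hV where "hV = (\<Sum>u\<in>AV. cstV X (F u) * (sV X ^ (N - (u + r * b)) * zV X ^ b))"
  define c where "c i = (if i \<le> N \<and> N - i \<le> d then F (N - i) else 0)" for i
  define C where "C i j = (if j = b then c i else 0)" for i j
  have reindex: "(\<Sum>i = 1..<r * b. G i (c i)) = (\<Sum>u\<in>AH. G (N - u) (F u))"
    if "\<And>i. G i 0 = 0" for G :: "nat \<Rightarrow> 'k \<Rightarrow> 'm::ab_group_add"
  proof -
    have "(\<Sum>u\<in>AH. G (N - u) (F u)) = (\<Sum>i | i \<in> {1..<r * b} \<and> i \<le> N \<and> N - i \<le> d. G i (c i))"
      by (rule sum.reindex_bij_witness[of _ "\<lambda>i. N - i" "\<lambda>u. N - u"]) (auto simp: AH_def c_def)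
    also have "\<dots> = (\<Sum>i = 1..<r * b. G i (c i))"
      by (rule sum.mono_neutral_left) (auto simp: c_def that)
    finally show ?thesis ..
  qed
  have reshU: "resU X hU = (\<Sum>u\<in>AU. cst (F u) * (zpow t (int u - int N) * y ^ b))"
    unfolding hU_def hom_sum[OF resU_hom]
  proof (rule sum.cong[OF refl])
    fix u assume "u \<in> AU"
    then have "int u - int N = int (u - N)" by (simp add: AU_def)
    then show "resU X (cstU X (F u) * (tU X ^ (u - N) * yU X ^ b)) = cst (F u) * (zpow t (int u - int N) * y ^ b)"
      by (simp only: zpow_nat hom_mult[OF resU_hom] hom_power[OF resU_hom] resU_gens)
  qed
  have reshV: "resV X hV = (\<Sum>u\<in>AV. cst (F u) * (zpow t (int u - int N) * y ^ b))"
    unfolding hV_def hom_sum[OF resV_hom]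
  proof (rule sum.cong[OF refl])
    fix u assume "u \<in> AV"
    then have "u + r * b \<le> N" by (simp add: AV_def)
    then have "int u - int N = - int ((N - (u + r * b)) + r * b)" by linarith
    then have z: "zpow t (int u - int N) = s ^ (N - (u + r * b)) * (s ^ r) ^ b"
      by (simp only: zpow_neg power_add power_mult)
    show "resV X (cstV X (F u) * (sV X ^ (N - (u + r * b)) * zV X ^ b)) = cst (F u) * (zpow t (int u - int N) * y ^ b)"
      unfolding z hom_mult[OF resV_hom] hom_power[OF resV_hom] resV_gens power_mult_distrib
      by (simp only: mult_ac)
  qed
  have hH: "(\<Sum>u\<in>AH. cst (F u) * h_fun X (N - u) b) = (\<Sum>u\<in>AH. cst (F u) * (zpow t (int u - int N) * y ^ b))"
  proof (rule sum.cong[OF refl])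
    fix u assume "u \<in> AH"
    then have "int u - int N = - int (N - u)" by (simp add: AH_def)
    then show "cst (F u) * h_fun X (N - u) b = cst (F u) * (zpow t (int u - int N) * y ^ b)"
      by (simp only: zpow_neg h_fun_def)
  qed
  have w_split: "w = resV X hV + ((\<Sum>u\<in>AH. cst (F u) * h_fun X (N - u) b) + resU X hU)"
    unfolding w_def reshU reshV hH split ..
  have kd_part: "kd (\<Sum>u\<in>A. cst (F u) * (zpow t (int u - int N) * y ^ b))
      = (\<Sum>u\<in>A. cst (F u) * D (int u - int N)) \<odot> W b" for A
    unfolding kd_sum kd_monomial[OF b(1)] D_def kaehler.scale_sum_left ..
  have D0: "(\<Sum>u\<le>d. cst (F u) * D (int u - int N)) = 0"
    using closed unfolding w_def kd_part by (rule W_free)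
  \<comment> \<open>The pair is a global differential because the three kinds of monomials add up to \<open>dw = 0\<close>.\<close>
  define \<omega>U where "\<omega>U = - (\<Sum>u\<in>AH. cstU X (F u) \<odot> alphaU n l f X (N - u) b) - kd hU"
  define \<omega>V where "\<omega>V = (\<Sum>u\<in>AH. cstV X (F u) \<odot> alphaV n r f X (N - u) b) + kd hV"
  have AH_int: "- int (N - u) = int u - int N" if "u \<in> AH" for u
    using that by (simp add: AH_def)
  have resU\<omega>: "kaehler_map (resU X) \<omega>U
      = - ((\<Sum>u\<in>AH. cst (F u) * Lplus b (int u - int N)) + (\<Sum>u\<in>AU. cst (F u) * D (int u - int N))) \<odot> W b"
    unfolding \<omega>U_def kaehler_map_diff[OF resU_hom] kaehler_map_uminus[OF resU_hom]
      kaehler_map_sum[OF resU_hom] kaehler_map_scale[OF resU_hom] kaehler_map_kd[OF resU_hom]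
      res_alphaU resU_gens reshU kd_part kscale_scale
    by (simp add: AH_int kaehler.scale_sum_left kaehler.scale_left_diff_distrib)
  have resV\<omega>: "kaehler_map (resV X) \<omega>V
      = ((\<Sum>u\<in>AH. cst (F u) * Lminus b (int u - int N)) + (\<Sum>u\<in>AV. cst (F u) * D (int u - int N))) \<odot> W b"
    unfolding \<omega>V_def kaehler_map_add[OF resV_hom]
      kaehler_map_sum[OF resV_hom] kaehler_map_scale[OF resV_hom] kaehler_map_kd[OF resV_hom]
      res_alphaV[OF b] resV_gens reshV kd_part kscale_scale
    by (simp add: AH_int kaehler.scale_sum_left kscale_add_left)
  have "- ((\<Sum>u\<in>AH. cst (F u) * Lplus b (int u - int N)) + (\<Sum>u\<in>AU. cst (F u) * D (int u - int N)))
      = (\<Sum>u\<in>AH. cst (F u) * Lminus b (int u - int N)) + (\<Sum>u\<in>AV. cst (F u) * D (int u - int N))"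
  proof (rule minus_unique)
    have "(\<Sum>u\<in>AH. cst (F u) * D (int u - int N))
        = (\<Sum>u\<in>AH. cst (F u) * Lplus b (int u - int N)) + (\<Sum>u\<in>AH. cst (F u) * Lminus b (int u - int N))"
      by (simp add: D_def distrib_left sum.distrib)
    then show "((\<Sum>u\<in>AH. cst (F u) * Lplus b (int u - int N)) + (\<Sum>u\<in>AU. cst (F u) * D (int u - int N)))
        + ((\<Sum>u\<in>AH. cst (F u) * Lminus b (int u - int N)) + (\<Sum>u\<in>AV. cst (F u) * D (int u - int N))) = 0"
      using D0 unfolding split by (simp add: add_ac)
  qed
  then have H0: "(\<omega>U, \<omega>V) \<in> H0 X" unfolding H0_def using resU\<omega> resV\<omega> by simp
  have DR: "DR_class X (0, 0, w) = DR_ident X \<tau> ((\<omega>U, \<omega>V), h_comb C +o H1_bd X)"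
  proof -
    have "tau_comb C = (\<Sum>u\<in>AH. triple_scale X (F u)
        (alphaU n l f X (N - u) b, - alphaV n r f X (N - u) b, h_fun X (N - u) b))"
      unfolding C_def tau_comb_single[OF bn]
      by (rule reindex) (simp add: triple_scale_def is_ring_hom_zero[OF U.cst_hom]
          is_ring_hom_zero[OF V.cst_hom] is_ring_hom_zero[OF UV.cst_hom] zero_prod_def)
    then have tc: "tau_comb C = (\<Sum>u\<in>AH. cstU X (F u) \<odot> alphaU n l f X (N - u) b,
        - (\<Sum>u\<in>AH. cstV X (F u) \<odot> alphaV n r f X (N - u) b), \<Sum>u\<in>AH. cst (F u) * h_fun X (N - u) b)"
      by (intro prod_eqI) (simp_all add: fst_sum snd_sum triple_scale_def sum_negf)
    have "(0, 0, w) - ((\<omega>U, \<omega>V, 0) + tau_comb C) = (kd hU, - kd hV, resU X hU + resV X hV)"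
      unfolding tc \<omega>U_def \<omega>V_def w_split by (simp add: algebra_simps)
    then have "(0, 0, w) - ((\<omega>U, \<omega>V, 0) + tau_comb C) \<in> DR_bd X"
      unfolding DR_bd_def by blast
    then show ?thesis
      by (simp add: DR_ident_def DR_class_def coset_add[OF DR_bd_subgroup] tau_h_comb[OF \<tau>]
          coset_eq_iff[OF DR_bd_subgroup])
  qed
  have "P2 X \<tau> (DR_class X (0, 0, w)) = (\<omega>U, \<omega>V)"
    unfolding DR by (rule P2_DR_ident[OF \<tau> H0]) (simp add: H1_def)
  also have "\<dots> = ?R"
  proof (rule H0_eqI[OF H0])
    have nb: "1 \<le> n - b" "n - b \<le> n - 1" using b n_pos by auto
    show "?R \<in> H0 X"
      by (intro H0_sum H0_scale_H0 omega_global(1)) (use nb in auto)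
    define Cm where "Cm m = (\<Sum>u | u \<le> d \<and> N < u + r * b. F u * dcoef b (int u - int N) (int m + 1 + int N - int u))" for m
    define L where "L = d + l + r * n"
    \<comment> \<open>Monomials with \<open>u + r b \<le> N\<close> would need a coefficient of \<open>f\<close> of index greater than \<open>l\<close>.\<close>
    have Cm0: "Cm m = 0" if "\<not> m + 2 \<le> r * (n - b)" for m
    proof -
      have "(\<Sum>u\<le>d. F u * dcoef b (int u - int N) (int m + 1 + int N - int u)) = 0"
        by (rule closed_coefficient[OF b(1)]) (use D0 in \<open>simp add: D_def\<close>)
      moreover have "(\<Sum>u\<le>d. F u * dcoef b (int u - int N) (int m + 1 + int N - int u)) = Cm m"
        unfolding Cm_def
      proof (rule sum.mono_neutral_right)
        show "\<forall>u\<in>{..d} - {u. u \<le> d \<and> N < u + r * b}. F u * dcoef b (int u - int N) (int m + 1 + int N - int u) = 0"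
        proof
          fix u assume "u \<in> {..d} - {u. u \<le> d \<and> N < u + r * b}"
          then have "u + r * b \<le> N" by auto
          moreover have "r * (n - b) + r * b = l + 1"
            unfolding rn[symmetric] distrib_left[symmetric] using bn by simp
          ultimately have "int l < int m + 1 + int N - int u" using that by linarith
          then have "icoeff f (int m + 1 + int N - int u) = 0"
            using degree_f by (auto simp: icoeff_def intro!: coeff_eq_0)
          then show "F u * dcoef b (int u - int N) (int m + 1 + int N - int u) = 0"
            by (simp add: dcoef_def)
        qed
      qed auto
      ultimately show ?thesis by simp
    qed
    have "(\<Sum>u\<in>AH. cst (F u) * Lplus b (int u - int N)) + (\<Sum>u\<in>AU. cst (F u) * D (int u - int N))
        = (\<Sum>u | u \<le> d \<and> N < u + r * b. cst (F u) * Lplus b (int u - int N))"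
      unfolding splitU by (simp add: AU_def D_def Lminus_eq_0)
    also have "\<dots> = (\<Sum>u | u \<le> d \<and> N < u + r * b. \<Sum>m\<le>L.
        cst (F u * dcoef b (int u - int N) (int m + 1 + int N - int u)) * t ^ m)"
    proof (rule sum.cong[OF refl])
      fix u assume "u \<in> {u. u \<le> d \<and> N < u + r * b}"
      then have "u + l \<le> L" by (simp add: L_def)
      then have "int u - int N + int l \<le> int L" by linarith
      from Lplus_expand[OF this, of b]
      show "cst (F u) * Lplus b (int u - int N)
          = (\<Sum>m\<le>L. cst (F u * dcoef b (int u - int N) (int m + 1 + int N - int u)) * t ^ m)"
        by (simp add: sum_distrib_left hom_mult[OF UV.cst_hom] mult.assoc algebra_simps)
    qed
    also have "\<dots> = (\<Sum>m\<le>L. cst (Cm m) * t ^ m)"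
      unfolding Cm_def hom_sum[OF UV.cst_hom] sum_distrib_right by (rule sum.swap)
    also have "\<dots> = (\<Sum>m | m + 2 \<le> r * (n - b). cst (Cm m) * t ^ m)"
    proof (rule sum.mono_neutral_right)
      have "r * (n - b) \<le> L" unfolding L_def by (rule trans_le_add2) (rule mult_le_mono2, simp)
      then show "{m. m + 2 \<le> r * (n - b)} \<subseteq> {..L}" by auto
    qed (auto simp: Cm0 is_ring_hom_zero[OF UV.cst_hom])
    finally have "kaehler_map (resU X) \<omega>U = - (\<Sum>m | m + 2 \<le> r * (n - b). cst (Cm m) * t ^ m) \<odot> W b"
      unfolding resU\<omega> by simp
    also have "\<dots> = (\<Sum>m | m + 2 \<le> r * (n - b). cst (- Cm m) \<odot> t ^ m \<odot> W b)"
      by (simp add: kaehler.scale_sum_left sum_negf hom_uminus[OF UV.cst_hom] kscale_scale)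
    also have "\<dots> = (\<Sum>m | m + 2 \<le> r * (n - b). kaehler_map (resU X) (cstU X (- Cm m) \<odot> fst (omega X m (n - b))))"
    proof (rule sum.cong[OF refl])
      fix m assume "m \<in> {m. m + 2 \<le> r * (n - b)}"
      then have m: "m + 2 \<le> r * (n - b)" by simp
      have "n - 1 = (b - 1) + (n - b)" using b n_pos by simp
      then have "y ^ (b - 1) * Y ^ (n - 1) = (y * Y) ^ (b - 1) * Y ^ (n - b)"
        by (simp only: power_add power_mult_distrib mult.assoc)
      then have "t ^ m \<odot> W b = (t ^ m * Y ^ (n - b)) \<odot> kd t" by (simp add: W_def kscale_scale yY)
      then show "cst (- Cm m) \<odot> t ^ m \<odot> W b = kaehler_map (resU X) (cstU X (- Cm m) \<odot> fst (omega X m (n - b)))"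
        by (simp only: kaehler_map_scale[OF resU_hom] resU_gens omega_global(2)[OF nb m])
    qed
    finally show "kaehler_map (resU X) (fst (\<omega>U, \<omega>V)) = kaehler_map (resU X) (fst ?R)"
      by (simp only: fst_conv fst_sum kaehler_map_sum[OF resU_hom] H0_scale_def Cm_def)
  qed
  finally show ?thesis .
qed

end

section \<open>The divided Frobenius\<close>

lemma kd_power_char:
  fixes \<iota> :: "'k::comm_ring_1 \<Rightarrow> 'a::comm_ring_1"
  assumes "is_ring_hom \<iota>" "of_nat p = (0::'k)"
  shows "kd ((x::'a) ^ p) = 0"
proof -
  have "of_nat p = (0::'a)"
    using hom_of_nat[OF assms(1), of p] by (simp add: assms(2) is_ring_hom_zero[OF assms(1)])
  then show ?thesis by (simp add: kd_power)
qed

context superelliptic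
begin

text \<open>
  A representative of \<open>h'_ij\<close> differs from \<open>t^(-i) y^j\<close> by \<open>u + u'\<close> with \<open>u\<close> regular on \<open>U'\<close> and \<open>u'\<close> on
  \<open>V'\<close>.  The relative Frobenius commutes with restriction, and its image consists of functions with
  zero differential; so the difference is mapped to the coboundary \<open>(0, 0, FU u + FV u')\<close>.
\<close>
lemma DI_map_hbar:
  fixes X' :: "('k, 'd::comm_ring_1, 'e::comm_ring_1, 'g::comm_ring_1) covered_curve"
  assumes X': "superelliptic_curve n r g g2 X'"
    and frob: "relative_frobenius p X X' FU FV FUV"
    and homotopy: "frobenius_homotopy p v X X' FU FV FUV fU fV h"
    and char_p: "of_nat p = (0::'k)"
  shows "DI_map X X' FUV fU fV h (0, hbar X' i j) = DR_class X (0, 0, s ^ (p * i) * y ^ (p * j))"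
proof -
  interpret U': affine_curve n g "monom 1 1" "cstU X'" "tU X'" "yU X'"
    using X' n_pos n_unit by unfold_locales (simp_all add: superelliptic_curve_def)
  interpret V': affine_curve n g2 1 "cstV X'" "sV X'" "zV X'"
    using X' n_pos n_unit by unfold_locales (simp_all add: superelliptic_curve_def)
  interpret UV': affine_curve n g "monom (monom 1 1) 1" "cstUV X'" "tUV X'" "yUV X'"
    using X' n_pos n_unit by unfold_locales (simp_all add: superelliptic_curve_def)
  have hom': "is_ring_hom (resU X')" "is_ring_hom (resV X')"
    and gens': "resU X' (cstU X' c) = cstUV X' c" "resU X' (tU X') = tUV X'" "resU X' (yU X') = yUV X'"
      "resV X' (cstV X' c) = cstUV X' c" "resV X' (sV X') = unit_inv (tUV X')"
      "resV X' (zV X') = unit_inv (tUV X') ^ r * yUV X'" for c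
    using X' by (auto simp: superelliptic_curve_def fun_eq_iff)
  have FU: "is_ring_hom FU" "FU (cstU X' c) = cstU X c" "FU (tU X') = tU X ^ p" "FU (yU X') = yU X ^ p"
    and FV: "is_ring_hom FV" "FV (cstV X' c) = cstV X c" "FV (sV X') = sV X ^ p" "FV (zV X') = zV X ^ p"
    and FUV: "is_ring_hom FUV" "FUV (cstUV X' c) = cst c" "FUV (tUV X') = t ^ p" "FUV (yUV X') = y ^ p" for c
    using frob by (auto simp: relative_frobenius_def fun_eq_iff)
  have "tUV X' * yUV X' dvd 1"
    using UV'.H_unit by (simp add: UV'.E2_monom ev_monom[OF UV'.cst_hom] hom_1[OF UV'.cst_hom])
  then have t'_unit: "tUV X' dvd 1" by (rule dvd_mult_left)
  have s': "FUV (unit_inv (tUV X')) = s ^ p"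
    unfolding hom_unit_inv[OF FUV(1) t'_unit] FUV(3) by (rule unit_inv_eqI) (rule pow_ts)
  have resFU: "FUV (resU X' u) = resU X (FU u)" for u
    by (rule U'.hom_eqI[OF hom_comp[OF hom'(1) FUV(1)] hom_comp[OF FU(1) resU_hom]])
      (simp_all add: gens' FU FUV resU_gens hom_power[OF resU_hom])
  have resFV: "FUV (resV X' u) = resV X (FV u)" for u
  proof (rule V'.hom_eqI[OF hom_comp[OF hom'(2) FUV(1)] hom_comp[OF FV(1) resV_hom]])
    show "FUV (resV X' (zV X')) = resV X (FV (zV X'))"
      unfolding gens' FV hom_mult[OF FUV(1)] hom_power[OF FUV(1)] hom_power[OF resV_hom] s' FUV resV_gens
        power_mult_distrib power_mult[symmetric] by (simp only: mult.commute[of r p])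
  qed (simp_all add: gens' FV FUV s' resV_gens hom_power[OF resV_hom])
  have dFU: "kd (FU u) = 0" for u
    by (rule U'.kd_hom_eq_0[OF FU(1)]) (simp_all add: FU kd_power_char[OF U.cst_hom char_p])
  have dFV: "kd (FV u) = 0" for u
    by (rule V'.kd_hom_eq_0[OF FV(1)]) (simp_all add: FV kd_power_char[OF V.cst_hom char_p])
  define x' where "x' = (SOME x'. x' \<in> hbar X' i j)"
  have "resU X' 0 + resV X' 0 \<in> H1_bd X'"
    unfolding H1_bd_def by (intro set_plus_intro rangeI)
  then have "0 \<in> H1_bd X'"
    by (simp add: is_ring_hom_zero[OF hom'(1)] is_ring_hom_zero[OF hom'(2)])
  then have "h_fun X' i j + 0 \<in> hbar X' i j" unfolding hbar_def by (rule set_plus_intro2)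
  then have "x' \<in> hbar X' i j" unfolding x'_def by (rule someI)
  then obtain u u' where x': "x' = h_fun X' i j + (resU X' u + resV X' u')"
    by (auto simp: hbar_def elt_set_plus_def H1_bd_def set_plus_def)
  have "FUV (h_fun X' i j) = s ^ (p * i) * y ^ (p * j)"
    by (simp add: h_fun_def hom_mult[OF FUV(1)] hom_power[OF FUV(1)] s' FUV power_mult)
  then have "FUV x' = s ^ (p * i) * y ^ (p * j) + (resU X (FU u) + resV X (FV u'))"
    by (simp add: x' hom_add[OF FUV(1)] resFU resFV)
  then have "(0, 0, FUV x') - (0, 0, s ^ (p * i) * y ^ (p * j))
      = (kd (FU u), - kd (FV u'), resU X (FU u) + resV X (FV u'))"
    by (simp add: dFU dFV)
  then have "(0, 0, FUV x') - (0, 0, s ^ (p * i) * y ^ (p * j)) \<in> DR_bd X"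
    unfolding DR_bd_def by blast
  then have cls: "DR_class X (0, 0, FUV x') = DR_class X (0, 0, s ^ (p * i) * y ^ (p * j))"
    unfolding DR_class_def coset_eq_iff[OF DR_bd_subgroup] .
  have lin: "fU (\<omega> + \<eta>) = fU \<omega> + fU \<eta>" "fV (\<omega>' + \<eta>') = fV \<omega>' + fV \<eta>'"
    "h (\<omega>'' + \<eta>'') = h \<omega>'' + h \<eta>''" for \<omega> \<eta> \<omega>' \<eta>' \<omega>'' \<eta>''
    using homotopy by (simp_all add: frobenius_homotopy_def linear_over_def)
  have "fU 0 = 0" "fV 0 = 0" "h 0 = 0" using lin(1)[of 0 0] lin(2)[of 0 0] lin(3)[of 0 0] by simp_all
  then have "DI_map X X' FUV fU fV h (0, hbar X' i j) = DR_class X (0, 0, 0) + DR_class X (0, 0, FUV x')"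
    by (simp add: DI_map_def x'_def kaehler_map_zero[OF hom'(1)])
  also have "\<dots> = DR_class X (0, 0, FUV x')"
    unfolding DR_class_def coset_add[OF DR_bd_subgroup] by simp
  finally show ?thesis unfolding cls .
qed

lemma monomial_expansion:
  assumes "b = e mod n" "F = f ^ (e div n)"
  shows "s ^ N * y ^ e = (\<Sum>u\<le>degree F. cst (coeff F u) * (zpow t (int u - int N) * y ^ b))"
proof -
  have "y ^ e = y ^ (n * (e div n) + b)" by (simp add: assms(1))
  also have "\<dots> = UV.E F * y ^ b"
    by (simp only: power_add power_mult UV.y_power assms(2) hom_power[OF UV.E_hom])
  finally have "s ^ N * y ^ e = UV.E F * (s ^ N * y ^ b)" by (simp only: mult_ac)
  also have "\<dots> = (\<Sum>u\<le>degree F. cst (coeff F u) * (zpow t (int u - int N) * y ^ b))"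
    unfolding ev_sum[OF UV.cst_hom order_refl] sum_distrib_right
  proof (rule sum.cong[OF refl])
    fix u
    have "zpow t (int u - int N) = t ^ u * s ^ N"
      using zpow_add[OF t_unit, of "int u" "- int N"] by (simp add: zpow_nat zpow_neg)
    then show "cst (coeff F u) * t ^ u * (s ^ N * y ^ b) = cst (coeff F u) * (zpow t (int u - int N) * y ^ b)"
      by (simp only: mult_ac)
  qed
  finally show ?thesis .
qed

text \<open>
  The substitution \<open>k = N - u\<close>.  Indices \<open>k > N\<close> do not come from any \<open>u \<ge> 0\<close>, but there the
  coefficient of \<open>F\<close> is zero by convention.
\<close>
lemma coefficient_reindex:
  assumes "d = degree F"
  shows "- (\<Sum>u | u \<le> d \<and> N < u + r * b. coeff F u * dcoef b (int u - int N) (int m + 1 + int N - int u))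
    = (\<Sum>k = int N - int d..int (r * b) - 1.
        of_int (k * int n - int b * (int m + k + 1)) / of_nat n * icoeff F (int N - k) * icoeff f (int m + k + 1))"
    (is "_ = sum ?g _")
proof -
  have "- (\<Sum>u | u \<le> d \<and> N < u + r * b. coeff F u * dcoef b (int u - int N) (int m + 1 + int N - int u))
      = (\<Sum>u | u \<le> d \<and> N < u + r * b. ?g (int N - int u))"
    unfolding sum_negf[symmetric]
  proof (rule sum.cong[OF refl])
    fix u
    define k where "k = int N - int u"
    have 1: "int u - int N = - k" "int m + 1 + int N - int u = int m + k + 1" "int N - k = int u"
      by (simp_all add: k_def)
    have 2: "int b * (int m + k + 1) + - k * int n = - (k * int n - int b * (int m + k + 1))" by simp
    have 3: "icoeff F (int u) = coeff F u" by (simp add: icoeff_def)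
    show "- (coeff F u * dcoef b (int u - int N) (int m + 1 + int N - int u)) = ?g (int N - int u)"
      unfolding k_def[symmetric] 1 3 dcoef_def 2 of_int_minus
      by (simp only: minus_divide_left[symmetric] mult_minus_left mult_minus_right minus_minus mult_ac)
  qed
  also have "\<dots> = (\<Sum>k | k \<in> {int N - int d..int (r * b) - 1} \<and> k \<le> int N. ?g k)"
    by (rule sum.reindex_bij_witness[of _ "\<lambda>k. nat (int N - k)" "\<lambda>u. int N - int u"])
      (simp_all del: of_nat_mult, linarith+)
  also have "\<dots> = (\<Sum>k = int N - int d..int (r * b) - 1. ?g k)"
    by (rule sum.mono_neutral_left) (auto simp: icoeff_def)
  finally show ?thesis .
qed

end

theorem proposition6p2:
  fixes p n l r i j a b d :: nat
    and \<pi> :: "'w::idom \<Rightarrow> 'k::finite_field"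
    and \<sigma> :: "'w \<Rightarrow> 'w"
    and ff ff2 :: "'w poly"
    and f f2 v c F :: "'k poly"
    and X :: "('k, 'a::comm_ring_1, 'b::comm_ring_1, 'c::comm_ring_1) covered_curve"
    and X' :: "('k, 'd::comm_ring_1, 'e::comm_ring_1, 'g::comm_ring_1) covered_curve"
    and \<tau> :: "'c set \<Rightarrow> 'a kaehler \<times> 'b kaehler \<times> 'c"
    and FU :: "'d \<Rightarrow> 'a" and FV :: "'e \<Rightarrow> 'b" and FUV :: "'g \<Rightarrow> 'c"
    and fU :: "'d kaehler \<Rightarrow> 'a kaehler" and fV :: "'e kaehler \<Rightarrow> 'b kaehler"
    and h :: "'g kaehler \<Rightarrow> 'c"
    and \<Phi> :: "('a kaehler \<times> 'b kaehler) \<times> 'c set \<Rightarrow> ('a kaehler \<times> 'b kaehler \<times> 'c) set"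
  assumes "prime p" and "CHAR('k) = p"
    and "witt_ring p \<pi>" and "frobenius_lift p \<pi> \<sigma>"
    and "n \<ge> 1" and "coprime n p"
    and "l \<ge> 1" and "[int l = -1] (mod int n)" and "\<not> p dvd l"
    and "r = (l + 1) div n"
    and "degree ff = l" and "\<exists>A B. A * ff + B * pderiv ff = 1"
    and "ff2 = flip_poly l ff"
    and "f = map_poly \<pi> ff" and "f2 = map_poly \<pi> ff2"
    and "degree f = l" and "poly f 0 \<noteq> 0"
    and "superelliptic_curve n r f f2 X"
    and "superelliptic_curve n r (map_poly (\<lambda>x. x ^ p) f) (map_poly (\<lambda>x. x ^ p) f2) X'"
    and "is_tau n l r f X \<tau>"
    and "\<exists>Q. map_poly \<pi> Q = v * pderiv f2 ^ p - of_nat n * c * f2 ^ p \<and>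
           [:of_nat (p ^ 2):] dvd
             ff2 ^ p - pcompose (map_poly \<sigma> ff2) (monom 1 p) - of_nat p * Q"
    and "relative_frobenius p X X' FU FV FUV"
    and "frobenius_homotopy p v X X' FU FV FUV fU fV h"
    and "divided_frobenius p n r X X' (DI_map X X' FUV fU fV h) \<Phi>"
    and "1 \<le> j" and "j \<le> n - 1" and "1 \<le> i" and "i \<le> r * j - 1"
    and "a = (p * j) div n" and "b = (p * j) mod n"
    and "F = f ^ a" and "d = degree F"
  shows "1 \<le> b \<and> b \<le> n - 1 \<and>
    P2 X \<tau> (\<Phi> (0, hbar X i j)) =
      (\<Sum>m | m + 2 \<le> r * (n - b).
         H0_scale X
           (\<Sum>k = int (p * i) - int d..int (r * b) - 1.
              of_int (k * int n - int b * (int m + k + 1)) / of_nat n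
                * icoeff F (int (p * i) - k) * icoeff f (int m + k + 1))
           (omega X m (n - b)))"
proof -
  have p0: "of_nat p = (0::'k)" using of_nat_CHAR[where 'a = 'k] assms(2) by simp
  have n_unit: "of_nat n \<noteq> (0::'k)"
  proof
    assume "of_nat n = (0::'k)"
    then have "p dvd n" using assms(2) by (simp add: of_nat_eq_0_iff_char_dvd)
    then have "is_unit p" using assms(6) by (metis coprime_common_divisor dvd_refl)
    then show False using assms(1) by simp
  qed
  have "int n dvd int l - - 1" using assms(8) by (simp only: cong_iff_dvd_diff)
  then have "int n dvd int (l + 1)" by (simp add: add.commute)
  then have "n dvd l + 1" by (simp only: int_dvd_int_iff)
  then have rn: "r * n = l + 1" using assms(10) by simp
  have \<pi>: "is_ring_hom \<pi>" using assms(3) by (simp add: witt_ring_def)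
  have f2: "f2 = flip_poly l f"
    by (rule poly_eqI)
      (simp add: assms(13-15) coeff_map_poly[of \<pi>, OF is_ring_hom_zero[OF \<pi>]] coeff_flip is_ring_hom_zero[OF \<pi>])
  obtain A B where AB: "A * ff + B * pderiv ff = 1" using assms(12) by blast
  have pderiv: "map_poly \<pi> (pderiv ff) = pderiv f"
    by (rule poly_eqI)
      (simp add: assms(14) coeff_map_poly[of \<pi>, OF is_ring_hom_zero[OF \<pi>]] coeff_pderiv
        hom_mult[OF \<pi>] hom_of_nat[OF \<pi>] hom_add[OF \<pi>] hom_1[OF \<pi>])
  note \<pi>p = map_poly_hom[OF \<pi>]
  have "map_poly \<pi> A * f + map_poly \<pi> B * pderiv f = 1"
    using arg_cong[OF AB, of "map_poly \<pi>"]
    unfolding hom_add[OF \<pi>p] hom_mult[OF \<pi>p] hom_1[OF \<pi>p] pderiv assms(14) .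
  then have bezout: "\<exists>A B. A * f + B * pderiv f = 1" by blast
  interpret superelliptic n l r f X
    using assms(18,5,7,16,17) n_unit rn bezout unfolding f2 by unfold_locales simp_all
  have "\<not> n dvd p * j"
  proof
    assume "n dvd p * j"
    then have "n dvd j" using assms(6) by (simp add: coprime_dvd_mult_right_iff)
    then show False using assms(25,26) by (auto dest: dvd_imp_le)
  qed
  then have "b \<noteq> 0" unfolding assms(30) by (simp add: dvd_eq_mod_eq_0)
  moreover have "b < n" unfolding assms(30) using n_pos by simp
  ultimately have b: "1 \<le> b" "b \<le> n - 1" by simp_all
  define w where "w = s ^ (p * i) * y ^ (p * j)"
  have "w = (s ^ i * y ^ j) ^ p"
    by (simp add: w_def power_mult_distrib power_mult[symmetric] mult.commute)
  then have "kd w = 0" by (simp add: kd_power_char[OF UV.cst_hom p0])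
  have w: "w = (\<Sum>u\<le>d. cst (coeff F u) * (zpow t (int u - int (p * i)) * y ^ b))"
    unfolding w_def assms(32) by (rule monomial_expansion) (simp_all add: assms(29-31))
  have "\<Phi> (0, hbar X i j) = DI_map X X' FUV fU fV h (0, hbar X' i j)"
    using assms(24-28) unfolding divided_frobenius_def by blast
  also have "\<dots> = DR_class X (0, 0, w)"
    unfolding w_def by (rule DI_map_hbar[OF assms(19,22,23) p0])
  finally have "P2 X \<tau> (\<Phi> (0, hbar X i j)) = P2 X \<tau> (DR_class X (0, 0, w))" by simp
  also have "\<dots> = (\<Sum>m | m + 2 \<le> r * (n - b). H0_scale X
      (- (\<Sum>u | u \<le> d \<and> p * i < u + r * b. coeff F u * dcoef b (int u - int (p * i)) (int m + 1 + int (p * i) - int u)))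
      (omega X m (n - b)))"
    unfolding w by (rule P2_closed_function[OF assms(20) b]) (use \<open>kd w = 0\<close> w in simp)
  finally show ?thesis using b unfolding coefficient_reindex[OF assms(32)] by blast
qed

end
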